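(* Let $d\ge 1$ and let $\omega=(\omega(v))_{v\in\mathbb{Z}^d}$ be a finitely supported vector of non-negative reals with $\sum_{v}\omega(v)=1$, which is centered ($\sum_v \omega(v)v=0$), symmetric ($\omega(-v)=\omega(v)$ for all $v$), and aperiodic, and whose covariance matrix $Q=\sum_{v\in\mathbb{Z}^d}\omega(v)vv^\top$ has full rank. Let $(x_n)_{n\ge 0}$ be the iterates of the Jacobi polynomial iteration on $\mathbb{Z}^d$ initialized at $x_0={\boldsymbol 1}_0$ (defined in the context). Let $$u(t,y)=\frac{\Gamma(d/2+1)}{\pi^{d/2}(\det Q)^{1/2}}\,\frac{1}{t^d}\,{\boldsymbol 1}_{\{\langle y,Q^{-1}y\rangle\le t^2\}},\qquad t>0,\ y\in\mathbb{R}^d.$$ Then for every $t>0$, the signed measures $\sum_{v\in\mathbb{Z}^d}x_{\lfloor t/\varepsilon\rfloor}(v)\,\delta_{\varepsilon v}$ converge weakly (i.e., against bounded continuous test functions) to the measure $u(t,y)\,\mathrm{d}y$ as $\varepsilon\to 0$.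
   Context: ${\boldsymbol 1}_v$ denotes the vector in $\mathbb{R}^{\mathbb{Z}^d}$ with entry $1$ at $v$ and $0$ elsewhere; $\delta_y$ is the Dirac mass at $y\in\mathbb{R}^d$; $\lfloor s\rfloor$ is the integer part. The convolution is $(\omega*x)(v)=\sum_{\eta\in\mathbb{Z}^d}\omega(v-\eta)x(\eta)$. $\omega$ is called aperiodic if the random walk on $\mathbb{Z}^d$ with increments distributed according to $\omega$ is an aperiodic Markov chain. The Jacobi polynomial iteration is: $x_0={\boldsymbol 1}_0$, $x_1=a_0\,\omega*x_0+b_0x_0$, and $x_{n+1}=a_n\,\omega*x_n+b_nx_n-c_nx_{n-1}$ for $n\ge1$, where $a_0=\frac{d+4}{2(2+d)}$, $b_0=\frac{d}{2(2+d)}$, and for $n\ge 1$: $a_n=\frac{(2n+d/2+1)(2n+d/2+2)}{2(n+1+d/2)^2}$, $b_n=\frac{d^2(2n+d/2+1)}{8(n+1+d/2)^2(2n+d/2)}$, $c_n=\frac{n^2(2n+d/2+2)}{(n+1+d/2)^2(2n+d/2)}$. *)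

theory Defs
  imports "HOL-Analysis.Analysis"
begin

text \<open>Lattice points of Z^d are int^'n, points of R^d are real^'n, with d = CARD('n).\<close>

definition rvec :: "int^'n \<Rightarrow> real^'n" where
  "rvec v = (\<chi> i. real_of_int (v $ i))"

definition unitv :: "int^'n \<Rightarrow> int^'n \<Rightarrow> real" where
  "unitv a v = (if v = a then 1 else 0)"

definition conv :: "(int^'n \<Rightarrow> real) \<Rightarrow> (int^'n \<Rightarrow> real) \<Rightarrow> int^'n \<Rightarrow> real" where
  "conv \<omega> x v = infsum (\<lambda>\<eta>. \<omega> (v - \<eta>) * x \<eta>) UNIV"

fun walk_law :: "(int^'n \<Rightarrow> real) \<Rightarrow> nat \<Rightarrow> int^'n \<Rightarrow> real" where
  "walk_law \<omega> 0 = unitv 0"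
| "walk_law \<omega> (Suc n) = conv \<omega> (walk_law \<omega> n)"

text \<open>Aperiodic: the period gcd{n >= 1. P^n(0,0) > 0} of the random walk equals 1
  (by translation invariance all states have the same period).\<close>
definition aperiodic :: "(int^'n \<Rightarrow> real) \<Rightarrow> bool" where
  "aperiodic \<omega> \<longleftrightarrow> Gcd {n::nat. n \<ge> 1 \<and> walk_law \<omega> n 0 > 0} = 1"

definition covariance :: "(int^'n \<Rightarrow> real) \<Rightarrow> real^'n^'n" where
  "covariance \<omega> = (\<chi> i j. \<Sum>v\<in>{v. \<omega> v \<noteq> 0}. \<omega> v * (rvec v $ i) * (rvec v $ j))"

definition ja0 :: "real \<Rightarrow> real" where "ja0 d = (d + 4) / (2 * (2 + d))"
definition jb0 :: "real \<Rightarrow> real" where "jb0 d = d / (2 * (2 + d))"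
definition ja :: "real \<Rightarrow> nat \<Rightarrow> real" where
  "ja d n = (2 * real n + d/2 + 1) * (2 * real n + d/2 + 2) / (2 * (real n + 1 + d/2)^2)"
definition jb :: "real \<Rightarrow> nat \<Rightarrow> real" where
  "jb d n = d^2 * (2 * real n + d/2 + 1) / (8 * (real n + 1 + d/2)^2 * (2 * real n + d/2))"
definition jc :: "real \<Rightarrow> nat \<Rightarrow> real" where
  "jc d n = (real n)^2 * (2 * real n + d/2 + 2) / ((real n + 1 + d/2)^2 * (2 * real n + d/2))"

fun jacobi :: "(int^'n \<Rightarrow> real) \<Rightarrow> nat \<Rightarrow> int^'n \<Rightarrow> real" where
  "jacobi \<omega> 0 = unitv 0"
| "jacobi \<omega> (Suc 0) =
     (\<lambda>v. ja0 (real CARD('n)) * conv \<omega> (unitv 0) v + jb0 (real CARD('n)) * unitv 0 v)"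
| "jacobi \<omega> (Suc (Suc n)) =
     (\<lambda>v. ja (real CARD('n)) (Suc n) * conv \<omega> (jacobi \<omega> (Suc n)) v
        + jb (real CARD('n)) (Suc n) * jacobi \<omega> (Suc n) v
        - jc (real CARD('n)) (Suc n) * jacobi \<omega> n v)"

definition limit_density :: "real^'n^'n \<Rightarrow> real \<Rightarrow> real^'n \<Rightarrow> real" where
  "limit_density Q t y =
     Gamma (real CARD('n) / 2 + 1) / (pi powr (real CARD('n) / 2) * sqrt (det Q))
     * (1 / t ^ CARD('n))
     * (if y \<bullet> (matrix_inv Q *v y) \<le> t^2 then 1 else 0)"

end

theory Submission
  imports Defs "HOL-Probability.Distributions" "HOL-Computational_Algebra.Polynomial"
begin

text \<open>
  Write \<open>d\<close> for the dimension, \<open>\<alpha> = d/2\<close>, and \<open>z(\<xi>) = (1 - \<omega>^(\<xi>))/2\<close>, which lies in \<open>[0, 1]\<close> as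
  \<open>\<omega>\<close> is symmetric. The Fourier transform of \<open>x\<^sub>n\<close> at \<open>\<xi>\<close> is \<open>P\<^sub>n(z(\<xi>))\<close>, where
  \<open>P\<^sub>n(z) = \<^sub>2F\<^sub>1(-n, n + \<alpha> + 1; \<alpha> + 1; z)\<close> is the Jacobi polynomial of parameters \<open>(\<alpha>, 0)\<close>
  normalised at the right end point.

  Convergence of the Fourier transforms: near the origin \<open>n\<^sup>2 z(\<epsilon>\<xi>)\<close> tends to
  \<open>t\<^sup>2 \<langle>\<xi>, Q\<xi>\<rangle>/4\<close>, so the Mehler-Heine asymptotics give a Bessel-type power series,
  which is the Fourier transform of the uniform law on the ellipsoid.

  Since the \<open>x\<^sub>n\<close> are signed, a uniform bound on their \<open>l\<^sup>1\<close> norms is needed as well. The support of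
  \<open>x\<^sub>n\<close> has \<open>O(n\<^sup>d)\<close> points, so by Cauchy-Schwarz and Parseval it suffices that the integral of
  \<open>P\<^sub>n(z(\<xi>))\<^sup>2\<close> over the torus is \<open>O(n\<^sup>-\<^sup>d)\<close>. Aperiodicity keeps \<open>z\<close> away from \<open>1\<close>, where an energy
  argument for the Jacobi differential equation bounds \<open>P\<^sub>n(z)\<^sup>2 (1 + n\<^sup>2 z)\<close> with exponent
  \<open>(d+1)/2\<close> on the second factor; the full rank of \<open>Q\<close> bounds \<open>z\<close> from below by the squared distances of \<open>d\<close>
  independent integral linear forms to the integers. All the measures live in a common compact set,
  so trigonometric polynomials suffice as test functions.
\<close>

section \<open>Lebesgue measure under linear maps\<close>

text \<open>Convergence of the transforms at a fixed \<open>\<xi>\<close> sees only lattice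
  frequencies of order 1/n; the l1 bound has to control the whole torus. The exponent is the
  classical one: \<open>P\<^sub>n(z)\<close> decays like n sqrt(z) to the power -(\<alpha> + 1/2),
  so its square carries \<open>n^2 z\<close> to the power -(d+1)/2. As \<open>z\<close> vanishes
  quadratically, an integral of size n^-d asks for an exponent above d/2, so 1/2 is left to spare.
  The size n^-d is natural: the limit is a constant density, so values of order n^-d on order n^d
  points are expected, and there Cauchy-Schwarz loses only a constant. Two obstacles shape the
  estimate. The constant of the energy argument blows up as \<open>z\<close> approaches 1. And d
  independent vectors of the support need not generate the lattice, so the lower bound for
  \<open>z\<close> may vanish at further points of the torus; they are finitely many, and each costs
  another O(n^-d). Sharing the exponent among the d linear forms makes the integral a product of
  one-dimensional ones after a linear change of variables, which also straightens the ellipsoid of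
  the limit.\<close>

lemma bij_betw_axis_Basis: "bij_betw (\<lambda>i::'n::finite. axis i (1::real)) UNIV Basis"
  by (auto simp: bij_betw_def inj_on_def axis_eq_axis Basis_vec_def)

lemma prod_Basis_vec:
  "(\<Prod>b\<in>(Basis::(real^'n) set). g b) = (\<Prod>i\<in>UNIV. g (axis i 1))"
  by (rule prod.reindex_bij_betw[OF bij_betw_axis_Basis, symmetric])

lemma measurable_vec_lambda_PiM [measurable]:
  "(\<lambda>f. \<chi> i::'n. f i) \<in> (\<Pi>\<^sub>M i\<in>(UNIV::'n::finite set). (lborel::real measure)) \<rightarrow>\<^sub>M borel"
proof (subst borel_measurable_euclidean_space, intro ballI)
  fix b :: "real^'n" assume "b \<in> Basis"
  then obtain i where b: "b = axis i 1" by (auto simp: Basis_vec_def)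
  have "(\<lambda>f. f i) \<in> (\<Pi>\<^sub>M i\<in>(UNIV::'n set). (lborel::real measure)) \<rightarrow>\<^sub>M lborel"
    by (rule measurable_component_singleton) simp
  then show "(\<lambda>f. (\<chi> i. f i) \<bullet> b) \<in> borel_measurable (\<Pi>\<^sub>M i\<in>(UNIV::'n set). lborel)"
    by (simp add: b inner_axis)
qed

text \<open>Identifying vectors with functions on the index type makes Fubini in a single coordinate
  and product integrals available. Boxes are products of intervals, and they determine the
  measure.\<close>

lemma lborel_vec_eq_distr_PiM:
  "(lborel :: (real^'n) measure) = distr (\<Pi>\<^sub>M i\<in>(UNIV::'n::finite set). lborel) borel (\<lambda>f. \<chi> i. f i)"
proof (rule lborel_eqI)
  fix l u :: "real^'n"
  assume le: "\<And>b. b \<in> Basis \<Longrightarrow> l \<bullet> b \<le> u \<bullet> b"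
  interpret product_sigma_finite "\<lambda>_::'n. (lborel::real measure)" by standard
  have le': "l $ i \<le> u $ i" for i
    using le[of "axis i 1"] by (simp add: inner_axis)
  have eq: "(\<lambda>f. \<chi> i::'n. f i) -` box l u \<inter> space (\<Pi>\<^sub>M i\<in>(UNIV::'n set). (lborel::real measure))
      = (\<Pi>\<^sub>E i\<in>UNIV. {l $ i <..< u $ i})"
    by (auto simp: mem_box_cart space_PiM PiE_iff)
  have "emeasure (distr (\<Pi>\<^sub>M i\<in>(UNIV::'n set). lborel) borel (\<lambda>f. \<chi> i. f i)) (box l u)
      = (\<Prod>i\<in>UNIV. ennreal (u $ i - l $ i))"
    using le' by (simp add: emeasure_distr eq emeasure_PiM)
  also have "\<dots> = (\<Prod>b\<in>Basis. (u - l) \<bullet> b)"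
    using le' by (simp add: prod_Basis_vec inner_axis prod_ennreal)
  finally show "emeasure (distr (\<Pi>\<^sub>M i\<in>(UNIV::'n set). lborel) borel (\<lambda>f. \<chi> i. f i)) (box l u)
      = (\<Prod>b\<in>Basis. (u - l) \<bullet> b)" .
qed simp

text \<open>The values lie in a general normed field because the same fact serves complex
  characters, Gaussian factors and real decay factors.\<close>

lemma
  fixes f :: "'n::finite \<Rightarrow> real \<Rightarrow> 'b::{real_normed_field,banach,second_countable_topology}"
  assumes f: "\<And>i. integrable lborel (f i)"
  shows integrable_lborel_vec_prod: "integrable lborel (\<lambda>x::real^'n. \<Prod>i\<in>UNIV. f i (x $ i))"
    and integral_lborel_vec_prod:
      "(LINT x|lborel. (\<Prod>i\<in>UNIV. f i (x $ i))) = (\<Prod>i\<in>UNIV. LINT t|lborel. f i t)"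
proof -
  interpret product_sigma_finite "\<lambda>_::'n. (lborel::real measure)" by standard
  have [measurable]: "f i \<in> borel_measurable borel" for i
    using f[of i] by auto
  have m: "(\<lambda>x::real^'n. \<Prod>i\<in>UNIV. f i (x $ i)) \<in> borel_measurable borel"
    by measurable
  show "integrable lborel (\<lambda>x::real^'n. \<Prod>i\<in>UNIV. f i (x $ i))"
    by (subst lborel_vec_eq_distr_PiM, subst integrable_distr_eq[OF _ m])
      (use product_integrable_prod[of UNIV f] f in auto)
  show "(LINT x|lborel. (\<Prod>i\<in>UNIV. f i (x $ i))) = (\<Prod>i\<in>UNIV. LINT t|lborel. f i t)"
    by (subst lborel_vec_eq_distr_PiM, subst integral_distr[OF _ m])
      (use product_integral_prod[of UNIV f] f in auto)
qed

text \<open>With all coordinates but \<open>m\<close> frozen, the shear translates the remaining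
  line by \<open>x n\<close>, and Lebesgue measure on the line is translation invariant.\<close>

lemma lborel_vec_shear:
  fixes m n :: "'n::finite"
  assumes mn: "m \<noteq> n"
  shows "(lborel :: (real^'n) measure) = distr lborel borel (\<lambda>x. \<chi> i. if i = m then x $ m + x $ n else x $ i)"
    (is "_ = distr lborel borel ?T")
proof (rule measure_eqI)
  fix X assume "X \<in> sets (lborel :: (real^'n) measure)"
  then have [measurable]: "X \<in> sets borel" by simp
  interpret product_sigma_finite "\<lambda>_::'n. (lborel::real measure)" by standard
  have T[measurable]: "?T \<in> borel \<rightarrow>\<^sub>M borel"
  proof (intro borel_measurable_continuous_onI continuous_on_vec_lambda)
    show "continuous_on UNIV (\<lambda>x::real^'n. if i = m then x $ m + x $ n else x $ i)" for i
      by (cases "i = m") (auto intro!: continuous_intros)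
  qed
  let ?U = "UNIV - {m}"
  let ?P = "\<lambda>I. Pi\<^sub>M I (\<lambda>_. lborel :: real measure)"
  have ins: "insert m ?U = UNIV" by auto
  have split: "emeasure lborel A = (\<integral>\<^sup>+ x. (\<integral>\<^sup>+ y. indicator A (\<chi> i. (x(m := y)) i) \<partial>lborel) \<partial>?P ?U)"
    if [measurable]: "A \<in> sets borel" for A :: "(real^'n) set"
  proof -
    have "emeasure lborel A = (\<integral>\<^sup>+ x. indicator A x \<partial>lborel)" by simp
    also have "\<dots> = (\<integral>\<^sup>+ x. indicator A (\<chi> i. x i) \<partial>?P UNIV)"
      by (subst lborel_vec_eq_distr_PiM, subst nn_integral_distr) auto
    also have "\<dots> = (\<integral>\<^sup>+ x. (\<integral>\<^sup>+ y. indicator A (\<chi> i. (x(m := y)) i) \<partial>lborel) \<partial>?P ?U)"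
      using product_nn_integral_insert[of ?U m "\<lambda>x. indicator A (\<chi> i. x i)"] by (simp add: ins)
    finally show ?thesis .
  qed
  have "emeasure (distr lborel borel ?T) X = emeasure lborel (?T -` X)"
    by (simp add: emeasure_distr)
  also have "\<dots> = (\<integral>\<^sup>+ x. (\<integral>\<^sup>+ y. indicator (?T -` X) (\<chi> i. (x(m := y)) i) \<partial>lborel) \<partial>?P ?U)"
    by (rule split) (use measurable_sets[OF T, of X] in simp)
  also have "\<dots> = (\<integral>\<^sup>+ x. (\<integral>\<^sup>+ y. indicator X (\<chi> i. (x(m := y)) i) \<partial>lborel) \<partial>?P ?U)"
  proof (rule nn_integral_cong)
    fix x :: "'n \<Rightarrow> real"
    have [measurable]: "(\<lambda>y. \<chi> i. (x(m := y)) i) \<in> borel \<rightarrow>\<^sub>M borel"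
    proof (intro borel_measurable_continuous_onI continuous_on_vec_lambda)
      show "continuous_on UNIV (\<lambda>y. (x(m := y)) i)" for i
        by (cases "i = m") (auto intro!: continuous_intros)
    qed
    have e: "(\<chi> i. if i = m then (\<chi> i. (x(m := y)) i) $ m + (\<chi> i. (x(m := y)) i) $ n else (\<chi> i. (x(m := y)) i) $ i)
        = (\<chi> i. (x(m := x n + 1 * y)) i)" for y
      using mn by (auto simp: vec_eq_iff)
    have "(\<integral>\<^sup>+ y. indicator (?T -` X) (\<chi> i. (x(m := y)) i) \<partial>lborel)
      = (\<integral>\<^sup>+ y. indicator X (\<chi> i. (x(m := x n + 1 * y)) i) \<partial>lborel)"
      by (intro nn_integral_cong) (simp only: indicator_def vimage_eq e)
    also have "\<dots> = (\<integral>\<^sup>+ y. indicator X (\<chi> i. (x(m := y)) i) \<partial>lborel)"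
      by (subst (2) nn_integral_real_affine[where c=1 and t="x n"]) auto
    finally show "(\<integral>\<^sup>+ y. indicator (?T -` X) (\<chi> i. (x(m := y)) i) \<partial>lborel)
      = (\<integral>\<^sup>+ y. indicator X (\<chi> i. (x(m := y)) i) \<partial>lborel)" .
  qed
  also have "\<dots> = emeasure lborel X" by (rule split[symmetric]) simp
  finally show "emeasure lborel X = emeasure (distr lborel borel ?T) X" by simp
qed simp

lemma borel_measurable_matrix_vector_mult [measurable]:
  "(\<lambda>x. A *v x) \<in> borel_measurable borel" for A :: "real^'n^'m"
  by (intro borel_measurable_continuous_onI continuous_intros)

text \<open>The formula is multiplicative in \<open>A\<close>, so elementary matrices suffice: a
  zero row is excluded by the determinant, a diagonal matrix scales the coordinates, a transposition
  maps boxes to boxes, and the last kind is a shear. The condition on the determinant sits inside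
  the predicate \<open>?P\<close> because the induction runs over all matrices.\<close>

theorem lborel_matrix_vector_mult:
  fixes A :: "real^'n^'n"
  assumes "det A \<noteq> 0"
  shows "lborel = density (distr lborel borel (\<lambda>x. A *v x)) (\<lambda>_. \<bar>det A\<bar>)"
proof -
  let ?P = "\<lambda>A::real^'n^'n. det A \<noteq> 0 \<longrightarrow> lborel = density (distr lborel borel (\<lambda>x. A *v x)) (\<lambda>_. \<bar>det A\<bar>)"
  have "?P A"
  proof (rule induct_matrix_elementary_alt)
    fix A B :: "real^'n^'n" assume A: "?P A" and B: "?P B"
    show "?P (A ** B)"
    proof
      assume "det (A ** B) \<noteq> 0"
      then have "det A \<noteq> 0" "det B \<noteq> 0" by (auto simp: det_mul)
      then have A': "lborel = density (distr lborel borel (\<lambda>x. A *v x)) (\<lambda>_. \<bar>det A\<bar>)"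
        and B': "lborel = density (distr lborel borel (\<lambda>x. B *v x)) (\<lambda>_. \<bar>det B\<bar>)"
        using A B by auto
      have "lborel = density (distr (density (distr lborel borel (\<lambda>x. B *v x)) (\<lambda>_. \<bar>det B\<bar>)) borel (\<lambda>x. A *v x)) (\<lambda>_. \<bar>det A\<bar>)"
        unfolding B'[symmetric] by (rule A')
      also have "\<dots> = density (distr lborel borel (\<lambda>x. (A ** B) *v x)) (\<lambda>_. \<bar>det (A ** B)\<bar>)"
        by (rule measure_eqI)
          (auto simp: emeasure_density nn_integral_distr nn_integral_density det_mul abs_mult ennreal_mult
            matrix_vector_mul_assoc nn_integral_cmult mult_ac)
      finally show "lborel = density (distr lborel borel (\<lambda>x. (A ** B) *v x)) (\<lambda>_. \<bar>det (A ** B)\<bar>)" .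
    qed
  next
    fix A :: "real^'n^'n" and i assume "row i A = 0"
    then show "?P A" by (simp add: det_zero_row)
  next
    fix A :: "real^'n^'n" assume d: "\<And>i j. i \<noteq> j \<Longrightarrow> A $ i $ j = 0"
    show "?P A"
    proof
      assume "det A \<noteq> 0"
      then have nz: "A $ i $ i \<noteq> 0" for i
        using det_diagonal[OF d] by auto
      define c where "c b = (A *v b) \<bullet> b" for b :: "real^'n"
      have c: "c (axis i 1) = A $ i $ i" for i
        by (simp add: c_def inner_axis matrix_vector_mult_basis column_def)
      have "c b \<noteq> 0" if "b \<in> Basis" for b
        using that nz c by (auto simp: Basis_vec_def)
      note L = lborel_affine_euclidean[where c=c and t=0, OF this]
      have "0 + (\<Sum>j\<in>Basis. (c j * (x \<bullet> j)) *\<^sub>R j) = A *v x" for x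
      proof -
        have "(\<Sum>j\<in>Basis. (c j * (x \<bullet> j)) *\<^sub>R j) = (\<Sum>i\<in>UNIV. (A $ i $ i * x $ i) *\<^sub>R axis i 1)"
          by (subst sum.reindex_bij_betw[OF bij_betw_axis_Basis, symmetric]) (simp add: c inner_axis)
        also have "\<dots> = A *v x"
        proof (clarsimp simp: vec_eq_iff matrix_vector_mult_def axis_def if_distrib cong: if_cong)
          fix i
          have "(\<Sum>j\<in>UNIV. A $ i $ j * x $ j) = (\<Sum>j\<in>UNIV. if j = i then A $ i $ j * x $ j else 0)"
            by (intro sum.cong) (auto simp: d)
          then show "A $ i $ i * x $ i = (\<Sum>j\<in>UNIV. A $ i $ j * x $ j)" by simp
        qed
        finally show ?thesis by simp
      qed
      with L show "lborel = density (distr lborel borel (\<lambda>x. A *v x)) (\<lambda>_. \<bar>det A\<bar>)"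
        by (simp add: prod_Basis_vec c det_diagonal[OF d] abs_prod)
    qed
  next
    fix m n :: 'n assume mn: "m \<noteq> n"
    let ?t = "Transposition.transpose m n"
    let ?A = "(\<chi> i j. mat 1 $ i $ ?t j) :: real^'n^'n"
    have det: "\<bar>det ?A\<bar> = 1"
      by (simp add: det_permute_columns permutes_swap_id sign_swap_id abs_mult)
    have A: "?A *v x = (\<chi> i. x $ ?t i)" for x
    proof (clarsimp simp: vec_eq_iff matrix_vector_mult_def mat_def)
      fix i
      have "(\<Sum>j\<in>UNIV. (if i = ?t j then 1 else 0) * x $ j) = (\<Sum>j\<in>UNIV. if j = ?t i then x $ j else 0)"
        by (intro sum.cong) auto
      then show "(\<Sum>j\<in>UNIV. (if i = ?t j then 1 else 0) * x $ j) = x $ ?t i" by simp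
    qed
    have "lborel = distr lborel borel (\<lambda>x. ?A *v x)"
    proof (rule lborel_eqI)
      fix l u :: "real^'n" assume le: "\<And>b. b \<in> Basis \<Longrightarrow> l \<bullet> b \<le> u \<bullet> b"
      have le': "l $ i \<le> u $ i" for i
        using le[of "axis i 1"] by (simp add: inner_axis)
      have eq: "(\<lambda>x. ?A *v x) -` box l u = box (\<chi> i. l $ ?t i) (\<chi> i. u $ ?t i)"
        by (auto simp: mem_box_cart A) (metis transpose_involutory)+
      have "emeasure (distr lborel borel (\<lambda>x. ?A *v x)) (box l u) = (\<Prod>i\<in>UNIV. ennreal (u $ ?t i - l $ ?t i))"
        using le' by (simp add: emeasure_distr eq emeasure_lborel_box_eq prod_Basis_vec inner_axis prod_ennreal)
          (auto simp: Basis_vec_def inner_axis)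
      also have "\<dots> = (\<Prod>i\<in>UNIV. ennreal (u $ i - l $ i))"
        by (rule prod.permute[OF permutes_swap_id, symmetric, unfolded o_def]) auto
      finally show "emeasure (distr lborel borel (\<lambda>x. ?A *v x)) (box l u) = (\<Prod>b\<in>Basis. (u - l) \<bullet> b)"
        using le' by (simp add: prod_Basis_vec inner_axis prod_ennreal)
    qed simp
    then show "?P ?A" by (simp add: det density_1)
  next
    fix m n :: 'n assume mn: "m \<noteq> n"
    let ?A = "(\<chi> i j. of_bool (i = m \<and> j = n \<or> i = j)) :: real^'n^'n"
    have "?A = (\<chi> k. if k = m then row m (mat 1) + 1 *s row n (mat 1) else row k (mat 1))"
      using mn by (auto simp: vec_eq_iff row_def mat_def)
    then have det: "det ?A = 1"
      using det_row_operation[OF mn, of "mat 1" 1] by simp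
    have A: "?A *v x = (\<chi> i. if i = m then x $ m + x $ n else x $ i)" for x
    proof (rule vec_eq_iff[THEN iffD2], rule allI)
      fix i
      have "(?A *v x) $ i = (\<Sum>j\<in>UNIV. of_bool (i = m \<and> j = n \<or> i = j) * x $ j)"
        by (simp add: matrix_vector_mult_def)
      also have "\<dots> = (\<Sum>j\<in>UNIV. (if j = i then x $ j else 0) + (if j = n then (if i = m then x $ j else 0) else 0))"
        using mn by (intro sum.cong) auto
      also have "\<dots> = (\<chi> i. if i = m then x $ m + x $ n else x $ i) $ i"
        by (simp add: sum.distrib)
      finally show "(?A *v x) $ i = (\<chi> i. if i = m then x $ m + x $ n else x $ i) $ i" .
    qed
    show "?P ?A"
      unfolding det A using lborel_vec_shear[OF mn] by (simp add: density_1)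
  qed
  with assms show ?thesis by simp
qed

section \<open>Jacobi polynomials\<close>

definition jacobi_coeff :: "real \<Rightarrow> nat \<Rightarrow> nat \<Rightarrow> real" where
  "jacobi_coeff \<alpha> n k =
     pochhammer (- real n) k * pochhammer (real n + \<alpha> + 1) k / (pochhammer (\<alpha> + 1) k * fact k)"

definition jacobi_poly :: "real \<Rightarrow> nat \<Rightarrow> real poly" where
  "jacobi_poly \<alpha> n = (\<Sum>k\<le>n. monom (jacobi_coeff \<alpha> n k) k)"

lemma jacobi_coeff_eq_0: "n < k \<Longrightarrow> jacobi_coeff \<alpha> n k = 0"
  by (simp add: jacobi_coeff_def pochhammer_of_nat_eq_0_lemma)

lemma jacobi_coeff_0 [simp]: "jacobi_coeff \<alpha> n 0 = 1"
  by (simp add: jacobi_coeff_def)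

lemma coeff_jacobi_poly: "coeff (jacobi_poly \<alpha> n) k = jacobi_coeff \<alpha> n k"
proof -
  have "coeff (jacobi_poly \<alpha> n) k = (\<Sum>j\<le>n. if j = k then jacobi_coeff \<alpha> n k else 0)"
    unfolding jacobi_poly_def by (simp add: coeff_sum)
  then show ?thesis by (auto simp: jacobi_coeff_eq_0)
qed

lemma poly_jacobi_poly: "poly (jacobi_poly \<alpha> n) z = (\<Sum>k\<le>n. jacobi_coeff \<alpha> n k * z ^ k)"
  by (simp add: jacobi_poly_def poly_sum poly_monom)

lemma poly_jacobi_poly_0 [simp]: "poly (jacobi_poly \<alpha> n) 0 = 1"
  by (simp add: poly_0_coeff_0 coeff_jacobi_poly)

text \<open>The ratio of consecutive hypergeometric terms, cross-multiplied. It is the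
  hypergeometric equation read coefficient by coefficient.\<close>

lemma jacobi_coeff_Suc:
  assumes "\<alpha> > 0"
  shows "(real k + 1) * (real k + \<alpha> + 1) * jacobi_coeff \<alpha> n (Suc k)
    = (real k - real n) * (real k + real n + \<alpha> + 1) * jacobi_coeff \<alpha> n k"
proof -
  have p: "pochhammer (\<alpha> + 1) k > 0" by (rule pochhammer_pos) (use assms in simp)
  have q: "\<alpha> + 1 + real k > 0" using assms by simp
  show ?thesis
    unfolding jacobi_coeff_def pochhammer_Suc fact_Suc
    using p q by (simp add: divide_simps) (simp add: algebra_simps)
qed

text \<open>The recurrence for the coefficients with their common factor (called \<open>K\<close> below) and all
  denominators cleared.\<close>

lemma jacobi_coeff_recurrence_poly_identity:
  fixes N \<alpha> j :: real
  shows "2 * (N + 1 + \<alpha>)^2 * (2 * N + \<alpha>) * ((N + 1) * N * (N + \<alpha> + 2 + j) * (N + \<alpha> + 3 + j))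
    = (2*N + \<alpha> + 1) * ((2*N + \<alpha> + 2) * (2*N + \<alpha>) + \<alpha>^2) * ((-N) * (-N + 1 + j) * (N + \<alpha> + 1) * (N + \<alpha> + 2 + j))
    - 2 * ((2*N + \<alpha> + 1) * (2*N + \<alpha> + 2) * (2*N + \<alpha>)) * ((-N) * (N + \<alpha> + 1) * (\<alpha> + 2 + j) * (j + 2))
    - 2 * N^2 * (2*N + \<alpha> + 2) * ((-N + 1 + j) * (-N + 2 + j) * (N + \<alpha>) * (N + \<alpha> + 1))"
  by algebra

text \<open>Coefficients of the three-term relation in which \<open>P\<^sub>n\<close> is multiplied
  by a(1 - 2z) + b and c times the previous polynomial is subtracted: the first identity is the
  constant term, the second the term of degree \<open>k + 1\<close>.\<close>

lemma jacobi_coeff_recurrence: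
  fixes \<alpha> :: real
  assumes a: "\<alpha> > 0" and n: "n \<ge> 1"
  defines "d \<equiv> 2 * \<alpha>"
  shows "ja d n + jb d n - jc d n = 1"
    and "jacobi_coeff \<alpha> (Suc n) (Suc k) = (ja d n + jb d n) * jacobi_coeff \<alpha> n (Suc k)
      - 2 * ja d n * jacobi_coeff \<alpha> n k - jc d n * jacobi_coeff \<alpha> (n - 1) (Suc k)"
proof -
  define N where "N = real n"
  have N: "N \<ge> 1" using n by (simp add: N_def)
  \<comment> \<open>A common denominator of \<open>ja\<close>, \<open>jb\<close> and
    \<open>jc\<close>; the 8 in \<open>jb\<close> drops to 2 because d^2 is 4 times the square of
    \<open>\<alpha>\<close>.\<close>
  define D where "D = 2 * (N + 1 + \<alpha>)^2 * (2 * N + \<alpha>)"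
  have D: "D \<noteq> 0" using N a by (simp add: D_def)
  have nz: "N + 1 + \<alpha> \<noteq> 0" "2 * N + \<alpha> \<noteq> 0" using N a by auto
  have ja: "ja d n = (2*N + \<alpha> + 1) * (2*N + \<alpha> + 2) * (2*N + \<alpha>) / D"
    unfolding ja_def d_def D_def N_def[symmetric] using nz by (simp add: divide_simps)
  have jb: "jb d n = (2*N + \<alpha> + 1) * \<alpha>^2 / D"
    unfolding jb_def d_def D_def N_def[symmetric] using nz by (simp add: divide_simps power2_eq_square)
  have jc: "jc d n = 2 * N^2 * (2*N + \<alpha> + 2) / D"
    unfolding jc_def d_def D_def N_def[symmetric] using nz by (simp add: divide_simps)
  have "(2*N + \<alpha> + 1) * (2*N + \<alpha> + 2) * (2*N + \<alpha>) + (2*N + \<alpha> + 1) * \<alpha>^2 - 2 * N^2 * (2*N + \<alpha> + 2) = D"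
    unfolding D_def by algebra
  then show "ja d n + jb d n - jc d n = 1"
    unfolding ja jb jc using D by (simp add: divide_simps)
  show "jacobi_coeff \<alpha> (Suc n) (Suc k) = (ja d n + jb d n) * jacobi_coeff \<alpha> n (Suc k)
      - 2 * ja d n * jacobi_coeff \<alpha> n k - jc d n * jacobi_coeff \<alpha> (n - 1) (Suc k)"
  proof (cases k)
    \<comment> \<open>The linear coefficient stands apart: the factorisation for higher degrees
      splits two factors off each Pochhammer product, and here there is only one.\<close>
    case 0
    have n1: "real (n - Suc 0) = N - 1" using n by (simp add: N_def of_nat_diff)
    have "D * (- (N+1) * (N + \<alpha> + 2))
      = ((2*N + \<alpha> + 1) * (2*N + \<alpha> + 2) * (2*N + \<alpha>) + (2*N + \<alpha> + 1) * \<alpha>^2) * (- N * (N + \<alpha> + 1))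
       - 2 * ((2*N + \<alpha> + 1) * (2*N + \<alpha> + 2) * (2*N + \<alpha>)) * (\<alpha> + 1)
       - 2 * N^2 * (2*N + \<alpha> + 2) * (- (N - 1) * (N + \<alpha>))"
      unfolding D_def by algebra
    then have "- (N+1) * (N + \<alpha> + 2)
      = (((2*N + \<alpha> + 1) * (2*N + \<alpha> + 2) * (2*N + \<alpha>) + (2*N + \<alpha> + 1) * \<alpha>^2) * (- N * (N + \<alpha> + 1))
       - 2 * ((2*N + \<alpha> + 1) * (2*N + \<alpha> + 2) * (2*N + \<alpha>)) * (\<alpha> + 1)
       - 2 * N^2 * (2*N + \<alpha> + 2) * (- (N - 1) * (N + \<alpha>))) / D"
      using D by (simp add: eq_divide_eq mult.commute)
    also have "\<dots> = (ja d n + jb d n) * (- N * (N + \<alpha> + 1)) - 2 * ja d n * (\<alpha> + 1) - jc d n * (- (N - 1) * (N + \<alpha>))"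
      unfolding ja jb jc using D by (simp add: divide_simps)
    finally have *: "- (N+1) * (N + \<alpha> + 2) = \<dots>" .
    have c1: "jacobi_coeff \<alpha> m (Suc 0) = - real m * (real m + \<alpha> + 1) / (\<alpha> + 1)" for m
      by (simp add: jacobi_coeff_def)
    have "jacobi_coeff \<alpha> (Suc n) (Suc 0) = - (N+1) * (N + \<alpha> + 2) / (\<alpha> + 1)"
      unfolding c1 by (simp add: N_def algebra_simps)
    also have "\<dots> = (ja d n + jb d n) * jacobi_coeff \<alpha> n (Suc 0)
      - 2 * ja d n - jc d n * jacobi_coeff \<alpha> (n - 1) (Suc 0)"
      unfolding * unfolding c1 using a n1 by (simp add: N_def[symmetric] divide_simps)
    finally show ?thesis using 0 by simp
  next
    case (Suc j)
    \<comment> \<open>The Pochhammer products in the four coefficients start at shifted points and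
      have different lengths; the \<open>j\<close> factors from \<open>-N + 1\<close> on and the
      \<open>j\<close> factors from \<open>N + \<alpha> + 2\<close> on occur in all of them.\<close>
    define p where "p = pochhammer (-N + 1) j"
    define r where "r = pochhammer (N + \<alpha> + 2) j"
    define s where "s = pochhammer (\<alpha> + 1) j"
    define J where "J = real j"
    have s: "s > 0" unfolding s_def by (rule pochhammer_pos) (use a in simp)
    have J: "J \<ge> 0" by (simp add: J_def)
    define K where "K = p * r / (s * (\<alpha> + 1 + J) * (\<alpha> + 2 + J) * ((J + 1) * (J + 2) * fact j))"
    have fa: "fact (Suc (Suc j)) = (J+1) * (J + 2) * (fact j :: real)" "fact (Suc j) = (J+1) * (fact j :: real)"
      by (simp_all add: J_def algebra_simps)
    have s2: "pochhammer (\<alpha> + 1) (Suc (Suc j)) = s * (\<alpha> + 1 + J) * (\<alpha> + 2 + J)"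
       "pochhammer (\<alpha> + 1) (Suc j) = s * (\<alpha> + 1 + J)"
      by (simp_all add: pochhammer_Suc s_def J_def add_ac)
    have e1: "jacobi_coeff \<alpha> (Suc n) (Suc (Suc j)) = K * ((N + 1) * N * (N + \<alpha> + 2 + J) * (N + \<alpha> + 3 + J))"
    proof -
      have "pochhammer (- real (Suc n)) (Suc (Suc j)) = (-N-1) * (-N) * p"
        by (simp add: pochhammer_rec p_def N_def)
      moreover have "pochhammer (real (Suc n) + \<alpha> + 1) (Suc (Suc j)) = r * (N + \<alpha> + 2 + J) * (N + \<alpha> + 3 + J)"
        by (simp add: pochhammer_Suc r_def N_def J_def add_ac)
      ultimately show ?thesis unfolding jacobi_coeff_def s2 fa K_def by (simp add: algebra_simps)
    qed
    have e2: "jacobi_coeff \<alpha> n (Suc (Suc j)) = K * ((-N) * (-N + 1 + J) * (N + \<alpha> + 1) * (N + \<alpha> + 2 + J))"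
    proof -
      have "pochhammer (- real n) (Suc (Suc j)) = (-N) * (p * (-N + 1 + J))"
        unfolding pochhammer_rec[of "- real n"] by (simp add: pochhammer_Suc p_def N_def J_def)
      moreover have "pochhammer (real n + \<alpha> + 1) (Suc (Suc j)) = (N + \<alpha> + 1) * (r * (N + \<alpha> + 2 + J))"
        unfolding pochhammer_rec[of "real n + \<alpha> + 1"] by (simp add: pochhammer_Suc r_def N_def J_def add_ac)
      ultimately show ?thesis unfolding jacobi_coeff_def s2 fa K_def by (simp add: mult_ac)
    qed
    have e3: "jacobi_coeff \<alpha> (n - 1) (Suc (Suc j)) = K * ((-N + 1 + J) * (-N + 2 + J) * (N + \<alpha>) * (N + \<alpha> + 1))"
    proof -
      have n1: "real (n - 1) = N - 1" using n by (simp add: N_def of_nat_diff)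
      have "pochhammer (- (N - 1)) (Suc (Suc j)) = p * (-N + 1 + J) * (-N + 2 + J)"
        by (simp add: pochhammer_Suc p_def J_def algebra_simps)
      moreover have "pochhammer (N - 1 + \<alpha> + 1) (Suc (Suc j)) = (N + \<alpha>) * ((N + \<alpha> + 1) * r)"
        by (simp add: pochhammer_rec r_def add_ac)
      ultimately show ?thesis unfolding jacobi_coeff_def n1 s2 fa K_def by (simp add: mult_ac)
    qed
    have e4: "jacobi_coeff \<alpha> n (Suc j) = K * ((-N) * (N + \<alpha> + 1) * (\<alpha> + 2 + J) * (J + 2))"
    proof -
      have "pochhammer (- real n) (Suc j) = (-N) * p" "pochhammer (real n + \<alpha> + 1) (Suc j) = (N + \<alpha> + 1) * r"
        by (simp_all add: pochhammer_rec p_def r_def N_def add_ac)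
      then have *: "jacobi_coeff \<alpha> n (Suc j) = ((-N) * (N + \<alpha> + 1) * (p * r)) / (s * (\<alpha> + 1 + J) * ((J+1) * fact j))"
        unfolding jacobi_coeff_def s2 fa by (simp add: mult_ac)
      have nn: "\<alpha> + 2 + J \<noteq> 0" "J + 2 \<noteq> 0" "\<alpha> + 1 + J \<noteq> 0" "J + 1 \<noteq> 0" using a J by auto
      show ?thesis unfolding * K_def using s nn by (simp add: divide_simps)
    qed
    have "(N + 1) * N * (N + \<alpha> + 2 + J) * (N + \<alpha> + 3 + J) =
      ((2*N + \<alpha> + 1) * ((2*N + \<alpha> + 2) * (2*N + \<alpha>) + \<alpha>^2) * ((-N) * (-N + 1 + J) * (N + \<alpha> + 1) * (N + \<alpha> + 2 + J))
    - 2 * ((2*N + \<alpha> + 1) * (2*N + \<alpha> + 2) * (2*N + \<alpha>)) * ((-N) * (N + \<alpha> + 1) * (\<alpha> + 2 + J) * (J + 2))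
    - 2 * N^2 * (2*N + \<alpha> + 2) * ((-N + 1 + J) * (-N + 2 + J) * (N + \<alpha>) * (N + \<alpha> + 1))) / D"
      using jacobi_coeff_recurrence_poly_identity[of N \<alpha> J] D
      unfolding D_def[symmetric] by (simp add: eq_divide_eq mult.commute)
    also have "\<dots> = (ja d n + jb d n) * ((-N) * (-N + 1 + J) * (N + \<alpha> + 1) * (N + \<alpha> + 2 + J))
     - 2 * ja d n * ((-N) * (N + \<alpha> + 1) * (\<alpha> + 2 + J) * (J + 2))
     - jc d n * ((-N + 1 + J) * (-N + 2 + J) * (N + \<alpha>) * (N + \<alpha> + 1))"
    proof -
      have jab: "ja d n + jb d n = (2*N + \<alpha> + 1) * ((2*N + \<alpha> + 2) * (2*N + \<alpha>) + \<alpha>^2) / D"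
        unfolding ja jb add_divide_distrib[symmetric] by (simp add: algebra_simps)
      show ?thesis unfolding jab unfolding ja jc by (simp add: diff_divide_distrib)
    qed
    finally have "K * ((N + 1) * N * (N + \<alpha> + 2 + J) * (N + \<alpha> + 3 + J)) = K * \<dots>" by (rule arg_cong)
    then show ?thesis unfolding Suc e1 e2 e3 e4 by (simp only: right_diff_distrib mult.left_commute[of K])
  qed
qed

text \<open>\<open>1 - 2 * z\<close> is the Fourier multiplier of convolution with
  \<open>\<omega>\<close>, so these are the two kinds of step of the iteration on the Fourier
  side.\<close>

lemma poly_jacobi_poly_rec:
  fixes d :: real
  assumes d: "d > 0"
  shows "poly (jacobi_poly (d/2) (Suc 0)) z = ja0 d * (1 - 2 * z) + jb0 d"
    and "poly (jacobi_poly (d/2) (Suc (Suc n))) z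
      = ja d (Suc n) * ((1 - 2 * z) * poly (jacobi_poly (d/2) (Suc n)) z)
        + jb d (Suc n) * poly (jacobi_poly (d/2) (Suc n)) z - jc d (Suc n) * poly (jacobi_poly (d/2) n) z"
proof -
  show "poly (jacobi_poly (d/2) (Suc 0)) z = ja0 d * (1 - 2 * z) + jb0 d"
    using d by (simp add: poly_jacobi_poly jacobi_coeff_def ja0_def jb0_def divide_simps) (simp add: algebra_simps)
  let ?P = "jacobi_poly (d/2)"
  note R = jacobi_coeff_recurrence[of "d/2" "Suc n", simplified, OF d]
  have "?P (Suc (Suc n)) = smult (ja d (Suc n) + jb d (Suc n)) (?P (Suc n))
      - smult (2 * ja d (Suc n)) (pCons 0 (?P (Suc n))) - smult (jc d (Suc n)) (?P n)"
  proof (rule poly_eqI)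
    fix k
    show "coeff (?P (Suc (Suc n))) k = coeff (smult (ja d (Suc n) + jb d (Suc n)) (?P (Suc n))
      - smult (2 * ja d (Suc n)) (pCons 0 (?P (Suc n))) - smult (jc d (Suc n)) (?P n)) k"
      by (cases k) (simp_all add: coeff_jacobi_poly coeff_pCons R(1) R(2))
  qed
  then have "poly (?P (Suc (Suc n))) z = poly (smult (ja d (Suc n) + jb d (Suc n)) (?P (Suc n))
      - smult (2 * ja d (Suc n)) (pCons 0 (?P (Suc n))) - smult (jc d (Suc n)) (?P n)) z"
    by (rule arg_cong)
  then show "poly (?P (Suc (Suc n))) z
      = ja d (Suc n) * ((1 - 2 * z) * poly (?P (Suc n)) z)
        + jb d (Suc n) * poly (?P (Suc n)) z - jc d (Suc n) * poly (?P n) z"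
    by (simp add: algebra_simps)
qed

text \<open>The hypergeometric equation with parameters -n, n + \<alpha> + 1 and \<alpha> + 1.
  Degrees 0 and 1 are split off in the comparison of coefficients because multiplying by z and z^2
  shifts by up to two places.\<close>

lemma jacobi_poly_ode:
  assumes "\<alpha> > 0"
  shows "z * (1 - z) * poly (pderiv (pderiv (jacobi_poly \<alpha> n))) z
    + ((\<alpha> + 1) - (\<alpha> + 2) * z) * poly (pderiv (jacobi_poly \<alpha> n)) z
    + real n * (real n + \<alpha> + 1) * poly (jacobi_poly \<alpha> n) z = 0"
proof -
  let ?P = "jacobi_poly \<alpha> n"
  have "pCons 0 (pderiv (pderiv ?P)) - pCons 0 (pCons 0 (pderiv (pderiv ?P)))
    + smult (\<alpha> + 1) (pderiv ?P) - smult (\<alpha> + 2) (pCons 0 (pderiv ?P)) + smult (real n * (real n + \<alpha> + 1)) ?P = 0"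
    (is "?Q = 0")
  proof (rule poly_eqI)
    fix k
    have *: "(real k + 1) * (real k + \<alpha> + 1) * jacobi_coeff \<alpha> n (Suc k)
      = (real k - real n) * (real k + real n + \<alpha> + 1) * jacobi_coeff \<alpha> n k"
      by (rule jacobi_coeff_Suc[OF assms])
    consider "k = 0" | "k = Suc 0" | j where "k = Suc (Suc j)"
      by (metis nat.exhaust)
    then show "coeff ?Q k = coeff 0 k"
      using * by cases (simp_all add: coeff_pderiv coeff_pCons coeff_jacobi_poly algebra_simps)
  qed
  then have "poly ?Q z = 0" by simp
  then show ?thesis by (simp add: algebra_simps)
qed

section \<open>Uniform decay of the Jacobi polynomials by an energy argument\<close>

text \<open>This is a damped oscillator whose damping \<open>q\<close> is the logarithmic derivative
  of \<rho> = sin^k cos. While \<open>q\<close> is nonnegative the plain energy decreases, which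
  bounds \<open>Y\<close> by 1 up to pi/4. Where |q| is at most \<open>m\<close>, the energy
  weighted by \<rho> grows at most by a constant factor, so the square of \<open>Y\<close> is
  bounded by a multiple of 1/\<rho>.\<close>

lemma weighted_oscillator_bound:
  fixes Y Y1 Y2 :: "real \<Rightarrow> real" and k :: nat and m \<theta> x :: real
  assumes Y: "\<And>x. (Y has_real_derivative Y1 x) (at x)"
    and Y1: "\<And>x. (Y1 has_real_derivative Y2 x) (at x)"
    and ode: "\<And>x. 0 < x \<Longrightarrow> x < pi/2 \<Longrightarrow>
      Y2 x = - (real k * (cos x / sin x) - sin x / cos x) * Y1 x - m\<^sup>2 * Y x"
    and init: "Y 0 = 1" "Y1 0 = 0" and k: "k \<ge> 1"
    and \<theta>: "0 < \<theta>" "\<theta> < pi/2" and m: "m \<ge> tan \<theta>" "m \<ge> 4 * real k / pi"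
    and x: "0 \<le> x" "x \<le> \<theta>"
  shows "(Y x)\<^sup>2 \<le> 3 * exp 2 / cos \<theta>" and "(Y x)\<^sup>2 * (m * sin x) ^ k \<le> 3 * exp 2 * real k ^ k / cos \<theta>"
proof -
  \<comment> \<open>The point where the damping, of size k/x near 0, has dropped to the frequency
    \<open>m\<close>. Before it \<open>m * sin x\<close> is at most \<open>k\<close> and boundedness
    is enough; the assumption on \<open>4 * real k / pi\<close> keeps it within the range of the
    plain energy.\<close>
  define x0 where "x0 = real k / m"
  have "4 * real k / pi > 0" using k by simp
  with m have m0: "m > 0" by linarith
  have x0: "0 < x0" "x0 \<le> pi/4"
    using k m m0 by (auto simp: x0_def field_simps)
  have cos\<theta>: "cos \<theta> > 0" "cos \<theta> \<le> 1" using \<theta> by (auto intro!: cos_gt_zero)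
  define q where "q x = real k * (cos x / sin x) - sin x / cos x" for x
  have sc: "sin x > 0" "cos x > 0" if "0 < x" "x < pi/2" for x
    using that by (auto intro!: sin_gt_zero cos_gt_zero)
  have q_nonneg: "q x \<ge> 0" if "0 < x" "x \<le> pi/4" for x
  proof -
    have s: "sin x > 0" "cos x > 0" using sc that by auto
    have "sin x \<le> sin (pi/2 - x)"
      using that by (intro sin_monotone_2pi_le) auto
    then have "sin x \<le> cos x" by (simp add: cos_sin_eq)
    then have "sin x / cos x \<le> 1" "cos x / sin x \<ge> 1" using s by auto
    moreover have "1 * 1 \<le> real k * (cos x / sin x)"
      using k calculation by (intro mult_mono) auto
    ultimately show ?thesis unfolding q_def by linarith
  qed
  have F_le: "(Y1 x)\<^sup>2 + m\<^sup>2 * (Y x)\<^sup>2 \<le> m\<^sup>2" if x: "0 \<le> x" "x \<le> pi/4" for x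
  proof -
    have "(\<lambda>x. (Y1 x)\<^sup>2 + m\<^sup>2 * (Y x)\<^sup>2) x \<le> (\<lambda>x. (Y1 x)\<^sup>2 + m\<^sup>2 * (Y x)\<^sup>2) 0"
    proof (rule DERIV_nonpos_imp_nonincreasing[OF x(1)])
      fix u assume u: "0 \<le> u" "u \<le> x"
      have "((\<lambda>x. (Y1 x)\<^sup>2 + m\<^sup>2 * (Y x)\<^sup>2) has_real_derivative 2 * Y1 u * (Y2 u + m\<^sup>2 * Y u)) (at u)"
        by (rule derivative_eq_intros Y Y1 refl)+ (simp add: algebra_simps)
      moreover have "2 * Y1 u * (Y2 u + m\<^sup>2 * Y u) \<le> 0"
      \<comment> \<open>The equation is assumed on the open interval only; at 0 the derivative of
        the energy vanishes because \<open>Y1 0 = 0\<close>.\<close>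
      proof (cases "u = 0")
        case False
        then have u': "0 < u" "u < pi/2" "u \<le> pi/4" using u x by auto
        have "2 * Y1 u * (Y2 u + m\<^sup>2 * Y u) = - 2 * q u * (Y1 u)\<^sup>2"
          unfolding ode[OF u'(1,2)] q_def by (simp add: algebra_simps power2_eq_square)
        then show ?thesis using q_nonneg[OF u'(1,3)] by simp
      qed (simp add: init)
      ultimately show "\<exists>y. ((\<lambda>x. (Y1 x)\<^sup>2 + m\<^sup>2 * (Y x)\<^sup>2) has_real_derivative y) (at u) \<and> y \<le> 0"
        by blast
    qed
    then show ?thesis by (simp add: init)
  qed
  have Y_le1: "(Y x)\<^sup>2 \<le> 1" if x: "0 \<le> x" "x \<le> pi/4" for x
  proof -
    have "m\<^sup>2 * (Y x)\<^sup>2 \<le> m\<^sup>2 * 1" using F_le[OF x] by (simp add: add_increasing) (smt (verit) zero_le_power2)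
    then show ?thesis using m0 by simp
  qed
  have C1: "1 \<le> 3 * exp 2 / cos \<theta>"
  proof -
    have "cos \<theta> \<le> 3 * exp 2" using cos\<theta> exp_ge_add_one_self[of 2] by linarith
    then show ?thesis using cos\<theta> by simp
  qed
  show "(Y x)\<^sup>2 \<le> 3 * exp 2 / cos \<theta>" "(Y x)\<^sup>2 * (m * sin x) ^ k \<le> 3 * exp 2 * real k ^ k / cos \<theta>"
  proof -
    consider "x \<le> x0" | "x0 < x" by linarith
    then have "(Y x)\<^sup>2 \<le> 3 * exp 2 / cos \<theta> \<and> (Y x)\<^sup>2 * (m * sin x) ^ k \<le> 3 * exp 2 * real k ^ k / cos \<theta>"
    proof cases
      case 1
      have xx: "x \<le> pi/4" using 1 x0 by simp
      have "sin x \<ge> 0" using x \<theta> by (intro sin_ge_zero) auto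
      have "m * sin x \<le> m * x0" using sin_x_le_x[OF x(1)] 1 m0 by (intro mult_left_mono) auto
      then have "m * sin x \<le> real k" using m0 by (simp add: x0_def)
      then have "(m * sin x) ^ k \<le> real k ^ k" using \<open>sin x \<ge> 0\<close> m0 by (intro power_mono) auto
      then have "(Y x)\<^sup>2 * (m * sin x) ^ k \<le> 1 * real k ^ k"
        using Y_le1[OF x(1) xx] \<open>sin x \<ge> 0\<close> m0 by (intro mult_mono) auto
      also have "\<dots> \<le> (3 * exp 2 / cos \<theta>) * real k ^ k" using C1 by (intro mult_right_mono) auto
      finally show ?thesis using Y_le1[OF x(1) xx] C1 by auto
    next
      case 2
      define \<rho> where "\<rho> x = sin x ^ k * cos x" for x :: real
      \<comment> \<open>The term \<open>q Y Y'\<close> cancels the squares in the derivative of \<open>\<rho> (Y'\<^sup>2 + m\<^sup>2 Y\<^sup>2)\<close>, leaving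
        \<open>E' = \<rho> q' Y Y'\<close>; hence \<open>E exp (q/m)\<close> decreases as long as \<open>\<bar>q\<bar> \<le> m\<close>.\<close>
      define E where "E x = \<rho> x * ((Y1 x)\<^sup>2 + m\<^sup>2 * (Y x)\<^sup>2 + q x * Y x * Y1 x)" for x
      define q' where "q' x = - real k / (sin x)\<^sup>2 - 1 / (cos x)\<^sup>2" for x
      have Dq: "(q has_real_derivative q' u) (at u)" if "0 < u" "u < pi/2" for u
      proof -
        note s = sc[OF that]
        have sc2: "cos u * cos u = 1 - sin u * sin u" using sin_cos_squared_add[of u] by (simp add: power2_eq_square algebra_simps)
        have a: "((\<lambda>x. cos x / sin x) has_real_derivative (- 1 / (sin u)\<^sup>2)) (at u)"
          using s by (auto intro!: derivative_eq_intros simp: power2_eq_square divide_simps) (simp add: sc2)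
        have b: "((\<lambda>x. sin x / cos x) has_real_derivative (1 / (cos u)\<^sup>2)) (at u)"
          using s by (auto intro!: derivative_eq_intros simp: power2_eq_square divide_simps)
        show ?thesis unfolding q_def[abs_def] q'_def
          by (rule derivative_eq_intros a b refl)+ simp
      qed
      have q'0: "q' u \<le> 0" for u unfolding q'_def by (simp add: divide_nonpos_nonneg) (smt (verit) divide_nonneg_nonneg of_nat_0_le_iff zero_le_power2)
      have D\<rho>: "(\<rho> has_real_derivative \<rho> u * q u) (at u)" if "0 < u" "u < pi/2" for u
      proof -
        note s = sc[OF that]
        obtain j where j: "k = Suc j" using k by (cases k) auto
        have "(\<rho> has_real_derivative
            real k * (cos u * sin u ^ (k - Suc 0)) * cos u + - sin u * sin u ^ k) (at u)"
          unfolding \<rho>_def[abs_def] by (rule DERIV_mult[OF DERIV_power[OF DERIV_sin] DERIV_cos])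
        also have "real k * (cos u * sin u ^ (k - Suc 0)) * cos u + - sin u * sin u ^ k = \<rho> u * q u"
          unfolding \<rho>_def q_def j using s by (simp add: field_simps)
        finally show ?thesis .
      qed
      have x2: "x < pi/2" using x \<theta> by simp
      \<comment> \<open>\<open>q\<close> decreases, so its maximum is at \<open>x0\<close>, where
        cot x0 is at most 1/x0 = m/k. From below, \<open>q\<close> is at least minus the tangent,
        which is controlled by \<open>tan \<theta>\<close>.\<close>
      have q_abs: "\<bar>q u\<bar> \<le> m" if u: "x0 \<le> u" "u \<le> x" for u
      proof -
        have u': "0 < u" "u < pi/2" using u x0 x2 by auto
        have "q u \<le> q x0"
        proof (rule DERIV_nonpos_imp_nonincreasing[OF u(1)])
          fix v assume "x0 \<le> v" "v \<le> u"
          then have "0 < v" "v < pi/2" using x0 u' by auto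
          then show "\<exists>y. (q has_real_derivative y) (at v) \<and> y \<le> 0" using Dq q'0 by blast
        qed
        also have "\<dots> \<le> real k * (cos x0 / sin x0)"
          unfolding q_def using sc[of x0] x0 pi_gt_zero by auto
        also have "\<dots> \<le> real k * (1 / x0)"
        proof (rule mult_left_mono)
          have "sin 0 - 0 * cos 0 \<le> sin x0 - x0 * cos x0"
          proof (rule DERIV_nonneg_imp_nondecreasing[of 0 x0 "\<lambda>x. sin x - x * cos x"])
            fix v assume "0 \<le> v" "v \<le> x0"
            then have "v * sin v \<ge> 0" using x0 pi_gt_zero by (intro mult_nonneg_nonneg sin_ge_zero) auto
            moreover have "((\<lambda>x. sin x - x * cos x) has_real_derivative v * sin v) (at v)"
              by (auto intro!: derivative_eq_intros)
            ultimately show "\<exists>y. ((\<lambda>x. sin x - x * cos x) has_real_derivative y) (at v) \<and> 0 \<le> y" by blast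
          qed (use x0 in simp)
          then show "cos x0 / sin x0 \<le> 1 / x0" using sc[of x0] x0 by (simp add: field_simps)
        qed simp
        also have "\<dots> = m" using m0 k by (simp add: x0_def)
        finally have a: "q u \<le> m" .
        have "- q u \<le> tan u" unfolding q_def tan_def using sc[OF u'] by simp
        also have "\<dots> \<le> tan \<theta>" using u u' x \<theta> by (intro tan_mono_le) auto
        also have "\<dots> \<le> m" by fact
        finally show ?thesis using a by simp
      qed
      have YY: "m * \<bar>Y u * Y1 u\<bar> \<le> ((Y1 u)\<^sup>2 + m\<^sup>2 * (Y u)\<^sup>2) / 2" for u
      proof -
        have "0 \<le> (\<bar>Y1 u\<bar> - m * \<bar>Y u\<bar>)\<^sup>2" by simp
        then show ?thesis by (simp add: power2_diff power_mult_distrib abs_mult algebra_simps)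
      qed
      have qYY: "\<bar>q u * Y u * Y1 u\<bar> \<le> ((Y1 u)\<^sup>2 + m\<^sup>2 * (Y u)\<^sup>2) / 2" if u: "x0 \<le> u" "u \<le> x" for u
      proof -
        have "\<bar>q u * Y u * Y1 u\<bar> = \<bar>q u\<bar> * \<bar>Y u * Y1 u\<bar>" by (simp add: abs_mult)
        also have "\<dots> \<le> m * \<bar>Y u * Y1 u\<bar>" using q_abs[OF u] by (intro mult_right_mono) auto
        finally show ?thesis using YY[of u] by linarith
      qed
      have \<rho>pos: "\<rho> u > 0" if "x0 \<le> u" "u \<le> x" for u
        unfolding \<rho>_def using sc[of u] that x0 x2 by auto
      have E_low: "E u \<ge> \<rho> u * (((Y1 u)\<^sup>2 + m\<^sup>2 * (Y u)\<^sup>2) / 2)" if u: "x0 \<le> u" "u \<le> x" for u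
      proof -
        have "b / 2 \<le> b + a" if "\<bar>a\<bar> \<le> b / 2" for a b :: real using that by linarith
        from this[OF qYY[OF u]] show ?thesis
          unfolding E_def using \<rho>pos[OF u] by (intro mult_left_mono) auto
      qed
      have "E x * exp (q x / m) \<le> E x0 * exp (q x0 / m)"
      proof (rule DERIV_nonpos_imp_nonincreasing[of x0 x "\<lambda>x. E x * exp (q x / m)"])
        fix u assume u: "x0 \<le> u" "u \<le> x"
        then have u': "0 < u" "u < pi/2" using x0 x2 by auto
        have "(E has_real_derivative \<rho> u * q u * ((Y1 u)\<^sup>2 + m\<^sup>2 * (Y u)\<^sup>2 + q u * Y u * Y1 u) +
            \<rho> u * (2 * Y1 u * Y2 u + m\<^sup>2 * (2 * Y u * Y1 u) + (q' u * Y u * Y1 u + q u * Y1 u * Y1 u + q u * Y u * Y2 u))) (at u)"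
          unfolding E_def[abs_def]
          by (rule derivative_eq_intros Y Y1 Dq[OF u'] D\<rho>[OF u'] refl)+ (simp add: algebra_simps)
        also have "\<rho> u * q u * ((Y1 u)\<^sup>2 + m\<^sup>2 * (Y u)\<^sup>2 + q u * Y u * Y1 u) +
            \<rho> u * (2 * Y1 u * Y2 u + m\<^sup>2 * (2 * Y u * Y1 u) + (q' u * Y u * Y1 u + q u * Y1 u * Y1 u + q u * Y u * Y2 u))
          = \<rho> u * (q' u * (Y u * Y1 u))"
          unfolding ode[OF u', folded q_def] by (simp add: algebra_simps power2_eq_square)
        finally have DE: "(E has_real_derivative \<rho> u * (q' u * (Y u * Y1 u))) (at u)" .
        have "((\<lambda>x. E x * exp (q x / m)) has_real_derivative
           (\<rho> u * (q' u * (Y u * Y1 u)) + q' u / m * E u) * exp (q u / m)) (at u)"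
          by (rule derivative_eq_intros DE Dq[OF u'] refl)+ (use m0 in \<open>auto simp: algebra_simps\<close>)
        moreover have "(\<rho> u * (q' u * (Y u * Y1 u)) + q' u / m * E u) * exp (q u / m) \<le> 0"
        proof -
          have "\<rho> u * (m * \<bar>Y u * Y1 u\<bar>) \<le> E u"
            using E_low[OF u] mult_left_mono[OF YY[of u], of "\<rho> u"] \<rho>pos[OF u] by linarith
          moreover have "\<rho> u * (m * (- (Y u * Y1 u))) \<le> \<rho> u * (m * \<bar>Y u * Y1 u\<bar>)"
            using m0 \<rho>pos[OF u] by (intro mult_left_mono) auto
          ultimately have "- (\<rho> u * (Y u * Y1 u)) * m \<le> E u" by (simp add: algebra_simps)
          then have "- (\<rho> u * (Y u * Y1 u)) \<le> E u / m"
            using m0 by (simp add: pos_le_divide_eq)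
          then have "q' u * (\<rho> u * (Y u * Y1 u) + E u / m) \<le> 0"
            using q'0[of u] by (intro mult_nonpos_nonneg) auto
          then show ?thesis by (intro mult_nonpos_nonneg) (auto simp: algebra_simps)
        qed
        ultimately show "\<exists>y. ((\<lambda>x. E x * exp (q x / m)) has_real_derivative y) (at u) \<and> y \<le> 0" by blast
      qed (use 2 in simp)
      then have "E x \<le> E x0 * exp ((q x0 - q x) / m)"
        by (simp add: diff_divide_distrib exp_diff field_simps)
      \<comment> \<open>As |q| is at most \<open>m\<close> at both ends, the correcting exponential
        costs a factor exp 2 independent of \<open>m\<close>. The 3 in the final bounds is the
        quotient of 3/2 and 1/2, the factors by which the cross term can raise and lower the
        energy.\<close>
      also have "\<dots> \<le> E x0 * exp 2"
      proof (rule mult_left_mono)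
        have "q x0 - q x \<le> 2 * m" using q_abs[of x0] q_abs[of x] 2 by linarith
        then show "exp ((q x0 - q x) / m) \<le> exp 2" using m0 by (simp add: field_simps)
        have "0 \<le> \<rho> x0 * (((Y1 x0)\<^sup>2 + m\<^sup>2 * (Y x0)\<^sup>2) / 2)"
          using \<rho>pos[of x0] 2 by (intro mult_nonneg_nonneg) auto
        then show "0 \<le> E x0" using E_low[of x0] 2 by auto
      qed
      also have "E x0 \<le> \<rho> x0 * (3/2 * m\<^sup>2)"
        unfolding E_def
      proof (rule mult_left_mono)
        show "(Y1 x0)\<^sup>2 + m\<^sup>2 * (Y x0)\<^sup>2 + q x0 * Y x0 * Y1 x0 \<le> 3/2 * m\<^sup>2"
        proof -
          have "b + a \<le> 3/2 * c" if "\<bar>a\<bar> \<le> b / 2" "b \<le> c" for a b c :: real using that by linarith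
          from this[OF qYY[of x0] F_le[of x0]] show ?thesis using 2 x0 by simp
        qed
        show "0 \<le> \<rho> x0" using \<rho>pos[of x0] 2 by simp
      qed
      finally have "E x \<le> \<rho> x0 * (3/2 * m\<^sup>2) * exp 2" by simp
      moreover have "\<rho> x * (m\<^sup>2 * (Y x)\<^sup>2 / 2) \<le> \<rho> x * (((Y1 x)\<^sup>2 + m\<^sup>2 * (Y x)\<^sup>2) / 2)"
        using \<rho>pos[of x] 2 by (intro mult_left_mono) auto
      moreover note E_low[of x]
      ultimately have "\<rho> x * (m\<^sup>2 * (Y x)\<^sup>2 / 2) \<le> \<rho> x0 * (3/2 * m\<^sup>2) * exp 2"
        using 2 by auto
      then have "m\<^sup>2 * (\<rho> x * (Y x)\<^sup>2) \<le> m\<^sup>2 * (3 * exp 2 * \<rho> x0)" by (simp add: algebra_simps)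
      then have main: "\<rho> x * (Y x)\<^sup>2 \<le> 3 * exp 2 * \<rho> x0" using m0 by simp
      have sx: "sin x > 0" "cos x > 0" using sc[of x] 2 x0 x2 by auto
      have cx: "cos \<theta> \<le> cos x" using x \<theta> by (intro cos_monotone_0_pi_le) auto
      have "cos \<theta> * ((Y x)\<^sup>2 * sin x ^ k) \<le> cos x * ((Y x)\<^sup>2 * sin x ^ k)"
        using cx sx by (intro mult_right_mono) auto
      also have "\<dots> \<le> 3 * exp 2 * \<rho> x0" using main by (simp add: \<rho>_def algebra_simps)
      also have "\<dots> \<le> 3 * exp 2 * sin x0 ^ k"
        unfolding \<rho>_def using sc[of x0] x0 pi_gt_zero by (intro mult_left_mono mult_left_le) auto
      finally have fin: "(Y x)\<^sup>2 * sin x ^ k \<le> 3 * exp 2 / cos \<theta> * sin x0 ^ k"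
        using cos\<theta> by (simp add: field_simps)
      have sx0: "0 \<le> sin x0" using sc[of x0] x0 pi_gt_zero by auto
      have "sin x0 \<le> sin x" using 2 x0 x2 by (intro sin_monotone_2pi_le) auto
      then have "3 * exp 2 / cos \<theta> * sin x0 ^ k \<le> 3 * exp 2 / cos \<theta> * sin x ^ k"
        using sx0 cos\<theta> by (intro mult_left_mono power_mono) auto
      with fin have "(Y x)\<^sup>2 * sin x ^ k \<le> 3 * exp 2 / cos \<theta> * sin x ^ k" by linarith
      then have r1: "(Y x)\<^sup>2 \<le> 3 * exp 2 / cos \<theta>" by (rule mult_right_le_imp_le) (use sx in simp)
      have "(Y x)\<^sup>2 * (m * sin x) ^ k = m ^ k * ((Y x)\<^sup>2 * sin x ^ k)" by (simp add: power_mult_distrib)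
      also have "\<dots> \<le> m ^ k * (3 * exp 2 / cos \<theta> * sin x0 ^ k)" using fin m0 by (intro mult_left_mono) auto
      also have "\<dots> = 3 * exp 2 / cos \<theta> * (m * sin x0) ^ k" by (simp add: power_mult_distrib)
      also have "\<dots> \<le> 3 * exp 2 / cos \<theta> * real k ^ k"
      proof (intro mult_left_mono power_mono)
        have "m * sin x0 \<le> m * x0" using sin_x_le_x[of x0] x0 m0 by (intro mult_left_mono) auto
        then show "m * sin x0 \<le> real k" using m0 by (simp add: x0_def)
      qed (use sx0 m0 cos\<theta> in auto)
      finally show ?thesis using r1 by simp
    qed
    then show "(Y x)\<^sup>2 \<le> 3 * exp 2 / cos \<theta>" "(Y x)\<^sup>2 * (m * sin x) ^ k \<le> 3 * exp 2 * real k ^ k / cos \<theta>"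
      by auto
  qed
qed

text \<open>Substituting the squared sine of \<open>x\<close> for \<open>z\<close> turns the Jacobi
  equation into the oscillator equation with \<open>k = d + 1\<close> and m^2 = 4n(n + d/2 + 1). The
  angle \<open>\<theta>\<close> belonging to \<open>z1\<close> is below pi/2, which keeps the factor
  1/cos \<theta> finite.\<close>

lemma jacobi_poly_decay:
  fixes d :: nat and z1 :: real
  assumes d: "d \<ge> 1" and z1: "0 < z1" "z1 < 1"
  obtains C n0 where "C \<ge> 0"
    "\<And>n z. n \<ge> n0 \<Longrightarrow> 0 \<le> z \<Longrightarrow> z \<le> z1 \<Longrightarrow>
      (poly (jacobi_poly (real d / 2) n) z)\<^sup>2 * (1 + (real n)\<^sup>2 * z) powr (real (d + 1) / 2) \<le> C"
proof -
  define \<theta> where "\<theta> = arcsin (sqrt z1)"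
  have sz1: "0 < sqrt z1" "sqrt z1 < 1" using z1 by auto
  have \<theta>: "0 < \<theta>" "\<theta> < pi/2"
    using arcsin_less_arcsin[of 0 "sqrt z1"] arcsin_less_arcsin[of "sqrt z1" 1] sz1
    by (auto simp: \<theta>_def)
  define k where "k = d + 1"
  \<comment> \<open>Makes \<open>m\<close> pass both thresholds of the oscillator bound, since
    \<open>m \<ge> 2 * real n\<close>.\<close>
  define n0 where "n0 = nat \<lceil>max (tan \<theta>) (4 * real k / pi)\<rceil> + 1"
  define C1 where "C1 = 3 * exp 2 / cos \<theta>"
  define C2 where "C2 = 3 * exp 2 * real k ^ k / cos \<theta>"
  define C where "C = 2 powr (real k / 2) * max C1 C2"
  have "cos \<theta> > 0" using \<theta> by (intro cos_gt_zero) auto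
  then have "C1 \<ge> 0" by (simp add: C1_def)
  then have C0: "C \<ge> 0" by (simp add: C_def le_max_iff_disj)
  have "(poly (jacobi_poly (real d / 2) n) z)\<^sup>2 * (1 + (real n)\<^sup>2 * z) powr (real (d + 1) / 2) \<le> C"
    if n: "n \<ge> n0" and z: "0 \<le> z" "z \<le> z1" for n z
  proof -
    define x where "x = arcsin (sqrt z)"
    have sz: "0 \<le> sqrt z" "sqrt z \<le> sqrt z1" "sqrt z \<le> 1" using z z1 by auto
    have x: "0 \<le> x" "x \<le> \<theta>"
      using arcsin_le_arcsin[of 0 "sqrt z"] arcsin_le_arcsin[of "sqrt z" "sqrt z1"] sz sz1
      by (auto simp: x_def \<theta>_def)
    have sinx: "sin x = sqrt z"
      unfolding x_def by (rule sin_arcsin) (use sz in linarith)+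
    define m where "m = sqrt (4 * real n * (real n + real d / 2 + 1))"
    have mge: "m \<ge> 2 * real n"
      unfolding m_def by (rule real_le_rsqrt) (simp add: power2_eq_square algebra_simps)
    have m2: "m\<^sup>2 = 4 * real n * (real n + real d / 2 + 1)" by (simp add: m_def)
    have "max (tan \<theta>) (4 * real k / pi) \<le> real n0" unfolding n0_def by linarith
    with n mge have m: "m \<ge> tan \<theta>" "m \<ge> 4 * real k / pi" by auto
    define P where "P = jacobi_poly (real d / 2) n"
    define Y where "Y x = poly P ((sin x)\<^sup>2)" for x
    define Y1 where "Y1 x = 2 * sin x * cos x * poly (pderiv P) ((sin x)\<^sup>2)" for x
    define Y2 where "Y2 x = 4 * (sin x)\<^sup>2 * (cos x)\<^sup>2 * poly (pderiv (pderiv P)) ((sin x)\<^sup>2)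
        + 2 * ((cos x)\<^sup>2 - (sin x)\<^sup>2) * poly (pderiv P) ((sin x)\<^sup>2)" for x
    have Dp: "((\<lambda>x. poly Q ((sin x)\<^sup>2)) has_real_derivative poly (pderiv Q) ((sin u)\<^sup>2) * (2 * sin u * cos u)) (at u)" for Q u
    proof -
      have "((\<lambda>x. (sin x)\<^sup>2) has_real_derivative (2 * sin u * cos u)) (at u)"
        by (auto intro!: derivative_eq_intros)
      from DERIV_chain[OF poly_DERIV[of Q] this] show ?thesis by (simp add: o_def)
    qed
    have DY: "(Y has_real_derivative Y1 u) (at u)" for u
      unfolding Y_def[abs_def] Y1_def using Dp[of P u] by (simp add: mult_ac)
    have DY1: "(Y1 has_real_derivative Y2 u) (at u)" for u
      unfolding Y1_def[abs_def] Y2_def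
      by (rule derivative_eq_intros Dp refl)+ (simp add: algebra_simps power2_eq_square)
    have ode: "Y2 u = - (real k * (cos u / sin u) - sin u / cos u) * Y1 u - m\<^sup>2 * Y u"
      if u: "0 < u" "u < pi/2" for u
    proof -
      have s: "sin u > 0" "cos u > 0" using u by (auto intro!: sin_gt_zero cos_gt_zero)
      define S where "S = (sin u)\<^sup>2"
      have c: "(cos u)\<^sup>2 = 1 - S" by (simp add: S_def cos_squared_eq)
      have A: "(real k * (cos u / sin u) - sin u / cos u) * Y1 u = 2 * (real k * (cos u)\<^sup>2 - (sin u)\<^sup>2) * poly (pderiv P) S"
        unfolding Y1_def S_def using s by (simp add: divide_simps) (simp add: algebra_simps power2_eq_square)
      have B: "S * (1 - S) * poly (pderiv (pderiv P)) S + ((real d / 2 + 1) - (real d / 2 + 2) * S) * poly (pderiv P) S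
        + real n * (real n + real d / 2 + 1) * poly P S = 0"
        unfolding P_def by (rule jacobi_poly_ode) (use d in simp)
      have "Y2 u + (real k * (cos u / sin u) - sin u / cos u) * Y1 u + m\<^sup>2 * Y u = 
         4 * (S * (1 - S) * poly (pderiv (pderiv P)) S + ((real d / 2 + 1) - (real d / 2 + 2) * S) * poly (pderiv P) S
        + real n * (real n + real d / 2 + 1) * poly P S)"
        unfolding A unfolding Y2_def Y_def m2 c S_def[symmetric] k_def by (simp add: algebra_simps)
      then show ?thesis unfolding B mult_minus_left by linarith
    qed
    note bd = weighted_oscillator_bound[of Y Y1 Y2 k m \<theta> x, OF DY DY1 ode _ _ _ \<theta> m x]
    have bd1: "(Y x)\<^sup>2 \<le> C1" and bd2: "(Y x)\<^sup>2 * (m * sin x) ^ k \<le> C2"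
      using bd by (auto simp: C1_def C2_def Y_def Y1_def P_def k_def)
    \<comment> \<open>As \<open>a\<close> is at most \<open>m * sin x\<close>, the two oscillator
      bounds cover the two regimes: for \<open>a \<le> 1\<close> the weight is at most a power of 2,
      beyond that it is comparable to \<open>a ^ k\<close>.\<close>
    define a where "a = real n * sqrt z"
    have a0: "a \<ge> 0" using z by (simp add: a_def)
    have a2: "(real n)\<^sup>2 * z = a\<^sup>2" using z by (simp add: a_def power_mult_distrib)
    have Yx: "Y x = poly P z" using z by (simp add: Y_def sinx)
    have "a \<le> m * sin x" unfolding a_def sinx using mge sz by (intro mult_right_mono) auto
    then have "(Y x)\<^sup>2 * a ^ k \<le> (Y x)\<^sup>2 * (m * sin x) ^ k"
      using a0 by (intro mult_left_mono power_mono) auto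
    with bd2 have bd2: "(Y x)\<^sup>2 * a ^ k \<le> C2" by simp
    have "(Y x)\<^sup>2 * (1 + a\<^sup>2) powr (real k / 2) \<le> C"
    proof (cases "a \<le> 1")
      case True
      then have "a\<^sup>2 \<le> 1" using a0 by (simp add: power_le_one)
      then have "(1 + a\<^sup>2) powr (real k / 2) \<le> 2 powr (real k / 2)" by (intro powr_mono2) (auto intro: add_nonneg_nonneg)
      then have "(Y x)\<^sup>2 * (1 + a\<^sup>2) powr (real k / 2) \<le> max C1 C2 * 2 powr (real k / 2)"
        using bd1 by (intro mult_mono) (auto simp: \<open>C1 \<ge> 0\<close> le_max_iff_disj)
      then show ?thesis by (simp add: C_def mult.commute)
    next
      case False
      then have a1: "a > 1" by simp
      then have "1 \<le> a\<^sup>2" by (simp add: one_le_power)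
      then have "(1 + a\<^sup>2) powr (real k / 2) \<le> (2 * a\<^sup>2) powr (real k / 2)" by (intro powr_mono2) auto
      also have "\<dots> = 2 powr (real k / 2) * (a\<^sup>2) powr (real k / 2)" by (simp add: powr_mult)
      also have "(a\<^sup>2) powr (real k / 2) = a ^ k"
      proof -
        have "(a\<^sup>2) powr (real k / 2) = (a powr 2) powr (real k / 2)" using a1 by (simp add: powr_numeral)
        also have "\<dots> = a powr (real k)" by (simp add: powr_powr)
        also have "\<dots> = a ^ k" using a1 by (simp add: powr_realpow)
        finally show ?thesis .
      qed
      finally have "(Y x)\<^sup>2 * (1 + a\<^sup>2) powr (real k / 2) \<le> (Y x)\<^sup>2 * (2 powr (real k / 2) * a ^ k)"
        by (intro mult_left_mono) auto
      also have "\<dots> = 2 powr (real k / 2) * ((Y x)\<^sup>2 * a ^ k)" by simp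
      also have "\<dots> \<le> C" unfolding C_def using bd2 by (intro mult_left_mono) auto
      finally show ?thesis .
    qed
    then show ?thesis unfolding a2 Yx P_def k_def .
  qed
  with C0 that show ?thesis by blast
qed

section \<open>Mehler-Heine asymptotics\<close>

text \<open>The slope \<open>s\<close> is -1 and 1 in its two uses, for the two Pochhammer factors
  in the numerator of \<open>jacobi_coeff\<close>.\<close>

lemma tendsto_pochhammer_div_power:
  fixes s c :: real
  shows "((\<lambda>n. pochhammer (s * real n + c) k / real n ^ k) \<longlongrightarrow> s ^ k) sequentially"
proof (induction k)
  case (Suc k)
  have "((\<lambda>n. s + (c + real k) * (1 / real n)) \<longlongrightarrow> s + (c + real k) * 0) sequentially"
    by (intro tendsto_intros lim_1_over_n)
  moreover have "eventually (\<lambda>n. s + (c + real k) * (1 / real n) = (s * real n + c + real k) / real n) sequentially"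
    using eventually_gt_at_top[of 0] by eventually_elim (simp add: field_simps)
  ultimately have "((\<lambda>n. (s * real n + c + real k) / real n) \<longlongrightarrow> s) sequentially"
    by (simp add: filterlim_cong)
  from tendsto_mult[OF Suc this] show ?case
    by (simp add: pochhammer_Suc mult_ac)
qed simp

lemma abs_pochhammer_neg_le: "\<bar>pochhammer (- real n) k\<bar> \<le> real n ^ k"
proof (induction k)
  case (Suc k)
  show ?case
  proof (cases "k \<le> n")
    case True
    then have "\<bar>- real n + real k\<bar> \<le> real n" by auto
    with Suc have "\<bar>pochhammer (- real n) k\<bar> * \<bar>- real n + real k\<bar> \<le> real n ^ k * real n"
      by (intro mult_mono) auto
    then show ?thesis by (simp add: pochhammer_Suc abs_mult mult.commute)
  next
    case False
    then show ?thesis by (simp add: pochhammer_of_nat_eq_0_lemma)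
  qed
qed simp

lemma pochhammer_le_power: "0 \<le> x \<Longrightarrow> pochhammer x k \<le> (x + real k) ^ k" for x :: real
proof (induction k)
  case (Suc k)
  have "pochhammer x k * (x + real k) \<le> (x + real (Suc k)) ^ k * (x + real (Suc k))"
    using Suc by (intro mult_mono order.trans[OF Suc.IH] power_mono) auto
  then show ?case by (simp add: pochhammer_Suc mult.commute)
qed simp

lemma pochhammer_ge_1: "1 \<le> x \<Longrightarrow> 1 \<le> pochhammer x k" for x :: real
proof (induction k)
  case (Suc k)
  have "1 * 1 \<le> pochhammer x k * (x + real k)"
    using Suc by (intro mult_mono) auto
  then show ?case by (simp add: pochhammer_Suc)
qed simp

text \<open>Once n^2 is absorbed into the argument, the bound no longer depends on \<open>n\<close>:
  this is the majorant for the passage to the limit. For \<open>k \<le> n\<close> and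
  \<open>n \<ge> 1\<close> the largest factor n + \<alpha> + 1 + k is at most (\<alpha> + 3)
  n.\<close>

lemma abs_jacobi_coeff_le:
  assumes \<alpha>: "\<alpha> > 0" and n: "n \<ge> 1"
  shows "\<bar>jacobi_coeff \<alpha> n k\<bar> \<le> ((\<alpha> + 3) * (real n)\<^sup>2) ^ k / fact k"
proof (cases "k \<le> n")
  case True
  have "1 \<le> real n" using n by simp
  then have "\<alpha> * 1 \<le> \<alpha> * real n" using \<alpha> by (intro mult_left_mono) auto
  then have le: "real n + \<alpha> + 1 + real k \<le> (\<alpha> + 3) * real n" using True n by (simp add: algebra_simps)
  have "pochhammer (real n + \<alpha> + 1) k \<le> (real n + \<alpha> + 1 + real k) ^ k"
    using \<alpha> by (intro pochhammer_le_power) auto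
  also have "\<dots> \<le> ((\<alpha> + 3) * real n) ^ k" using le \<alpha> by (intro power_mono) auto
  finally have p: "pochhammer (real n + \<alpha> + 1) k \<le> ((\<alpha> + 3) * real n) ^ k" .
  have p0: "pochhammer (real n + \<alpha> + 1) k > 0" using \<alpha> by (intro pochhammer_pos) auto
  have q: "pochhammer (\<alpha> + 1) k \<ge> 1" using \<alpha> by (intro pochhammer_ge_1) auto
  have "\<bar>jacobi_coeff \<alpha> n k\<bar> = \<bar>pochhammer (- real n) k\<bar> * pochhammer (real n + \<alpha> + 1) k / (pochhammer (\<alpha> + 1) k * fact k)"
    unfolding jacobi_coeff_def using p0 q by (simp add: abs_mult)
  also have "\<dots> \<le> real n ^ k * ((\<alpha> + 3) * real n) ^ k / (1 * fact k)"
    using p p0 q abs_pochhammer_neg_le[of n k]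
    by (intro frac_le mult_mono mult_nonneg_nonneg) auto
  also have "\<dots> = ((\<alpha> + 3) * (real n)\<^sup>2) ^ k / fact k"
    by (simp add: power_mult_distrib power2_eq_square)
  finally show ?thesis .
qed (use \<alpha> in \<open>simp add: jacobi_coeff_eq_0\<close>)

text \<open>Dominated convergence for series, with an exponential series as majorant. The filter is
  arbitrary because degree and argument will both depend on the lattice spacing. For
  \<open>w > 0\<close> the limit is Gamma(\<alpha> + 1) w^(-\<alpha>/2) J(2 sqrt w), where J is the
  Bessel function of order \<alpha>.\<close>

theorem jacobi_poly_Mehler_Heine:
  fixes N :: "'a \<Rightarrow> nat" and z :: "'a \<Rightarrow> real"
  assumes \<alpha>: "\<alpha> > 0" and N: "filterlim N at_top F"
    and z: "((\<lambda>e. (real (N e))\<^sup>2 * z e) \<longlongrightarrow> w) F" and F: "F \<noteq> bot"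
  shows "((\<lambda>e. poly (jacobi_poly \<alpha> (N e)) (z e)) \<longlongrightarrow> (\<Sum>k. (- w) ^ k / (pochhammer (\<alpha> + 1) k * fact k))) F"
proof -
  define B where "B = (\<bar>w\<bar> + 1) * (\<alpha> + 3)"
  have N1: "eventually (\<lambda>e. N e \<ge> 1) F" using N by (simp add: filterlim_at_top)
  have "((\<lambda>e. \<bar>(real (N e))\<^sup>2 * z e\<bar>) \<longlongrightarrow> \<bar>w\<bar>) F" using z by (intro tendsto_intros)
  then have "eventually (\<lambda>e. \<bar>(real (N e))\<^sup>2 * z e\<bar> < \<bar>w\<bar> + 1) F"
    by (rule order_tendstoD) simp
  with N1 have ev: "eventually (\<lambda>e. \<forall>k. norm (jacobi_coeff \<alpha> (N e) k * z e ^ k) \<le> B ^ k / fact k) F"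
  proof eventually_elim
    case (elim e)
    show ?case
    proof
      fix k
      have "norm (jacobi_coeff \<alpha> (N e) k * z e ^ k) \<le> ((\<alpha> + 3) * (real (N e))\<^sup>2) ^ k / fact k * \<bar>z e\<bar> ^ k"
        unfolding real_norm_def abs_mult power_abs
        using abs_jacobi_coeff_le[OF \<alpha>, of "N e" k] elim by (intro mult_right_mono) auto
      also have "\<dots> = (\<bar>(real (N e))\<^sup>2 * z e\<bar> * (\<alpha> + 3)) ^ k / fact k"
        by (simp add: power_mult_distrib abs_mult mult_ac)
      also have "\<dots> \<le> B ^ k / fact k"
        unfolding B_def using elim \<alpha> by (intro divide_right_mono power_mono mult_right_mono) auto
      finally show "norm (jacobi_coeff \<alpha> (N e) k * z e ^ k) \<le> B ^ k / fact k" .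
    qed
  qed
  have lim: "((\<lambda>e. jacobi_coeff \<alpha> (N e) k * z e ^ k) \<longlongrightarrow> (- w) ^ k / (pochhammer (\<alpha> + 1) k * fact k)) F" for k
  proof -
    have a: "((\<lambda>e. pochhammer (- real (N e)) k / real (N e) ^ k) \<longlongrightarrow> (-1) ^ k) F"
      using filterlim_compose[OF tendsto_pochhammer_div_power[of "-1" 0 k] N] by simp
    have b: "((\<lambda>e. pochhammer (real (N e) + \<alpha> + 1) k / real (N e) ^ k) \<longlongrightarrow> 1) F"
      using filterlim_compose[OF tendsto_pochhammer_div_power[of 1 "\<alpha> + 1" k] N] by (simp add: add_ac)
    have "((\<lambda>e. (pochhammer (- real (N e)) k / real (N e) ^ k) * (pochhammer (real (N e) + \<alpha> + 1) k / real (N e) ^ k)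
       * ((real (N e))\<^sup>2 * z e) ^ k / (pochhammer (\<alpha> + 1) k * fact k)) \<longlongrightarrow> (-1) ^ k * 1 * w ^ k / (pochhammer (\<alpha> + 1) k * fact k)) F"
      by (intro tendsto_intros a b z) (use \<alpha> pochhammer_pos[of "\<alpha> + 1" k] in auto)
    moreover have "eventually (\<lambda>e. (pochhammer (- real (N e)) k / real (N e) ^ k) * (pochhammer (real (N e) + \<alpha> + 1) k / real (N e) ^ k)
       * ((real (N e))\<^sup>2 * z e) ^ k / (pochhammer (\<alpha> + 1) k * fact k) = jacobi_coeff \<alpha> (N e) k * z e ^ k) F"
      using N1
    proof eventually_elim
      case (elim e)
      then have "N e > 0" by simp
      then show ?case
        unfolding jacobi_coeff_def power2_eq_square power_mult_distrib by (simp add: field_simps)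
    qed
    ultimately show ?thesis
      by (simp add: filterlim_cong power_minus[of w])
  qed
  have "eventually (\<lambda>(k, e). norm (jacobi_coeff \<alpha> (N e) k * z e ^ k) \<le> B ^ k / fact k) (at_top \<times>\<^sub>F F)"
    unfolding eventually_prod_filter
    by (rule exI[of _ "\<lambda>_. True"], rule exI[of _ "\<lambda>e. \<forall>k. norm (jacobi_coeff \<alpha> (N e) k * z e ^ k) \<le> B ^ k / fact k"])
      (use ev in auto)
  from tannerys_theorem[OF lim this _ F]
  have "((\<lambda>e. \<Sum>k. jacobi_coeff \<alpha> (N e) k * z e ^ k) \<longlongrightarrow> (\<Sum>k. (- w) ^ k / (pochhammer (\<alpha> + 1) k * fact k))) F"
    using summable_exp[of B] by (simp add: divide_inverse mult.commute)
  also have "(\<lambda>e. \<Sum>k. jacobi_coeff \<alpha> (N e) k * z e ^ k) = (\<lambda>e. poly (jacobi_poly \<alpha> (N e)) (z e))"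
    unfolding poly_jacobi_poly by (rule ext, rule suminf_finite) (auto simp: jacobi_coeff_eq_0)
  finally show ?thesis .
qed

section \<open>Fourier transforms on the lattice\<close>

definition fourier :: "(int^'n \<Rightarrow> real) \<Rightarrow> real^'n \<Rightarrow> complex" where
  "fourier x \<xi> = infsum (\<lambda>v. complex_of_real (x v) * cis (\<xi> \<bullet> rvec v)) UNIV"

lemma rvec_simps [simp]: "rvec 0 = 0" "rvec (u + v) = rvec u + rvec v" "rvec (- v) = - rvec v"
  by (simp_all add: rvec_def vec_eq_iff)

lemma infsum_finite_support:
  fixes g :: "'a \<Rightarrow> 'b::{comm_monoid_add,t2_space}"
  assumes "finite S" "\<And>v. v \<notin> S \<Longrightarrow> g v = 0"
  shows "infsum g UNIV = sum g S"
proof -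
  have "infsum g UNIV = infsum g S"
    using assms by (intro infsum_cong_neutral) auto
  with assms show ?thesis by simp
qed

lemma fourier_eq_sum:
  assumes "finite S" "\<And>v. v \<notin> S \<Longrightarrow> x v = 0"
  shows "fourier x \<xi> = (\<Sum>v\<in>S. complex_of_real (x v) * cis (\<xi> \<bullet> rvec v))"
  unfolding fourier_def using assms by (intro infsum_finite_support) auto

lemma conv_eq_sum:
  assumes "finite S" "\<And>v. v \<notin> S \<Longrightarrow> x v = 0"
  shows "conv \<omega> x v = (\<Sum>\<eta>\<in>S. \<omega> (v - \<eta>) * x \<eta>)"
  unfolding conv_def using assms by (intro infsum_finite_support) auto

lemma conv_support:
  assumes "finite {v. x v \<noteq> 0}" "conv \<omega> x v \<noteq> 0"
  obtains u \<eta> where "v = u + \<eta>" "\<omega> u \<noteq> 0" "x \<eta> \<noteq> 0"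
proof -
  have "conv \<omega> x v = (\<Sum>\<eta>\<in>{v. x v \<noteq> 0}. \<omega> (v - \<eta>) * x \<eta>)"
    by (rule conv_eq_sum) (use assms in auto)
  with assms have "\<exists>\<eta>\<in>{v. x v \<noteq> 0}. \<omega> (v - \<eta>) * x \<eta> \<noteq> 0"
    by (metis (no_types, lifting) sum.neutral)
  then obtain \<eta> where "x \<eta> \<noteq> 0" "\<omega> (v - \<eta>) \<noteq> 0" by auto
  then show ?thesis using that[of "v - \<eta>" \<eta>] by simp
qed

lemma finite_conv_support:
  assumes "finite {v. \<omega> v \<noteq> 0}" "finite {v. x v \<noteq> 0}"
  shows "finite {v. conv \<omega> x v \<noteq> 0}"
proof (rule finite_subset)
  show "{v. conv \<omega> x v \<noteq> 0} \<subseteq> (\<lambda>(u, \<eta>). u + \<eta>) ` ({v. \<omega> v \<noteq> 0} \<times> {v. x v \<noteq> 0})"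
  proof
    fix v assume "v \<in> {v. conv \<omega> x v \<noteq> 0}"
    then obtain u \<eta> where "v = u + \<eta>" "\<omega> u \<noteq> 0" "x \<eta> \<noteq> 0"
      using conv_support[OF assms(2), of \<omega> v] by auto
    then show "v \<in> (\<lambda>(u, \<eta>). u + \<eta>) ` ({v. \<omega> v \<noteq> 0} \<times> {v. x v \<noteq> 0})"
      by (intro image_eqI[of _ _ "(u, \<eta>)"]) auto
  qed
  show "finite ((\<lambda>(u, \<eta>). u + \<eta>) ` ({v. \<omega> v \<noteq> 0} \<times> {v. x v \<noteq> 0}))"
    using assms by simp
qed

lemma fourier_conv:
  assumes \<omega>: "finite {v. \<omega> v \<noteq> 0}" and x: "finite {v. x v \<noteq> 0}"
  shows "fourier (conv \<omega> x) \<xi> = fourier \<omega> \<xi> * fourier x \<xi>"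
proof -
  let ?T = "{v. \<omega> v \<noteq> 0}" and ?S = "{v. x v \<noteq> 0}"
  define U where "U = (\<lambda>(u, \<eta>). u + \<eta>) ` (?T \<times> ?S)"
  have U: "finite U" using assms by (simp add: U_def)
  have supp: "conv \<omega> x v = 0" if "v \<notin> U" for v
  proof (rule ccontr)
    assume "conv \<omega> x v \<noteq> 0"
    then obtain u \<eta> where "v = u + \<eta>" "\<omega> u \<noteq> 0" "x \<eta> \<noteq> 0"
      using conv_support[OF x, of \<omega> v] by auto
    then have "v \<in> U" unfolding U_def by (intro image_eqI[of _ _ "(u, \<eta>)"]) auto
    with that show False by simp
  qed
  let ?e = "\<lambda>v. cis (\<xi> \<bullet> rvec v)"
  have conv_e: "conv \<omega> x v = (\<Sum>\<eta>\<in>?S. \<omega> (v - \<eta>) * x \<eta>)" for v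
    by (rule conv_eq_sum) (use x in auto)
  have "fourier (conv \<omega> x) \<xi> = (\<Sum>v\<in>U. complex_of_real (conv \<omega> x v) * ?e v)"
    using U supp by (rule fourier_eq_sum)
  also have "\<dots> = (\<Sum>v\<in>U. \<Sum>\<eta>\<in>?S. complex_of_real (\<omega> (v - \<eta>)) * x \<eta> * ?e v)"
    by (simp add: conv_e sum_distrib_right)
  also have "\<dots> = (\<Sum>\<eta>\<in>?S. \<Sum>v\<in>U. complex_of_real (\<omega> (v - \<eta>)) * x \<eta> * ?e v)"
    by (rule sum.swap)
  also have "\<dots> = (\<Sum>\<eta>\<in>?S. \<Sum>u\<in>?T. complex_of_real (\<omega> u) * x \<eta> * ?e (u + \<eta>))"
  proof (rule sum.cong[OF refl])
    fix \<eta> assume "\<eta> \<in> ?S"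
    then have sub: "(\<lambda>u. u + \<eta>) ` ?T \<subseteq> U" by (auto simp: U_def)
    have "(\<Sum>v\<in>U. complex_of_real (\<omega> (v - \<eta>)) * x \<eta> * ?e v)
      = (\<Sum>v\<in>(\<lambda>u. u + \<eta>) ` ?T. complex_of_real (\<omega> (v - \<eta>)) * x \<eta> * ?e v)"
    proof (rule sum.mono_neutral_right[OF U sub], rule ballI)
      fix v assume v: "v \<in> U - (\<lambda>u. u + \<eta>) ` ?T"
      have "v = (v - \<eta>) + \<eta>" by simp
      with v have "\<omega> (v - \<eta>) = 0" by blast
      then show "complex_of_real (\<omega> (v - \<eta>)) * x \<eta> * ?e v = 0" by simp
    qed
    also have "\<dots> = (\<Sum>u\<in>?T. complex_of_real (\<omega> u) * x \<eta> * ?e (u + \<eta>))"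
      by (subst sum.reindex) (auto simp: inj_on_def)
    finally show "(\<Sum>v\<in>U. complex_of_real (\<omega> (v - \<eta>)) * x \<eta> * ?e v)
      = (\<Sum>u\<in>?T. complex_of_real (\<omega> u) * x \<eta> * ?e (u + \<eta>))" .
  qed
  also have "\<dots> = (\<Sum>u\<in>?T. complex_of_real (\<omega> u) * ?e u) * (\<Sum>\<eta>\<in>?S. complex_of_real (x \<eta>) * ?e \<eta>)"
    by (subst sum.swap) (simp add: sum_product inner_add_right cis_mult[symmetric] mult_ac)
  also have "\<dots> = fourier \<omega> \<xi> * fourier x \<xi>"
    by (intro arg_cong2[of _ _ _ _ "(*)"] fourier_eq_sum[symmetric]) (use assms in auto)
  finally show ?thesis .
qed

lemma fourier_unitv: "fourier (unitv 0) \<xi> = 1"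
  by (subst fourier_eq_sum[of "{0}"]) (auto simp: unitv_def)

lemma finite_unitv_support [simp]: "finite {v. unitv a v \<noteq> 0}"
  by (simp add: unitv_def)

lemma fourier_linear:
  assumes "finite {v. x v \<noteq> 0}" "finite {v. y v \<noteq> 0}"
  shows "fourier (\<lambda>v. a * x v + b * y v) \<xi> = a * fourier x \<xi> + b * fourier y \<xi>"
proof -
  let ?S = "{v. x v \<noteq> 0} \<union> {v. y v \<noteq> 0}"
  have "fourier (\<lambda>v. a * x v + b * y v) \<xi> = (\<Sum>v\<in>?S. complex_of_real (a * x v + b * y v) * cis (\<xi> \<bullet> rvec v))"
    "fourier x \<xi> = (\<Sum>v\<in>?S. complex_of_real (x v) * cis (\<xi> \<bullet> rvec v))"
    "fourier y \<xi> = (\<Sum>v\<in>?S. complex_of_real (y v) * cis (\<xi> \<bullet> rvec v))"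
    using assms by (intro fourier_eq_sum; auto)+
  then show ?thesis by (simp add: sum_distrib_left sum.distrib algebra_simps)
qed

lemma finite_linear_support:
  assumes "finite {v. x v \<noteq> 0}" "finite {v. y v \<noteq> 0}"
  shows "finite {v. a * x v + b * y v \<noteq> (0::real)}"
  by (rule finite_subset[of _ "{v. x v \<noteq> 0} \<union> {v. y v \<noteq> 0}"]) (use assms in auto)

section \<open>The symbol of the walk and the iterates on the Fourier side\<close>

text \<open>The half-angle form of \<open>z(\<xi>)\<close>. For a nonnegative
  \<open>\<omega>\<close> every summand is nonnegative, so single vectors of the support give lower
  bounds, and the behaviour at the origin reduces to that of the sine.\<close>

definition walk_symbol :: "(int^'n \<Rightarrow> real) \<Rightarrow> real^'n \<Rightarrow> real" where
  "walk_symbol \<omega> \<xi> = (\<Sum>v\<in>{v. \<omega> v \<noteq> 0}. \<omega> v * (sin (\<xi> \<bullet> rvec v / 2))\<^sup>2)"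

lemma fourier_step_law:
  fixes \<omega> :: "int^'n \<Rightarrow> real"
  assumes fin: "finite {v. \<omega> v \<noteq> 0}" and total: "(\<Sum>v\<in>{v. \<omega> v \<noteq> 0}. \<omega> v) = 1"
    and symm: "\<And>v. \<omega> (- v) = \<omega> v"
  shows "fourier \<omega> \<xi> = complex_of_real (1 - 2 * walk_symbol \<omega> \<xi>)"
proof -
  let ?S = "{v. \<omega> v \<noteq> 0}"
  have F: "fourier \<omega> \<xi> = (\<Sum>v\<in>?S. complex_of_real (\<omega> v) * cis (\<xi> \<bullet> rvec v))"
    by (rule fourier_eq_sum) (use fin in auto)
  have "(\<Sum>v\<in>?S. \<omega> v * sin (\<xi> \<bullet> rvec v)) = (\<Sum>v\<in>?S. \<omega> (- v) * sin (\<xi> \<bullet> rvec (- v)))"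
    by (rule sum.reindex_bij_witness[of _ uminus uminus]) (auto simp: symm)
  also have "\<dots> = - (\<Sum>v\<in>?S. \<omega> v * sin (\<xi> \<bullet> rvec v))"
    by (simp add: symm sum_negf)
  finally have Im0: "(\<Sum>v\<in>?S. \<omega> v * sin (\<xi> \<bullet> rvec v)) = 0" by simp
  have c: "cos a = 1 - 2 * (sin (a / 2))\<^sup>2" for a :: real
    using cos_double_sin[of "a/2"] by simp
  have "(\<Sum>v\<in>?S. \<omega> v * cos (\<xi> \<bullet> rvec v)) = 1 - 2 * walk_symbol \<omega> \<xi>"
    unfolding c walk_symbol_def using total
    by (simp add: algebra_simps sum_subtractf sum_distrib_left)
  with Im0 F show ?thesis
    by (simp add: complex_eq_iff)
qed

lemma finite_jacobi_support:
  fixes \<omega> :: "int^'n \<Rightarrow> real"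
  assumes "finite {v. \<omega> v \<noteq> 0}"
  shows "finite {v. jacobi \<omega> n v \<noteq> 0}"
proof -
  have "finite {v. jacobi \<omega> n v \<noteq> 0} \<and> finite {v. jacobi \<omega> (Suc n) v \<noteq> 0}"
  proof (induction n)
    case 0
    then show ?case
      using finite_linear_support[OF finite_conv_support[OF assms finite_unitv_support] finite_unitv_support]
      by simp
  next
    case (Suc n)
    let ?d = "real CARD('n)"
    have e: "jacobi \<omega> (Suc (Suc n)) = (\<lambda>v. 1 * (ja ?d (Suc n) * conv \<omega> (jacobi \<omega> (Suc n)) v
        + jb ?d (Suc n) * jacobi \<omega> (Suc n) v) + (- jc ?d (Suc n)) * jacobi \<omega> n v)"
      by (simp add: fun_eq_iff)
    from Suc have "finite {v. jacobi \<omega> (Suc (Suc n)) v \<noteq> 0}"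
      unfolding e by (intro finite_linear_support finite_conv_support assms) auto
    with Suc show ?case by simp
  qed
  then show ?thesis by simp
qed

lemma fourier_jacobi:
  fixes \<omega> :: "int^'n \<Rightarrow> real"
  assumes fin: "finite {v. \<omega> v \<noteq> 0}" and total: "(\<Sum>v\<in>{v. \<omega> v \<noteq> 0}. \<omega> v) = 1"
    and symm: "\<And>v. \<omega> (- v) = \<omega> v"
  shows "fourier (jacobi \<omega> n) \<xi> = complex_of_real (poly (jacobi_poly (real CARD('n) / 2) n) (walk_symbol \<omega> \<xi>))"
proof -
  let ?d = "real CARD('n)"
  let ?P = "\<lambda>n. poly (jacobi_poly (?d / 2) n) (walk_symbol \<omega> \<xi>)"
  have d: "?d > 0" by simp
  note fo = fourier_step_law[OF fin total symm]
  note fj = finite_jacobi_support[OF fin]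
  note fc = fourier_conv[OF fin]
  have "fourier (jacobi \<omega> n) \<xi> = complex_of_real (?P n) \<and> fourier (jacobi \<omega> (Suc n)) \<xi> = complex_of_real (?P (Suc n))"
  proof (induction n)
    case 0
    have "fourier (jacobi \<omega> 0) \<xi> = complex_of_real (?P 0)"
      by (simp add: fourier_unitv poly_jacobi_poly)
    moreover have "fourier (jacobi \<omega> (Suc 0)) \<xi> = complex_of_real (?P (Suc 0))"
      unfolding poly_jacobi_poly_rec(1)[OF d]
      by (simp add: fourier_linear finite_conv_support[OF fin] fc fo fourier_unitv)
    ultimately show ?case by simp
  next
    case (Suc n)
    let ?a = "ja ?d (Suc n)" and ?b = "jb ?d (Suc n)" and ?c = "jc ?d (Suc n)"
    \<comment> \<open>The factor 1 brings the three-term step into the two-term shape of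
      \<open>fourier_linear\<close>.\<close>
    have e: "jacobi \<omega> (Suc (Suc n)) = (\<lambda>v. 1 * (?a * conv \<omega> (jacobi \<omega> (Suc n)) v + ?b * jacobi \<omega> (Suc n) v) + (- ?c) * jacobi \<omega> n v)"
      by (simp add: fun_eq_iff)
    have "fourier (jacobi \<omega> (Suc (Suc n))) \<xi> = complex_of_real (?P (Suc (Suc n)))"
      unfolding e poly_jacobi_poly_rec(2)[OF d]
      by (subst fourier_linear fourier_linear[OF finite_conv_support[OF fin fj] fj],
          rule finite_linear_support[OF finite_conv_support[OF fin fj] fj], rule fj)
        (simp add: fourier_linear finite_conv_support[OF fin] fc fo fj Suc)
    then show ?case using Suc by simp
  qed
  then show ?thesis by simp
qed

section \<open>Growth of the support\<close>

lemma finite_support_radius: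
  fixes \<omega> :: "int^'n \<Rightarrow> real"
  assumes fin: "finite {v. \<omega> v \<noteq> 0}"
  obtains R :: int where "R \<ge> 0" "\<And>v i. \<omega> v \<noteq> 0 \<Longrightarrow> \<bar>v $ i\<bar> \<le> R"
proof
  let ?R = "\<Sum>v\<in>{v. \<omega> v \<noteq> 0}. \<Sum>i\<in>UNIV. \<bar>v $ i\<bar>"
  show "?R \<ge> 0" by (intro sum_nonneg) auto
  fix v i assume v: "\<omega> v \<noteq> 0"
  have "\<bar>v $ i\<bar> \<le> (\<Sum>i\<in>UNIV. \<bar>v $ i\<bar>)" by (rule member_le_sum) auto
  also have "\<dots> \<le> ?R"
    using v fin by (intro member_le_sum[of v _ "\<lambda>v. \<Sum>i\<in>UNIV. \<bar>v $ i\<bar>"]) (auto intro: sum_nonneg)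
  finally show "\<bar>v $ i\<bar> \<le> ?R" .
qed

text \<open>Finite propagation speed: a step enlarges the support by at most \<open>R\<close> in
  each coordinate. This counts the support points for the l1 bound and confines the rescaled
  measures to a fixed ball.\<close>

lemma jacobi_support_bound:
  fixes \<omega> :: "int^'n \<Rightarrow> real" and R :: int
  assumes fin: "finite {v. \<omega> v \<noteq> 0}" and R: "R \<ge> 0" "\<And>v i. \<omega> v \<noteq> 0 \<Longrightarrow> \<bar>v $ i\<bar> \<le> R"
    and v: "jacobi \<omega> n v \<noteq> 0"
  shows "\<bar>v $ i\<bar> \<le> R * int n"
proof -
  note fj = finite_jacobi_support[OF fin]
  have cs: "\<bar>v $ i\<bar> \<le> R * int (Suc n)"
    if A: "conv \<omega> x v \<noteq> 0" "finite {v. x v \<noteq> 0}" "\<And>v i. x v \<noteq> 0 \<Longrightarrow> \<bar>v $ i\<bar> \<le> R * int n" for x v n i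
  proof -
    obtain u \<eta> where "v = u + \<eta>" "\<omega> u \<noteq> 0" "x \<eta> \<noteq> 0" using conv_support[OF A(2,1)] .
    with R(2)[of u i] A(3)[of \<eta> i] show ?thesis by (simp add: algebra_simps)
  qed
  have mono: "\<bar>v $ i\<bar> \<le> R * int (Suc n)" if "\<bar>v $ i\<bar> \<le> R * int n" for v :: "int^'n" and n i
    using that R(1) by (simp add: algebra_simps)
  have u0: "\<bar>v $ i\<bar> \<le> R * int 0" if "unitv 0 v \<noteq> 0" for v :: "int^'n" and i
    using that by (simp add: unitv_def split: if_splits)
  have "(\<forall>v i. jacobi \<omega> n v \<noteq> 0 \<longrightarrow> \<bar>v $ i\<bar> \<le> R * int n) \<and> (\<forall>v i. jacobi \<omega> (Suc n) v \<noteq> 0 \<longrightarrow> \<bar>v $ i\<bar> \<le> R * int (Suc n))"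
  proof (induction n)
    case 0
    have "\<bar>v $ i\<bar> \<le> R * int (Suc 0)" if "jacobi \<omega> (Suc 0) v \<noteq> 0" for v i
    proof -
      from that consider "conv \<omega> (unitv 0) v \<noteq> 0" | "unitv 0 v \<noteq> 0" by fastforce
      then show ?thesis
      proof cases
        case 1
        then show ?thesis by (rule cs[OF _ finite_unitv_support u0])
      next
        case 2
        then show ?thesis by (intro mono u0)
      qed
    qed
    then show ?case using u0 by simp
  next
    case (Suc n)
    have "\<bar>v $ i\<bar> \<le> R * int (Suc (Suc n))" if "jacobi \<omega> (Suc (Suc n)) v \<noteq> 0" for v i
    proof -
      from that consider "conv \<omega> (jacobi \<omega> (Suc n)) v \<noteq> 0" | "jacobi \<omega> (Suc n) v \<noteq> 0" | "jacobi \<omega> n v \<noteq> 0"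
        by fastforce
      then show ?thesis
      proof cases
        case 1
        have "\<bar>v $ i\<bar> \<le> R * int (Suc n)" if "jacobi \<omega> (Suc n) v \<noteq> 0" for v i
          using Suc that by blast
        then show ?thesis by (rule cs[OF 1 fj])
      next
        case 2
        then show ?thesis using Suc by (intro mono[of _ _ "Suc n"]) blast
      next
        case 3
        then show ?thesis using Suc by (intro mono[of _ _ "Suc n"] mono[of _ _ n]) blast
      qed
    qed
    with Suc show ?case by blast
  qed
  with v show ?thesis by blast
qed

section \<open>Aperiodicity and the symbol\<close>

lemma walk_law_props:
  assumes fin: "finite {v. \<omega> v \<noteq> 0}" and nonneg: "\<And>v. \<omega> v \<ge> 0"
  shows "finite {v. walk_law \<omega> n v \<noteq> 0}" "walk_law \<omega> n v \<ge> 0" "fourier (walk_law \<omega> n) \<xi> = fourier \<omega> \<xi> ^ n"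
proof -
  have A: "finite {v. walk_law \<omega> n v \<noteq> 0} \<and> (\<forall>v. walk_law \<omega> n v \<ge> 0) \<and> fourier (walk_law \<omega> n) \<xi> = fourier \<omega> \<xi> ^ n"
  proof (induction n)
    case 0
    then show ?case by (simp add: fourier_unitv) (simp add: unitv_def)
  next
    case (Suc n)
    then have f: "finite {v. walk_law \<omega> n v \<noteq> 0}" by simp
    have "conv \<omega> (walk_law \<omega> n) v \<ge> 0" for v
      using f Suc nonneg by (subst conv_eq_sum[OF f]) (auto intro!: sum_nonneg)
    then show ?case using Suc finite_conv_support[OF fin f] fourier_conv[OF fin f] by simp
  qed
  show "finite {v. walk_law \<omega> n v \<noteq> 0}" "walk_law \<omega> n v \<ge> 0" "fourier (walk_law \<omega> n) \<xi> = fourier \<omega> \<xi> ^ n"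
    using A by auto
qed

text \<open>If the symbol takes the value 1, then the characteristic function of the step is $-1$ at that
  frequency, so the walk can return to the origin only at even times.\<close>

lemma walk_symbol_less_1:
  fixes \<omega> :: "int^'n \<Rightarrow> real"
  assumes fin: "finite {v. \<omega> v \<noteq> 0}" and nonneg: "\<And>v. \<omega> v \<ge> 0"
    and total: "(\<Sum>v\<in>{v. \<omega> v \<noteq> 0}. \<omega> v) = 1" and symm: "\<And>v. \<omega> (- v) = \<omega> v"
    and aper: "aperiodic \<omega>"
  shows "walk_symbol \<omega> \<xi> < 1"
proof (rule ccontr)
  assume "\<not> walk_symbol \<omega> \<xi> < 1"
  moreover have "walk_symbol \<omega> \<xi> \<le> (\<Sum>v\<in>{v. \<omega> v \<noteq> 0}. \<omega> v * 1)"
    unfolding walk_symbol_def using nonneg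
    by (intro sum_mono mult_left_mono) (auto simp: sin_squared_eq)
  ultimately have "walk_symbol \<omega> \<xi> = 1" using total by simp
  then have F: "fourier \<omega> \<xi> = -1" using fourier_step_law[OF fin total symm, of \<xi>] by simp
  have z0: "walk_symbol \<omega> 0 = 0" by (simp add: walk_symbol_def)
  have F0: "fourier \<omega> 0 = 1" using fourier_step_law[OF fin total symm, of 0] by (simp add: z0)
  have ev: "even n" if n: "walk_law \<omega> n 0 > 0" for n
  proof (rule ccontr)
    assume odd: "odd n"
    let ?w = "walk_law \<omega> n"
    let ?S = "{v. ?w v \<noteq> 0}"
    note wp = walk_law_props[OF fin nonneg, of n]
    have F_sum: "fourier ?w \<zeta> = (\<Sum>v\<in>?S. complex_of_real (?w v) * cis (\<zeta> \<bullet> rvec v))" for \<zeta>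
      by (rule fourier_eq_sum) (use wp(1) in auto)
    have "fourier ?w \<xi> = -1" "fourier ?w 0 = 1" using wp(3) F F0 odd by simp_all
    then have "(\<Sum>v\<in>?S. complex_of_real (?w v) * cis (\<xi> \<bullet> rvec v)) = -1"
       "(\<Sum>v\<in>?S. complex_of_real (?w v) * cis (0 \<bullet> rvec v)) = 1"
      unfolding F_sum .
    from this[THEN arg_cong[of _ _ Re]]
    have "(\<Sum>v\<in>?S. ?w v * cos (\<xi> \<bullet> rvec v)) = -1" "(\<Sum>v\<in>?S. ?w v) = 1" by simp_all
    \<comment> \<open>For odd \<open>n\<close> the cosine average equals -1 while the total mass is
      1. Added up, nonnegative terms sum to zero, although the term at the origin is twice the
      positive return probability.\<close>
    then have sum0: "(\<Sum>v\<in>?S. ?w v * (1 + cos (\<xi> \<bullet> rvec v))) = 0"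
      by (simp add: algebra_simps sum.distrib)
    have "?w v * (1 + cos (\<xi> \<bullet> rvec v)) = 0" if "v \<in> ?S" for v
    proof -
      have nn: "0 \<le> ?w v * (1 + cos (\<xi> \<bullet> rvec v))" for v
      proof -
        have "0 \<le> 1 + cos (\<xi> \<bullet> rvec v)" using cos_ge_minus_one[of "\<xi> \<bullet> rvec v"] by linarith
        then show ?thesis using wp(2) by (intro mult_nonneg_nonneg)
      qed
      have "(\<Sum>v\<in>?S. ?w v * (1 + cos (\<xi> \<bullet> rvec v))) = 0 \<longleftrightarrow> (\<forall>v\<in>?S. ?w v * (1 + cos (\<xi> \<bullet> rvec v)) = 0)"
        by (rule sum_nonneg_eq_0_iff[OF wp(1) nn])
      with sum0 that show ?thesis by blast
    qed
    from this[of 0] n show False by simp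
  qed
  then have "2 dvd Gcd {n::nat. n \<ge> 1 \<and> walk_law \<omega> n 0 > 0}"
    by (intro Gcd_greatest) auto
  with aper show False by (simp add: aperiodic_def)
qed

section \<open>Parseval identity\<close>

lemma
  fixes g :: "real^'n \<Rightarrow> 'b::{banach,second_countable_topology}" and A :: "real^'n^'n"
  assumes A: "det A \<noteq> 0" and [measurable]: "g \<in> borel_measurable borel"
  shows integral_lborel_matrix_vector_mult: "(LINT x|lborel. g x) = \<bar>det A\<bar> *\<^sub>R (LINT x|lborel. g (A *v x))"
    and integrable_lborel_matrix_vector_mult: "integrable lborel (\<lambda>x. g (A *v x)) \<longleftrightarrow> integrable lborel g"
proof -
  note L = lborel_matrix_vector_mult[OF A]
  have "(LINT x|lborel. g x) = (LINT x|density (distr lborel borel ((*v) A)) (\<lambda>_. \<bar>det A\<bar>). g x)"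
    using L by simp
  also have "\<dots> = \<bar>det A\<bar> *\<^sub>R (LINT x|lborel. g (A *v x))"
    by (subst integral_density) (auto simp: integral_distr)
  finally show "(LINT x|lborel. g x) = \<bar>det A\<bar> *\<^sub>R (LINT x|lborel. g (A *v x))" .
  have "integrable lborel g \<longleftrightarrow> integrable (density (distr lborel borel ((*v) A)) (\<lambda>_. \<bar>det A\<bar>)) g"
    using L by simp
  also have "\<dots> \<longleftrightarrow> integrable lborel (\<lambda>x. \<bar>det A\<bar> *\<^sub>R g (A *v x))"
    by (subst integrable_density) (auto simp: integrable_distr_eq)
  also have "\<dots> \<longleftrightarrow> integrable lborel (\<lambda>x. g (A *v x))"
  proof
    assume "integrable lborel (\<lambda>x. \<bar>det A\<bar> *\<^sub>R g (A *v x))"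
    from integrable_scaleR_right[of "1 / \<bar>det A\<bar>", OF this] A
    show "integrable lborel (\<lambda>x. g (A *v x))" by simp
  qed simp
  finally show "integrable lborel (\<lambda>x. g (A *v x)) \<longleftrightarrow> integrable lborel g" ..
qed

lemma has_bochner_integral_cis_period:
  "has_bochner_integral lborel (\<lambda>s. indicator {0..1} s *\<^sub>R cis (2 * pi * s * real_of_int k)) (if k = 0 then 1 else 0)"
proof (cases "k = 0")
  case True
  have "has_bochner_integral lborel (\<lambda>s::real. indicator {0..1} s *\<^sub>R (1::complex)) (measure lborel {0..1::real} *\<^sub>R 1)"
    by (intro has_bochner_integral_scaleR_left has_bochner_integral_real_indicator) auto
  then show ?thesis using True by simp
next
  case False
  let ?F = "\<lambda>s. cis (2 * pi * s * real_of_int k) / (\<i> * complex_of_real (2 * pi * real_of_int k))"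
  have "has_bochner_integral lborel (\<lambda>s. indicator {0..1} s *\<^sub>R cis (2 * pi * s * real_of_int k)) (?F 1 - ?F 0)"
  proof (rule has_bochner_integral_FTC_Icc)
    fix s :: real
    have "((\<lambda>s. cis (2 * pi * s * real_of_int k)) has_vector_derivative
       (2 * pi * real_of_int k) *\<^sub>R (\<i> * cis (2 * pi * s * real_of_int k))) (at s within {0..1})"
      using exp_scaleR_has_vector_derivative_right[of "\<i> * complex_of_real (2 * pi * real_of_int k)" s "{0..1}"]
      by (simp add: cis_conv_exp scaleR_conv_of_real mult_ac)
    then have "(?F has_vector_derivative ((2 * pi * real_of_int k) *\<^sub>R (\<i> * cis (2 * pi * s * real_of_int k)))
        / (\<i> * complex_of_real (2 * pi * real_of_int k))) (at s within {0..1})"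
      by (rule has_vector_derivative_divide)
    then show "(?F has_vector_derivative cis (2 * pi * s * real_of_int k)) (at s within {0..1})"
      using False by (simp add: scaleR_conv_of_real)
    show "continuous_on {0..1} (\<lambda>s. cis (2 * pi * s * real_of_int k))"
      by (intro continuous_intros)
  qed simp
  moreover have "cis (2 * pi * real_of_int k) = 1"
    using cis_multiple_2pi[of "real_of_int k"] by (simp add: mult_ac)
  ultimately show ?thesis using False by simp
qed

lemma prod_cis: "finite A \<Longrightarrow> (\<Prod>i\<in>A. cis (f i)) = cis (\<Sum>i\<in>A. f i)"
  by (induction A rule: finite_induct) (auto simp: cis_mult)

text \<open>A fundamental domain for the frequencies after scaling by 2 pi, written as a product of
  coordinate indicators so that integrals of characters factor.\<close>

definition unit_cube :: "real^'n \<Rightarrow> real" where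
  "unit_cube \<xi> = (\<Prod>i\<in>UNIV. indicator {0..1} (\<xi> $ i))"

lemma unit_cube_eq: "unit_cube \<xi> = (if \<forall>i. 0 \<le> \<xi> $ i \<and> \<xi> $ i \<le> 1 then 1 else 0)"
  by (auto simp: unit_cube_def indicator_def prod_zero_iff)

lemma borel_measurable_unit_cube [measurable]: "unit_cube \<in> borel_measurable borel"
  unfolding unit_cube_def[abs_def] by measurable

lemma has_bochner_integral_character:
  fixes v :: "int^'n"
  shows "has_bochner_integral lborel (\<lambda>\<xi>. unit_cube \<xi> *\<^sub>R cis (((2 * pi) *\<^sub>R \<xi>) \<bullet> rvec v)) (if v = 0 then 1 else 0)"
proof -
  let ?f = "\<lambda>(i::'n) (s::real). indicator {0..1} s *\<^sub>R cis (2 * pi * s * real_of_int (v $ i))"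
  have i: "integrable lborel (?f i)" for i
    using has_bochner_integral_cis_period[of "v $ i"] by (simp add: has_bochner_integral_iff)
  have e: "unit_cube \<xi> *\<^sub>R cis (((2 * pi) *\<^sub>R \<xi>) \<bullet> rvec v) = (\<Prod>i\<in>UNIV. ?f i (\<xi> $ i))" for \<xi>
  proof -
    have "((2 * pi) *\<^sub>R \<xi>) \<bullet> rvec v = (\<Sum>i\<in>UNIV. 2 * pi * \<xi> $ i * real_of_int (v $ i))"
      by (simp add: inner_vec_def rvec_def)
    then show ?thesis
      unfolding unit_cube_def scaleR_conv_of_real[where 'a = complex] by (simp only: prod.distrib prod_cis of_real_prod finite)
  qed
  have "(\<Prod>i\<in>UNIV. LINT s|lborel. ?f i s) = (\<Prod>i\<in>UNIV. if v $ i = 0 then 1 else 0)"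
    using has_bochner_integral_cis_period by (intro prod.cong) (auto simp: has_bochner_integral_iff)
  also have "\<dots> = (if v = 0 then 1 else 0)" by (auto simp: vec_eq_iff)
  finally have P: "(\<Prod>i\<in>UNIV. LINT s|lborel. ?f i s) = (if v = 0 then 1 else 0)" .
  show ?thesis
    unfolding e has_bochner_integral_iff integral_lborel_vec_prod[of ?f, OF i] P
    by (intro conjI refl integrable_lborel_vec_prod i)
qed

theorem fourier_Parseval:
  fixes x :: "int^'n \<Rightarrow> real"
  assumes S: "finite S" "\<And>v. v \<notin> S \<Longrightarrow> x v = 0"
  shows "has_bochner_integral lborel (\<lambda>\<xi>. unit_cube \<xi> * (cmod (fourier x ((2 * pi) *\<^sub>R \<xi>)))\<^sup>2) (\<Sum>v\<in>S. (x v)\<^sup>2)"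
proof -
  have "has_bochner_integral lborel (\<lambda>\<xi>. \<Sum>u\<in>S. \<Sum>v\<in>S. complex_of_real (x u * x v) *
      (unit_cube \<xi> *\<^sub>R cis (((2 * pi) *\<^sub>R \<xi>) \<bullet> rvec (u - v))))
     (\<Sum>u\<in>S. \<Sum>v\<in>S. complex_of_real (x u * x v) * (if u - v = 0 then 1 else 0))"
    by (intro has_bochner_integral_sum has_bochner_integral_mult_right has_bochner_integral_character)
  also have "(\<Sum>u\<in>S. \<Sum>v\<in>S. complex_of_real (x u * x v) * (if u - v = 0 then 1 else 0))
     = complex_of_real (\<Sum>v\<in>S. (x v)\<^sup>2)"
    using S by (simp add: if_distrib power2_eq_square cong: if_cong)
  also have "(\<lambda>\<xi>. \<Sum>u\<in>S. \<Sum>v\<in>S. complex_of_real (x u * x v) *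
      (unit_cube \<xi> *\<^sub>R cis (((2 * pi) *\<^sub>R \<xi>) \<bullet> rvec (u - v))))
    = (\<lambda>\<xi>. complex_of_real (unit_cube \<xi> * (cmod (fourier x ((2 * pi) *\<^sub>R \<xi>)))\<^sup>2))"
  proof (rule ext)
    fix \<xi>
    let ?F = "fourier x ((2 * pi) *\<^sub>R \<xi>)"
    have r: "rvec (u - v) = rvec u - rvec v" for u v :: "int^'n" by (simp add: rvec_def vec_eq_iff)
    have F: "?F = (\<Sum>v\<in>S. complex_of_real (x v) * cis (((2 * pi) *\<^sub>R \<xi>) \<bullet> rvec v))"
      using S by (rule fourier_eq_sum)
    have "complex_of_real (unit_cube \<xi> * (cmod ?F)\<^sup>2) = unit_cube \<xi> * (?F * cnj ?F)"
      using complex_norm_square[of ?F] by simp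
    also have "\<dots> = (\<Sum>u\<in>S. \<Sum>v\<in>S. complex_of_real (x u * x v) *
      (unit_cube \<xi> *\<^sub>R cis (((2 * pi) *\<^sub>R \<xi>) \<bullet> rvec (u - v))))"
    proof -
      have "?F * cnj ?F = (\<Sum>u\<in>S. \<Sum>v\<in>S. (complex_of_real (x u) * cis (((2 * pi) *\<^sub>R \<xi>) \<bullet> rvec u))
          * cnj (complex_of_real (x v) * cis (((2 * pi) *\<^sub>R \<xi>) \<bullet> rvec v)))"
        by (simp only: F cnj_sum sum_product)
      moreover have "(complex_of_real p * cis a) * cnj (complex_of_real q * cis b) = complex_of_real (p * q) * cis (a - b)" for p q a b
        using cis_mult[of a "- b"] by (simp add: cis_cnj)
      ultimately show ?thesis
        by (simp only: r inner_diff_right sum_distrib_left scaleR_conv_of_real[where 'a = complex] mult.left_commute)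
    qed
    finally show "(\<Sum>u\<in>S. \<Sum>v\<in>S. complex_of_real (x u * x v) *
      (unit_cube \<xi> *\<^sub>R cis (((2 * pi) *\<^sub>R \<xi>) \<bullet> rvec (u - v)))) = complex_of_real (unit_cube \<xi> * (cmod ?F)\<^sup>2)" ..
  qed
  finally have "has_bochner_integral lborel (\<lambda>\<xi>. complex_of_real (unit_cube \<xi> * (cmod (fourier x ((2 * pi) *\<^sub>R \<xi>)))\<^sup>2)) (complex_of_real (\<Sum>v\<in>S. (x v)\<^sup>2))" .
  then show ?thesis
    unfolding has_bochner_integral_iff complex_of_real_integrable_eq integral_complex_of_real of_real_eq_iff .
qed

section \<open>Elementary estimates on the line\<close>

lemma integrable_powr_decay:
  fixes \<gamma> :: real
  assumes "\<gamma> > 1"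
  shows "integrable lborel (\<lambda>s::real. (1 + \<bar>s\<bar>) powr (- \<gamma>))"
proof -
  let ?f = "\<lambda>s::real. (1 + \<bar>s\<bar>) powr (- \<gamma>)"
  let ?F = "\<lambda>s::real. (1 + s) powr (1 - \<gamma>) / (1 - \<gamma>)"
  have "(\<integral>\<^sup>+ s. ennreal (?f s) * indicator {0..} s \<partial>lborel) = ennreal (0 - ?F 0)"
  proof (rule nn_integral_FTC_atLeast)
    show "DERIV ?F s :> ?f s" if "0 \<le> s" for s
      using that assms by (auto intro!: derivative_eq_intros)
    have "((\<lambda>s::real. (1 + s) powr (1 - \<gamma>)) \<longlongrightarrow> 0) at_top"
      using assms by (intro tendsto_neg_powr filterlim_tendsto_add_at_top[OF tendsto_const] filterlim_ident) auto
    then show "(?F \<longlongrightarrow> 0) at_top"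
      using tendsto_divide[of _ 0 at_top "\<lambda>_. 1 - \<gamma>" "1 - \<gamma>"] assms by simp
  qed auto
  then have "(\<integral>\<^sup>+ s. ennreal (norm (indicator {0..} s *\<^sub>R ?f s)) \<partial>lborel) < \<infinity>"
    by (simp add: indicator_mult_ennreal mult.commute)
  then have "integrable lborel (\<lambda>s. indicator {0..} s *\<^sub>R ?f s)"
    by (intro integrableI_bounded) auto
  then have "has_bochner_integral lborel (\<lambda>s. indicator {0..} s *\<^sub>R ?f s) (LINT s|lborel. indicator {0..} s *\<^sub>R ?f s)"
    by (rule has_bochner_integral_integrable)
  from has_bochner_integral_even_function[OF this] show ?thesis
    by (simp add: has_bochner_integral_iff)
qed

text \<open>Jordan's inequality: the sine is concave on [0, pi], so up to pi/2 it lies above its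
  chord.\<close>

lemma two_abs_le_abs_sin_pi:
  fixes t :: real
  assumes "\<bar>t\<bar> \<le> 1/2"
  shows "2 * \<bar>t\<bar> \<le> \<bar>sin (pi * t)\<bar>"
proof -
  have *: "2 * t \<le> sin (pi * t)" if t: "0 \<le> t" "t \<le> 1/2" for t
  proof -
    have "concave_on {0..pi} sin"
      by (rule f''_le0_imp_concave[where f' = cos and f'' = "\<lambda>x. - sin x"])
        (auto intro!: derivative_eq_intros sin_ge_zero)
    then have "u * sin x + v * sin y \<le> sin (u *\<^sub>R x + v *\<^sub>R y)"
      if "x \<in> {0..pi}" "y \<in> {0..pi}" "u \<ge> 0" "v \<ge> 0" "u + v = 1" for x y u v
      unfolding concave_on_iff using that by blast
    from this[of 0 "pi / 2" "1 - 2 * t" "2 * t"] t show ?thesis by (simp add: mult.commute)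
  qed
  show ?thesis
  proof (cases "t \<ge> 0")
    case True
    then show ?thesis using *[of t] assms by auto
  next
    case False
    then show ?thesis using *[of "-t"] assms by auto
  qed
qed

section \<open>Norm bounds for the iterates\<close>

lemma sin_pi_squared_ge_round:
  "4 * (s - of_int (round s))\<^sup>2 \<le> (sin (pi * s))\<^sup>2" for s :: real
proof -
  define j where "j = round s"
  have a: "\<bar>s - of_int j\<bar> \<le> 1/2"
    using of_int_round_abs_le[of s] by (simp add: j_def abs_minus_commute)
  have sj: "sin (pi * of_int j) = 0" by (metis mult.commute sin_zero_iff_int2)
  then have cj: "(cos (pi * of_int j))\<^sup>2 = 1" by (simp add: cos_squared_eq)
  have "sin (pi * (s - of_int j)) = sin (pi * s) * cos (pi * of_int j)"
    by (simp add: right_diff_distrib sin_diff sj)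
  then have "(sin (pi * (s - of_int j)))\<^sup>2 = (sin (pi * s))\<^sup>2"
    by (simp add: power_mult_distrib cj)
  moreover have "(2 * \<bar>s - of_int j\<bar>)\<^sup>2 \<le> \<bar>sin (pi * (s - of_int j))\<bar>\<^sup>2"
    using two_abs_le_abs_sin_pi[OF a] by (intro power_mono) auto
  ultimately show ?thesis by (simp add: power_mult_distrib j_def)
qed

text \<open>By the quadratic lower bound for the squared sine, the integrand is dominated by bumps
  of width 1/n around the integers of the window. There are finitely many of them, each integrable
  as \<open>\<gamma> > 1\<close>, and rescaling by \<open>n\<close> gives the factor 1/n.\<close>

lemma periodic_decay_integral_bound:
  fixes c \<gamma> :: real and K :: nat
  assumes c: "c > 0" and \<gamma>: "\<gamma> > 1"
  defines "h \<equiv> \<lambda>(n::nat) s. indicator {- real K .. real K} s * (1 + c * (real n)\<^sup>2 * (sin (pi * s))\<^sup>2) powr (- \<gamma> / 2)"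
  obtains C where "C \<ge> 0" "\<And>n. n \<ge> 1 \<Longrightarrow> integrable lborel (h n)"
    "\<And>n. n \<ge> 1 \<Longrightarrow> (LINT s|lborel. h n s) \<le> C / real n"
proof -
  define H where "H s = (1 + \<bar>s\<bar>) powr (- \<gamma>)" for s :: real
  have H: "integrable lborel H" unfolding H_def[abs_def] by (rule integrable_powr_decay[OF \<gamma>])
  \<comment> \<open>The 1/2 pays for (1 + a)^2 \<le> 2(1 + a^2); the minimum lies below both
    coefficients of 1 + 4 c a^2.\<close>
  define c' where "c' = min 1 (4 * c) / 2"
  have c': "c' > 0" using c by (simp add: c'_def)
  define J where "J = {- int K .. int K}"
  define B where "B = c' powr (- \<gamma> / 2)"
  define C where "C = B * (real (card J) * (LINT s|lborel. H s))"
  have H0: "H s \<ge> 0" for s by (simp add: H_def)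
  have IH: "(LINT s|lborel. H s) \<ge> 0" by (simp add: H0)
  have C0: "C \<ge> 0" using IH by (simp add: C_def B_def)
  \<comment> \<open>Only the integer nearest to \<open>s\<close> is needed, but the sum over all
    integers of the window avoids cutting the line into pieces, and its summands are affine copies
    of one function \<open>H\<close>.\<close>
  have bound: "h n s \<le> B * (\<Sum>j\<in>J. H (- (real n * of_int j) + real n * s))" for n s
  proof (cases "s \<in> {- real K .. real K}")
    case True
    define j where "j = round s"
    have "round (of_int (- int K) :: real) \<le> round s" "round s \<le> round (of_int (int K) :: real)"
      using True by (intro round_mono; simp)+
    then have jJ: "j \<in> J" unfolding round_of_int by (simp add: J_def j_def)
    define a where "a = real n * \<bar>s - of_int j\<bar>"
    have a0: "a \<ge> 0" by (simp add: a_def)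
    have "1 + 4 * c * a\<^sup>2 \<le> 1 + c * (real n)\<^sup>2 * (sin (pi * s))\<^sup>2"
    proof -
      have "4 * c * a\<^sup>2 = c * (real n)\<^sup>2 * (4 * (s - of_int j)\<^sup>2)"
        by (simp add: a_def power_mult_distrib)
      also have "\<dots> \<le> c * (real n)\<^sup>2 * (sin (pi * s))\<^sup>2"
        using sin_pi_squared_ge_round[of s] c by (intro mult_left_mono) (auto simp: j_def)
      finally show ?thesis by simp
    qed
    moreover have "c' * (1 + a)\<^sup>2 \<le> 1 + 4 * c * a\<^sup>2"
    proof -
      have "0 \<le> (1 - a)\<^sup>2" by simp
      then have "(1 + a)\<^sup>2 \<le> 2 * (1 + a\<^sup>2)" by (simp add: power2_eq_square algebra_simps)
      then have "c' * (1 + a)\<^sup>2 \<le> c' * (2 * (1 + a\<^sup>2))" using c' by (intro mult_left_mono) auto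
      also have "\<dots> = min 1 (4 * c) * 1 + min 1 (4 * c) * a\<^sup>2" by (simp add: c'_def algebra_simps)
      also have "\<dots> \<le> 1 * 1 + 4 * c * a\<^sup>2" by (intro add_mono mult_right_mono) auto
      finally show ?thesis by simp
    qed
    ultimately have le: "c' * (1 + a)\<^sup>2 \<le> 1 + c * (real n)\<^sup>2 * (sin (pi * s))\<^sup>2" by linarith
    have pos: "0 < c' * (1 + a)\<^sup>2" using c' a0 by simp
    have "h n s = (1 + c * (real n)\<^sup>2 * (sin (pi * s))\<^sup>2) powr (- \<gamma> / 2)"
      using True by (simp add: h_def)
    also have "\<dots> \<le> (c' * (1 + a)\<^sup>2) powr (- \<gamma> / 2)"
      using le pos \<gamma> by (intro powr_mono2') auto
    also have "\<dots> = B * ((1 + a) powr 2) powr (- \<gamma> / 2)"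
      using c' a0 by (simp add: B_def powr_mult powr_numeral)
    also have "\<dots> = B * H (- (real n * of_int j) + real n * s)"
    proof -
      have "\<bar>- (real n * of_int j) + real n * s\<bar> = a"
      proof -
        have "- (real n * of_int j) + real n * s = real n * (s - of_int j)" by (simp add: algebra_simps)
        then show ?thesis by (simp add: a_def abs_mult)
      qed
      then show ?thesis unfolding H_def powr_powr by simp
    qed
    also have "\<dots> \<le> B * (\<Sum>j\<in>J. H (- (real n * of_int j) + real n * s))"
      using jJ H0 by (intro mult_left_mono member_le_sum) (auto simp: B_def J_def)
    finally show ?thesis .
  next
    case False
    then show ?thesis using H0 by (auto simp: h_def B_def intro!: mult_nonneg_nonneg sum_nonneg)
  qed
  have intS: "integrable lborel (\<lambda>s. B * (\<Sum>j\<in>J. H (- (real n * of_int j) + real n * s)))" if "n \<ge> 1" for n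
    using that by (intro integrable_mult_right Bochner_Integration.integrable_sum lborel_integrable_real_affine H) auto
  have inth: "integrable lborel (h n)" if "n \<ge> 1" for n
  proof (rule Bochner_Integration.integrable_bound[OF intS[OF that]])
    show "h n \<in> borel_measurable lborel" unfolding h_def by measurable
    have "h n s \<ge> 0" for s by (simp add: h_def)
    then show "AE s in lborel. norm (h n s) \<le> norm (B * (\<Sum>j\<in>J. H (- (real n * of_int j) + real n * s)))"
      by (intro AE_I2) (simp only: real_norm_def abs_of_nonneg, rule order_trans[OF bound abs_ge_self])
  qed
  have "(LINT s|lborel. h n s) \<le> C / real n" if n: "n \<ge> 1" for n
  proof -
    have "(LINT s|lborel. h n s) \<le> (LINT s|lborel. B * (\<Sum>j\<in>J. H (- (real n * of_int j) + real n * s)))"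
      using n by (intro integral_mono inth intS bound)
    also have "\<dots> = B * (\<Sum>j\<in>J. LINT s|lborel. H (- (real n * of_int j) + real n * s))"
      unfolding integral_mult_right_zero
      by (subst Bochner_Integration.integral_sum, rule lborel_integrable_real_affine[OF H]) (use n in auto)
    also have "\<dots> = B * (\<Sum>j\<in>J. (LINT s|lborel. H s) / real n)"
    proof -
      have "(LINT s|lborel. H (- (real n * of_int j) + real n * s)) = (LINT s|lborel. H s) / real n" for j :: int
        using lborel_integral_real_affine[of "real n" H "- (real n * of_int j)"] n by simp
      then show ?thesis by simp
    qed
    also have "\<dots> = C / real n" by (simp add: C_def)
    finally show ?thesis .
  qed
  with C0 inth that show ?thesis by blast
qed

section \<open>Full rank and the lower bound for the symbol\<close>

lemma covariance_mult:
  fixes \<omega> :: "int^'n \<Rightarrow> real"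
  shows "covariance \<omega> *v a = (\<Sum>v\<in>{v. \<omega> v \<noteq> 0}. (\<omega> v * (rvec v \<bullet> a)) *\<^sub>R rvec v)"
proof (rule vec_eq_iff[THEN iffD2], rule allI)
  fix i
  have "(covariance \<omega> *v a) $ i = (\<Sum>j\<in>UNIV. \<Sum>v\<in>{v. \<omega> v \<noteq> 0}. \<omega> v * (rvec v $ i) * (rvec v $ j) * a $ j)"
    by (simp add: matrix_vector_mult_def covariance_def sum_distrib_right)
  also have "\<dots> = (\<Sum>v\<in>{v. \<omega> v \<noteq> 0}. \<Sum>j\<in>UNIV. \<omega> v * (rvec v $ i) * (rvec v $ j) * a $ j)"
    by (rule sum.swap)
  also have "\<dots> = (\<Sum>v\<in>{v. \<omega> v \<noteq> 0}. (\<omega> v * (rvec v \<bullet> a)) *\<^sub>R rvec v) $ i"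
    by (simp add: inner_vec_def sum_distrib_left sum_distrib_right mult_ac)
  finally show "(covariance \<omega> *v a) $ i = (\<Sum>v\<in>{v. \<omega> v \<noteq> 0}. (\<omega> v * (rvec v \<bullet> a)) *\<^sub>R rvec v) $ i" .
qed

text \<open>A vector orthogonal to the support lies in the kernel of the covariance, which is
  trivial; hence the support spans the space and contains a basis. The basis is one over the reals
  and need not generate the lattice.\<close>

lemma full_rank_support_basis:
  fixes \<omega> :: "int^'n \<Rightarrow> real"
  assumes fullrank: "rank (covariance \<omega>) = CARD('n)"
  obtains V :: "'n \<Rightarrow> int^'n" where "\<And>i. \<omega> (V i) \<noteq> 0" "det (\<chi> i. rvec (V i)) \<noteq> 0"
proof -
  let ?S = "rvec ` {v. \<omega> v \<noteq> 0}"
  have span: "span ?S = UNIV"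
  proof (rule ccontr)
    assume "span ?S \<noteq> UNIV"
    then obtain a where a: "a \<noteq> 0" "\<forall>x\<in>span ?S. a \<bullet> x = 0"
      using span_not_UNIV_orthogonal by blast
    then have "rvec v \<bullet> a = 0" if "\<omega> v \<noteq> 0" for v
      using that by (metis (mono_tags, lifting) imageI inner_commute mem_Collect_eq span_base)
    then have "covariance \<omega> *v a = 0" by (simp add: covariance_mult)
    moreover have "inj ((*v) (covariance \<omega>))" using fullrank by (simp add: full_rank_injective)
    ultimately have "a = 0" by (metis injD matrix_vector_mult_0_right)
    with a show False by simp
  qed
  obtain B where B: "B \<subseteq> ?S" "independent B" "?S \<subseteq> span B" "card B = dim ?S"
    using basis_exists[of ?S] by metis
  have "dim ?S = CARD('n)" using span by (metis dim_UNIV dim_span DIM_cart DIM_real mult.right_neutral)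
  moreover have finB: "finite B" using B(2) by (rule independent_imp_finite)
  ultimately obtain b where b: "bij_betw b (UNIV :: 'n set) B"
    using B(4) by (metis finite finite_same_card_bij)
  have "\<exists>v. \<omega> v \<noteq> 0 \<and> b i = rvec v" for i
    using b B(1) by (auto simp: bij_betw_def)
  then obtain V where V: "\<And>i. \<omega> (V i) \<noteq> 0" "\<And>i. b i = rvec (V i)" by metis
  have "span B = UNIV" using B(3) span by (metis span_minimal subspace_span top.extremum_uniqueI)
  let ?M = "\<chi> i. rvec (V i)"
  have "x = 0" if x: "?M *v x = 0" for x
  proof -
    have ort: "orthogonal x y" if y: "y \<in> B" for y
    proof -
      obtain i where "y = b i" using b y by (auto simp: bij_betw_def)
      moreover have "(?M *v x) $ i = 0" using x by simp
      ultimately show ?thesis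
        by (simp add: V(2) matrix_vector_mult_def inner_vec_def orthogonal_def mult.commute)
    qed
    have "x \<in> span B" using \<open>span B = UNIV\<close> by simp
    then have "orthogonal x x" using ort by (rule orthogonal_to_span)
    then show "x = 0" by (simp add: orthogonal_def)
  qed
  then have "invertible ?M"
    using matrix_left_invertible_ker[of ?M] invertible_left_inverse[of ?M] by blast
  then have "det ?M \<noteq> 0" by (simp add: invertible_det_nz)
  with V that show ?thesis by blast
qed

lemma walk_symbol_nonneg: "(\<And>v. \<omega> v \<ge> 0) \<Longrightarrow> walk_symbol \<omega> \<xi> \<ge> 0"
  by (simp add: walk_symbol_def sum_nonneg)

text \<open>Parseval turns the sum into an integral over the cube. There the decay estimate is
  majorised by a product of functions of the single coordinates of \<open>M *v \<xi>\<close>, and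
  the linear substitution makes the integral a \<open>d\<close>-th power of O(1/n).\<close>

theorem jacobi_l2_bound:
  fixes \<omega> :: "int^'n \<Rightarrow> real"
  assumes fin: "finite {v. \<omega> v \<noteq> 0}" and nonneg: "\<And>v. \<omega> v \<ge> 0"
    and total: "(\<Sum>v\<in>{v. \<omega> v \<noteq> 0}. \<omega> v) = 1" and symm: "\<And>v. \<omega> (- v) = \<omega> v"
    and aper: "aperiodic \<omega>" and fullrank: "rank (covariance \<omega>) = CARD('n)"
  obtains C n0 where "C \<ge> 0"
    "\<And>n. n \<ge> n0 \<Longrightarrow> (\<Sum>v\<in>{v. jacobi \<omega> n v \<noteq> 0}. (jacobi \<omega> n v)\<^sup>2) \<le> C / real n ^ CARD('n)"
proof -
  let ?d = "CARD('n)"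
  let ?Z = "\<lambda>\<xi>. walk_symbol \<omega> ((2 * pi) *\<^sub>R \<xi>)"
  define cube where "cube = {\<xi> :: real^'n. \<forall>i. 0 \<le> \<xi> $ i \<and> \<xi> $ i \<le> 1}"
  have "cube = cbox 0 (\<chi> i. 1)" by (auto simp: cube_def mem_box_cart)
  then have "compact cube" by simp
  moreover have "0 \<in> cube" by (simp add: cube_def)
  moreover have "continuous_on cube ?Z" unfolding walk_symbol_def by (intro continuous_intros) auto
  ultimately obtain \<xi>0 where \<xi>0: "\<And>\<xi>. \<xi> \<in> cube \<Longrightarrow> ?Z \<xi> \<le> ?Z \<xi>0"
    using continuous_attains_sup[of cube ?Z] by blast
  \<comment> \<open>The maximum with 1/2 secures \<open>0 < z1\<close>. The supremum of the symbol
    is attained on the compact cube, so it stays strictly below 1.\<close>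
  define z1 where "z1 = max (1/2) (?Z \<xi>0)"
  have z1: "0 < z1" "z1 < 1"
    using walk_symbol_less_1[OF fin nonneg total symm aper] by (auto simp: z1_def)
  have z1_ge: "?Z \<xi> \<le> z1" if "\<xi> \<in> cube" for \<xi> using \<xi>0[OF that] by (simp add: z1_def)
  have d1: "?d \<ge> 1" by (simp add: Suc_leI)
  obtain C1 n0 where C1: "C1 \<ge> 0" and decay: "\<And>n z. n \<ge> n0 \<Longrightarrow> 0 \<le> z \<Longrightarrow> z \<le> z1 \<Longrightarrow>
      (poly (jacobi_poly (real ?d / 2) n) z)\<^sup>2 * (1 + (real n)\<^sup>2 * z) powr (real (?d + 1) / 2) \<le> C1"
    using jacobi_poly_decay[OF d1 z1] by blast
  obtain V :: "'n \<Rightarrow> int^'n" where V: "\<And>i. \<omega> (V i) \<noteq> 0" and det: "det (\<chi> i. rvec (V i)) \<noteq> 0"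
    using full_rank_support_basis[OF fullrank] by blast
  define M where "M = (\<chi> i. rvec (V i))"
  have M_nth: "(M *v \<xi>) $ i = \<xi> \<bullet> rvec (V i)" for \<xi> i
    by (simp add: M_def matrix_vector_mult_def inner_vec_def mult.commute)
  define c where "c = Min (range (\<lambda>i. \<omega> (V i)))"
  have "\<omega> (V i) > 0" for i using V[of i] nonneg[of "V i"] by simp
  then have c: "c > 0" "\<And>i. c \<le> \<omega> (V i)"
    by (auto simp: c_def)
  \<comment> \<open>The image of the cube under \<open>M\<close> lies in the box of half-width
    \<open>K\<close>. Cutting \<open>h\<close> off outside this window keeps the integral of a
    periodic function finite.\<close>
  define K where "K = nat \<lceil>\<Sum>i\<in>UNIV. \<Sum>j\<in>UNIV. \<bar>M $ i $ j\<bar>\<rceil>"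
  have MK: "\<bar>(M *v \<xi>) $ i\<bar> \<le> real K" if "\<xi> \<in> cube" for \<xi> i
  proof -
    have "\<bar>(M *v \<xi>) $ i\<bar> \<le> (\<Sum>j\<in>UNIV. \<bar>M $ i $ j * \<xi> $ j\<bar>)"
      by (simp add: matrix_vector_mult_def)
    also have "\<dots> \<le> (\<Sum>j\<in>UNIV. \<bar>M $ i $ j\<bar>)"
      using that by (intro sum_mono) (auto simp: cube_def abs_mult intro!: mult_left_le)
    also have "\<dots> \<le> (\<Sum>i\<in>UNIV. \<Sum>j\<in>UNIV. \<bar>M $ i $ j\<bar>)"
      by (rule member_le_sum[of i UNIV "\<lambda>i. \<Sum>j\<in>UNIV. \<bar>M $ i $ j\<bar>"]) (auto intro: sum_nonneg)
    also have "\<dots> \<le> real K" unfolding K_def by linarith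
    finally show ?thesis .
  qed
  \<comment> \<open>The decay exponent \<open>(d+1)/2\<close> is shared evenly by the \<open>d\<close> linear forms; since each share
    \<open>\<gamma>/2\<close> exceeds \<open>1/2\<close>, every one-dimensional factor contributes \<open>O(1/n)\<close>.\<close>
  define \<gamma> where "\<gamma> = real (?d + 1) / real ?d"
  have \<gamma>: "\<gamma> > 1" by (simp add: \<gamma>_def)
  define h where "h = (\<lambda>(n::nat) s. indicator {- real K .. real K} s * (1 + c * (real n)\<^sup>2 * (sin (pi * s))\<^sup>2) powr (- \<gamma> / 2))"
  obtain C2 where C2: "C2 \<ge> 0" "\<And>n. n \<ge> 1 \<Longrightarrow> integrable lborel (h n)"
    "\<And>n. n \<ge> 1 \<Longrightarrow> (LINT s|lborel. h n s) \<le> C2 / real n"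
    using periodic_decay_integral_bound[OF c(1) \<gamma>, of K] unfolding h_def by blast
  have h0: "h n s \<ge> 0" for n s by (simp add: h_def)
  have symbol_ge: "c * (sin (pi * (M *v \<xi>) $ i))\<^sup>2 \<le> ?Z \<xi>" for \<xi> i
  proof -
    have "c * (sin (pi * (M *v \<xi>) $ i))\<^sup>2 \<le> \<omega> (V i) * (sin (pi * (M *v \<xi>) $ i))\<^sup>2"
      using c(2) by (intro mult_right_mono) auto
    also have "\<dots> = \<omega> (V i) * (sin (((2 * pi) *\<^sub>R \<xi>) \<bullet> rvec (V i) / 2))\<^sup>2"
      by (simp add: M_nth)
    also have "\<dots> \<le> ?Z \<xi>"
      unfolding walk_symbol_def using V nonneg fin
      by (intro member_le_sum[of "V i" _ "\<lambda>v. \<omega> v * (sin (((2 * pi) *\<^sub>R \<xi>) \<bullet> rvec v / 2))\<^sup>2"]) auto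
    finally show ?thesis .
  qed
  have pointwise: "unit_cube \<xi> * (cmod (fourier (jacobi \<omega> n) ((2 * pi) *\<^sub>R \<xi>)))\<^sup>2
      \<le> C1 * (\<Prod>i\<in>UNIV. h n ((M *v \<xi>) $ i))" if n: "n \<ge> n0" for n \<xi>
  proof (cases "\<xi> \<in> cube")
    case True
    define z where "z = ?Z \<xi>"
    have z: "0 \<le> z" "z \<le> z1" using z1_ge[OF True] walk_symbol_nonneg[of \<omega>] nonneg by (auto simp: z_def)
    define w where "w = 1 + (real n)\<^sup>2 * z"
    have w: "w \<ge> 1" using z by (simp add: w_def)
    \<comment> \<open>Each linear form alone bounds \<open>w\<close> from below, so each of the
      \<open>d\<close> equal factors is traded for a function of a different coordinate.\<close>
    have "w powr (- (real (?d + 1) / 2)) = (w powr (- \<gamma> / 2)) ^ ?d"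
      using w by (simp add: powr_power \<gamma>_def)
    also have "\<dots> = (\<Prod>i\<in>(UNIV::'n set). w powr (- \<gamma> / 2))" by simp
    also have "\<dots> \<le> (\<Prod>i\<in>UNIV. h n ((M *v \<xi>) $ i))"
    proof (rule prod_mono, intro conjI)
      fix i
      have "(real n)\<^sup>2 * (c * (sin (pi * (M *v \<xi>) $ i))\<^sup>2) \<le> (real n)\<^sup>2 * z"
        using symbol_ge[of \<xi> i] by (intro mult_left_mono) (auto simp: z_def)
      then have "1 + c * (real n)\<^sup>2 * (sin (pi * (M *v \<xi>) $ i))\<^sup>2 \<le> w"
        by (simp add: w_def mult_ac)
      moreover have "0 < 1 + c * (real n)\<^sup>2 * (sin (pi * (M *v \<xi>) $ i))\<^sup>2"
        using c(1) by (intro add_pos_nonneg mult_nonneg_nonneg) auto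
      ultimately have "w powr (- \<gamma> / 2) \<le> (1 + c * (real n)\<^sup>2 * (sin (pi * (M *v \<xi>) $ i))\<^sup>2) powr (- \<gamma> / 2)"
        using \<gamma> by (intro powr_mono2') auto
      then show "w powr (- \<gamma> / 2) \<le> h n ((M *v \<xi>) $ i)"
        using MK[OF True, of i] by (simp add: h_def abs_le_iff)
    qed simp
    finally have wP: "w powr (- (real (?d + 1) / 2)) \<le> (\<Prod>i\<in>UNIV. h n ((M *v \<xi>) $ i))" .
    have "(poly (jacobi_poly (real ?d / 2) n) z)\<^sup>2 \<le> C1 * w powr (- (real (?d + 1) / 2))"
      using decay[OF n z] w unfolding w_def[symmetric] by (simp add: powr_minus field_simps)
    also have "\<dots> \<le> C1 * (\<Prod>i\<in>UNIV. h n ((M *v \<xi>) $ i))" using wP C1 by (rule mult_left_mono)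
    finally show ?thesis
      using True by (simp add: unit_cube_eq cube_def fourier_jacobi[OF fin total symm] z_def)
  next
    case False
    then show ?thesis using C1 h0 by (auto simp: unit_cube_eq cube_def intro!: mult_nonneg_nonneg prod_nonneg)
  qed
  define C where "C = C1 / \<bar>det M\<bar> * C2 ^ ?d"
  have detM: "det M \<noteq> 0" using det by (simp add: M_def)
  have "(\<Sum>v\<in>{v. jacobi \<omega> n v \<noteq> 0}. (jacobi \<omega> n v)\<^sup>2) \<le> C / real n ^ ?d" if n: "n \<ge> max n0 1" for n
  proof -
    have n': "n \<ge> n0" "n \<ge> 1" using n by auto
    note par = fourier_Parseval[OF finite_jacobi_support[OF fin], of n "jacobi \<omega> n", simplified]
    have ih: "integrable lborel (h n)" using C2(2) n'(2) .
    have ip: "integrable lborel (\<lambda>\<eta>::real^'n. \<Prod>i\<in>UNIV. h n (\<eta> $ i))"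
      by (rule integrable_lborel_vec_prod[of "\<lambda>_. h n"]) (rule ih)
    have [measurable]: "h n \<in> borel_measurable borel" using ih by auto
    have mp: "(\<lambda>\<eta>::real^'n. \<Prod>i\<in>UNIV. h n (\<eta> $ i)) \<in> borel_measurable borel" by measurable
    have iM: "integrable lborel (\<lambda>\<xi>. \<Prod>i\<in>UNIV. h n ((M *v \<xi>) $ i))"
      using integrable_lborel_matrix_vector_mult[OF detM mp] ip by simp
    have "(\<Sum>v\<in>{v. jacobi \<omega> n v \<noteq> 0}. (jacobi \<omega> n v)\<^sup>2)
       = (LINT \<xi>|lborel. unit_cube \<xi> * (cmod (fourier (jacobi \<omega> n) ((2 * pi) *\<^sub>R \<xi>)))\<^sup>2)"
      using par by (simp add: has_bochner_integral_iff)
    also have "\<dots> \<le> (LINT \<xi>|lborel. C1 * (\<Prod>i\<in>UNIV. h n ((M *v \<xi>) $ i)))"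
      using par iM by (intro integral_mono pointwise n' integrable_mult_right) (auto simp: has_bochner_integral_iff)
    also have "\<dots> = C1 * (LINT \<xi>|lborel. (\<Prod>i\<in>UNIV. h n ((M *v \<xi>) $ i)))" by simp
    also have "\<dots> = C1 / \<bar>det M\<bar> * (LINT \<eta>::real^'n|lborel. (\<Prod>i\<in>UNIV. h n (\<eta> $ i)))"
      unfolding integral_lborel_matrix_vector_mult[OF detM mp] using detM by simp
    also have "\<dots> = C1 / \<bar>det M\<bar> * (LINT s|lborel. h n s) ^ ?d"
      using integral_lborel_vec_prod[of "\<lambda>_::'n. h n", OF ih] by simp
    also have "\<dots> \<le> C1 / \<bar>det M\<bar> * (C2 / real n) ^ ?d"
      using C2(3)[OF n'(2)] C1 h0 by (intro mult_left_mono power_mono integral_nonneg) auto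
    also have "\<dots> = C / real n ^ ?d" by (simp add: C_def power_divide)
    finally show ?thesis .
  qed
  moreover have "C \<ge> 0" using C1 C2(1) by (simp add: C_def)
  ultimately show ?thesis using that by blast
qed

lemma card_lattice_cube_le:
  "finite {v::int^'n. \<forall>i. v $ i \<in> A} \<and> card {v::int^'n. \<forall>i. v $ i \<in> A} \<le> card A ^ CARD('n)" if "finite A"
proof -
  have sub: "{v::int^'n. \<forall>i. v $ i \<in> A} \<subseteq> vec_lambda ` (Pi\<^sub>E UNIV (\<lambda>_. A))"
  proof
    fix v :: "int^'n" assume "v \<in> {v. \<forall>i. v $ i \<in> A}"
    then show "v \<in> vec_lambda ` (Pi\<^sub>E UNIV (\<lambda>_. A))"
      by (intro image_eqI[of _ _ "($) v"]) (auto simp: vec_nth_inverse)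
  qed
  have fin: "finite (Pi\<^sub>E (UNIV :: 'n set) (\<lambda>_. A))" using that by (intro finite_PiE) auto
  have "card (vec_lambda ` (Pi\<^sub>E (UNIV :: 'n set) (\<lambda>_. A))) \<le> card A ^ CARD('n)"
    using card_image_le[OF fin, of vec_lambda] by (simp add: card_PiE)
  then show ?thesis
    using sub fin by (meson card_mono finite_imageI finite_subset order_trans)
qed

theorem jacobi_l1_bound:
  fixes \<omega> :: "int^'n \<Rightarrow> real"
  assumes fin: "finite {v. \<omega> v \<noteq> 0}" and nonneg: "\<And>v. \<omega> v \<ge> 0"
    and total: "(\<Sum>v\<in>{v. \<omega> v \<noteq> 0}. \<omega> v) = 1" and symm: "\<And>v. \<omega> (- v) = \<omega> v"
    and aper: "aperiodic \<omega>" and fullrank: "rank (covariance \<omega>) = CARD('n)"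
  obtains B n0 where "B \<ge> 0"
    "\<And>n. n \<ge> n0 \<Longrightarrow> (\<Sum>v\<in>{v. jacobi \<omega> n v \<noteq> 0}. \<bar>jacobi \<omega> n v\<bar>) \<le> B"
proof -
  let ?d = "CARD('n)"
  obtain C n0 where C: "C \<ge> 0" and l2:
    "\<And>n. n \<ge> n0 \<Longrightarrow> (\<Sum>v\<in>{v. jacobi \<omega> n v \<noteq> 0}. (jacobi \<omega> n v)\<^sup>2) \<le> C / real n ^ ?d"
    using jacobi_l2_bound[OF assms] by blast
  obtain R :: int where R: "R \<ge> 0" "\<And>v i. \<omega> v \<noteq> 0 \<Longrightarrow> \<bar>v $ i\<bar> \<le> R"
    using finite_support_radius[OF fin] by blast
  \<comment> \<open>The support has at most ((2R + 1) n)^d points; this n^d cancels the n^-d of the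
    l2 bound, so \<open>A\<close> is independent of \<open>n\<close>.\<close>
  define A where "A = (2 * real_of_int R + 1) ^ ?d * C"
  have "(\<Sum>v\<in>{v. jacobi \<omega> n v \<noteq> 0}. \<bar>jacobi \<omega> n v\<bar>) \<le> sqrt A" if n: "n \<ge> max n0 1" for n
  proof -
    let ?S = "{v. jacobi \<omega> n v \<noteq> 0}"
    let ?I = "{- (R * int n) .. R * int n}"
    have n1: "n \<ge> n0" "n \<ge> 1" using n by auto
    have "?S \<subseteq> {v. \<forall>i. v $ i \<in> ?I}"
      using jacobi_support_bound[OF fin R] by (auto simp: abs_le_iff) (smt (verit))+
    then have "card ?S \<le> card {v::int^'n. \<forall>i. v $ i \<in> ?I}"
      using card_lattice_cube_le[of ?I, where 'n = 'n] by (intro card_mono) auto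
    also have "\<dots> \<le> card ?I ^ ?d" using card_lattice_cube_le[of ?I, where 'n = 'n] by simp
    finally have "real (card ?S) \<le> real (card ?I) ^ ?d" by (metis of_nat_le_iff of_nat_power)
    also have "real (card ?I) = 2 * real_of_int R * real n + 1"
      using R(1) by simp
    also have "(2 * real_of_int R * real n + 1) ^ ?d \<le> ((2 * real_of_int R + 1) * real n) ^ ?d"
      using R(1) n1 by (intro power_mono) (auto simp: algebra_simps)
    finally have card: "real (card ?S) \<le> ((2 * real_of_int R + 1) * real n) ^ ?d" .
    have "(\<Sum>v\<in>?S. 1 * \<bar>jacobi \<omega> n v\<bar>)\<^sup>2 \<le> (\<Sum>v\<in>?S. 1\<^sup>2) * (\<Sum>v\<in>?S. \<bar>jacobi \<omega> n v\<bar>\<^sup>2)"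
      by (rule Cauchy_Schwarz_ineq_sum)
    then have "(\<Sum>v\<in>?S. \<bar>jacobi \<omega> n v\<bar>)\<^sup>2 \<le> real (card ?S) * (\<Sum>v\<in>?S. (jacobi \<omega> n v)\<^sup>2)" by simp
    also have "\<dots> \<le> ((2 * real_of_int R + 1) * real n) ^ ?d * (C / real n ^ ?d)"
      using card l2[OF n1(1)] R(1) by (intro mult_mono) (auto intro: sum_nonneg)
    also have "\<dots> = A" using n1 by (simp add: A_def power_mult_distrib)
    finally show ?thesis by (rule real_le_rsqrt)
  qed
  moreover have "sqrt A \<ge> 0" using C R(1) by (simp add: A_def)
  ultimately show ?thesis using that by blast
qed

section \<open>Positive definite matrices\<close>

lemma inner_matrix_vector_mult: "(A *v x) \<bullet> y = x \<bullet> (transpose A *v y)" for A :: "real^'n^'m"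
  by (metis dot_lmul_matrix transpose_matrix_vector transpose_transpose)

definition pos_def :: "real^'n^'n \<Rightarrow> bool" where
  "pos_def Q \<longleftrightarrow> transpose Q = Q \<and> (\<forall>x. x \<noteq> 0 \<longrightarrow> x \<bullet> (Q *v x) > 0)"

text \<open>Gram-Schmidt for the form \<open>Q\<close>. As long as the system is too small to span,
  a vector outside its span leaves a nonzero remainder, which positive definiteness allows to
  normalise.\<close>

lemma posdef_orthonormal_extension:
  fixes Q :: "real^'n^'n"
  assumes Q: "pos_def Q"
    and e: "e \<bullet> (Q *v e) = 1" and m: "1 \<le> m" "m \<le> CARD('n)"
  shows "\<exists>S. finite S \<and> card S = m \<and> e \<in> S \<and> (\<forall>u\<in>S. \<forall>v\<in>S. u \<bullet> (Q *v v) = (if u = v then 1 else 0))"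
  using m
proof (induction m rule: dec_induct)
  case base
  then show ?case using e by (intro exI[of _ "{e}"]) auto
next
  case (step m)
  have sym: "transpose Q = Q" and pos: "\<And>x. x \<noteq> 0 \<Longrightarrow> x \<bullet> (Q *v x) > 0"
    using Q by (auto simp: pos_def_def)
  from step obtain S where S: "finite S" "card S = m" "e \<in> S"
    and on: "\<And>u v. u \<in> S \<Longrightarrow> v \<in> S \<Longrightarrow> u \<bullet> (Q *v v) = (if u = v then 1 else 0)" by auto
  have comm: "u \<bullet> (Q *v v) = v \<bullet> (Q *v u)" for u v
    using inner_matrix_vector_mult[of Q u v] by (simp add: sym inner_commute)
  have "dim S \<le> m" using S dim_le_card' by metis
  then have "span S \<noteq> UNIV" using step.prems
    by (metis dim_UNIV dim_span DIM_cart DIM_real mult.right_neutral not_less_eq_eq)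
  then obtain u where u: "u \<notin> span S" by blast
  define w where "w = u - (\<Sum>v\<in>S. (v \<bullet> (Q *v u)) *\<^sub>R v)"
  have "w \<noteq> 0"
  proof
    assume "w = 0"
    then have "u = (\<Sum>v\<in>S. (v \<bullet> (Q *v u)) *\<^sub>R v)" by (simp add: w_def)
    then show False using u by (metis (no_types, lifting) span_base span_scale span_sum)
  qed
  then have wpos: "w \<bullet> (Q *v w) > 0" by (rule pos)
  have ort: "v \<bullet> (Q *v w) = 0" if v: "v \<in> S" for v
  proof -
    have "v \<bullet> (Q *v w) = v \<bullet> (Q *v u) - (\<Sum>x\<in>S. (x \<bullet> (Q *v u)) * (v \<bullet> (Q *v x)))"
      unfolding w_def comm[of v] by (simp add: inner_diff_left inner_sum_left)
    also have "(\<Sum>x\<in>S. (x \<bullet> (Q *v u)) * (v \<bullet> (Q *v x))) = (\<Sum>x\<in>S. if x = v then x \<bullet> (Q *v u) else 0)"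
      using on[OF v] by (intro sum.cong) auto
    finally show ?thesis using S(1) v by simp
  qed
  define w' where "w' = (1 / sqrt (w \<bullet> (Q *v w))) *\<^sub>R w"
  have w'1: "w' \<bullet> (Q *v w') = 1"
    using wpos by (simp add: w'_def matrix_vector_mult_scaleR power2_eq_square[symmetric] real_sqrt_pow2 field_simps)
  have ort': "v \<bullet> (Q *v w') = 0" "w' \<bullet> (Q *v v) = 0" if "v \<in> S" for v
    using ort[OF that] comm[of w' v] by (simp_all add: w'_def matrix_vector_mult_scaleR)
  have "w' \<notin> S" using ort'(1)[of w'] w'1 by auto
  then have "finite (insert w' S) \<and> card (insert w' S) = Suc m \<and> e \<in> insert w' S \<and>
    (\<forall>u\<in>insert w' S. \<forall>v\<in>insert w' S. u \<bullet> (Q *v v) = (if u = v then 1 else 0))"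
    using S on w'1 ort' by auto
  then show ?case by blast
qed

text \<open>Starting the orthonormal system for \<open>Q\<close> at a multiple of \<open>\<xi>\<close> makes the transposed factor send
  \<open>\<xi>\<close> to a coordinate axis, so that no rotation is needed afterwards.\<close>

lemma posdef_factorization:
  fixes Q :: "real^'n^'n" and \<xi> :: "real^'n"
  assumes Q: "pos_def Q"
  obtains A :: "real^'n^'n" and i :: 'n and s :: real where
    "A ** transpose A = Q" "invertible A" "transpose A *v \<xi> = s *\<^sub>R axis i 1"
proof -
  have pos: "\<And>x. x \<noteq> 0 \<Longrightarrow> x \<bullet> (Q *v x) > 0" using Q by (auto simp: pos_def_def)
  \<comment> \<open>The zero vector cannot be normalised; an arbitrary axis takes its place, and
    then \<open>s = 0\<close>.\<close>
  define \<xi>' where "\<xi>' = (if \<xi> = 0 then axis undefined 1 else \<xi>)"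
  have nz: "\<xi>' \<noteq> 0" by (simp add: \<xi>'_def axis_eq_0_iff)
  define r where "r = sqrt (\<xi>' \<bullet> (Q *v \<xi>'))"
  have r: "r > 0" using pos[OF nz] by (simp add: r_def)
  have r2: "\<xi>' \<bullet> (Q *v \<xi>') = r * r" using pos[OF nz] by (simp add: r_def)
  define e where "e = (1 / r) *\<^sub>R \<xi>'"
  have e1: "e \<bullet> (Q *v e) = 1" using r by (simp add: e_def matrix_vector_mult_scaleR r2)
  have "1 \<le> CARD('n)" by (simp add: Suc_leI)
  then obtain S where S: "finite S" "card S = CARD('n)" "e \<in> S"
    and on: "\<And>u v. u \<in> S \<Longrightarrow> v \<in> S \<Longrightarrow> u \<bullet> (Q *v v) = (if u = v then 1 else 0)"
    using posdef_orthonormal_extension[OF Q e1, of "CARD('n)"] by auto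
  obtain b where b: "bij_betw b (UNIV :: 'n set) S"
    using S by (metis finite finite_same_card_bij)
  obtain i where i: "b i = e" using b S(3) by (metis bij_betw_def imageE)
  \<comment> \<open>With a \<open>Q\<close>-orthonormal basis as rows,
    \<open>R ** Q ** transpose R\<close> is the identity, so the inverse \<open>A\<close> of
    \<open>R\<close> is the factor sought. Its transpose undoes \<open>transpose R\<close>, which
    sends the axis \<open>i\<close> to \<open>e\<close>.\<close>
  define R :: "real^'n^'n" where "R = (\<chi> i. b i)"
  have Rx: "(R *v x) $ k = b k \<bullet> x" for x k
    by (simp add: R_def matrix_vector_mult_def inner_vec_def)
  have Rt: "transpose R *v axis k 1 = b k" for k
    by (simp add: matrix_vector_mult_basis R_def row_def vec_eq_iff column_def transpose_def)
  have RQR: "R ** Q ** transpose R = mat 1"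
  proof -
    have "(R ** Q ** transpose R) *v axis k 1 = mat 1 *v axis k 1" for k
    proof (rule vec_eq_iff[THEN iffD2], rule allI)
      fix l
      have "((R ** Q ** transpose R) *v axis k 1) $ l = b l \<bullet> (Q *v b k)"
        by (simp only: matrix_vector_mul_assoc[symmetric] Rt Rx)
      also have "\<dots> = (if b l = b k then 1 else 0)" using on b by (metis bij_betwE UNIV_I)
      also have "\<dots> = (mat 1 *v axis k 1) $ l"
        using b by (auto simp: axis_def bij_betw_def inj_eq)
      finally show "((R ** Q ** transpose R) *v axis k 1) $ l = (mat 1 *v axis k 1) $ l" .
    qed
    then show ?thesis by (simp add: matrix_vector_mult_basis vec_eq_iff column_def)
  qed
  then have "det R * det Q * det (transpose R) = 1" by (metis det_I det_mul)
  then have "det R \<noteq> 0" by auto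
  then have invR: "invertible R" by (simp add: invertible_det_nz)
  then obtain A where AR: "A ** R = mat 1" "R ** A = mat 1" by (auto simp: invertible_def)
  then have tAR: "transpose R ** transpose A = mat 1" "transpose A ** transpose R = mat 1"
    by (metis matrix_transpose_mul transpose_mat)+
  have "A ** (R ** Q ** transpose R) ** transpose A = Q"
    using AR(1) tAR(1) by (metis matrix_mul_assoc matrix_mul_lid matrix_mul_rid)
  then have Q: "A ** transpose A = Q" by (simp add: RQR)
  have invA: "invertible A" using AR by (auto simp: invertible_def)
  have "transpose A *v e = axis i 1"
    unfolding i[symmetric] Rt[symmetric] by (simp only: matrix_vector_mul_assoc tAR matrix_vector_mul_lid)
  moreover have "\<xi>' = r *\<^sub>R e" using r by (simp add: e_def)
  ultimately have "transpose A *v \<xi>' = r *\<^sub>R axis i 1" by (simp only: matrix_vector_mult_scaleR)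
  then have "transpose A *v \<xi> = (if \<xi> = 0 then 0 else r) *\<^sub>R axis i 1" by (auto simp: \<xi>'_def split: if_splits)
  with Q invA that show ?thesis by blast
qed

section \<open>Moments of the unit ball\<close>

lemma nn_integral_gaussian_moment_vec:
  fixes i :: "'n::finite"
  shows "(\<integral>\<^sup>+y. ennreal (exp (- (norm y)\<^sup>2) * (y $ i) ^ (2 * k)) \<partial>(lborel :: (real^'n) measure))
    = ennreal (pi powr (real CARD('n) / 2) * (fact (2 * k) / (4 ^ k * fact k)))"
proof -
  have G: "has_bochner_integral lborel (\<lambda>x::real. exp (-x\<^sup>2) * x ^ (2 * k)) (sqrt pi * (fact (2 * k) / (2 ^ (2 * k) * fact k)))" for k
    using has_bochner_integral_even_function[OF gaussian_moment_even_pos[where k=k]] by simp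
  \<comment> \<open>The conditional exponent lets a single one-dimensional moment formula cover all
    coordinates: the moment of order 2k for \<open>i\<close>, the total mass for the others.\<close>
  define f where "f j = (\<lambda>x::real. exp (-x\<^sup>2) * x ^ (2 * (if j = i then k else 0)))" for j
  have If: "integrable lborel (f j)" for j
    unfolding f_def using G[of "if j = i then k else 0"] by (simp only: has_bochner_integral_iff)
  have e: "exp (- (norm y)\<^sup>2) * (y $ i) ^ (2 * k) = (\<Prod>j\<in>UNIV. f j (y $ j))" for y :: "real^'n"
  proof -
    have "(\<Prod>j\<in>UNIV. f j (y $ j)) = (\<Prod>j\<in>UNIV. exp (- (y $ j)\<^sup>2)) * (\<Prod>j\<in>UNIV. (y $ j) ^ (2 * (if j = i then k else 0)))"
      unfolding f_def by (rule prod.distrib)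
    also have "(\<Prod>j\<in>UNIV. exp (- (y $ j)\<^sup>2)) = exp (- (norm y)\<^sup>2)"
      by (simp add: exp_sum[symmetric] norm_eq_sqrt_inner inner_vec_def power2_eq_square sum_nonneg sum_negf)
    also have "(\<Prod>j\<in>UNIV. (y $ j) ^ (2 * (if j = i then k else 0))) = (\<Prod>j\<in>UNIV. if j = i then (y $ j) ^ (2 * k) else 1)"
      by (intro prod.cong) auto
    also have "\<dots> = (y $ i) ^ (2 * k)" by simp
    finally show ?thesis ..
  qed
  have "(\<integral>\<^sup>+y. ennreal (exp (- (norm y)\<^sup>2) * (y $ i) ^ (2 * k)) \<partial>(lborel :: (real^'n) measure))
    = ennreal (LINT y|lborel. (\<Prod>j\<in>UNIV. f j (y $ j)))"
    unfolding e
    by (rule nn_integral_eq_integral[OF integrable_lborel_vec_prod[OF If]])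
      (auto intro!: AE_I2 prod_nonneg simp: f_def zero_le_even_power)
  also have "(LINT y|lborel. (\<Prod>j\<in>UNIV. f j (y $ j))) = (\<Prod>j\<in>UNIV. LINT x|lborel. f j x)"
    by (rule integral_lborel_vec_prod[OF If])
  also have "\<dots> = (\<Prod>j\<in>UNIV. sqrt pi * (if j = i then fact (2 * k) / (4 ^ k * fact k) else 1))"
  proof (rule prod.cong[OF refl])
    fix j
    have "(LINT x|lborel. f j x) = (sqrt pi * (fact (2 * (if j = i then k else 0)) / (2 ^ (2 * (if j = i then k else 0)) * fact (if j = i then k else 0))))"
      unfolding f_def using G[of "if j = i then k else 0"] by (simp only: has_bochner_integral_iff)
    then show "(LINT x|lborel. f j x) = sqrt pi * (if j = i then fact (2 * k) / (4 ^ k * fact k) else 1)"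
      by (auto simp: power_mult)
  qed
  also have "\<dots> = sqrt pi ^ CARD('n) * (fact (2 * k) / (4 ^ k * fact k))"
    by (simp add: prod.distrib)
  also have "sqrt pi ^ CARD('n) = pi powr (real CARD('n) / 2)"
    by (simp add: powr_half_sqrt[symmetric] powr_power)
  finally show ?thesis .
qed

text \<open>The moments of the unit ball are read off from those of the Gaussian by writing
  $e^{-|y|^2} = \int_{|y|^2}^\infty e^{-s}\,ds$ and exchanging the integrals.\<close>

lemma unit_ball_moment:
  fixes i :: "'n::finite"
  shows "has_bochner_integral lborel (\<lambda>y::real^'n. indicator (cball 0 1) y * (y $ i) ^ (2 * k))
    (pi powr (real CARD('n) / 2) * (fact (2 * k) / (4 ^ k * fact k)) / Gamma (real CARD('n) / 2 + real k + 1))"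
proof -
  let ?d = "CARD('n)"
  \<comment> \<open>Scaling the ball to radius sqrt(s) yields s^(d/2) from the volume and s^k from
    the monomial, hence \<open>s powr (a - 1)\<close>; integrated against exp(-s) this is
    \<open>Gamma a\<close>.\<close>
  define a where "a = real ?d / 2 + real k + 1"
  have a0: "a > 0" by (simp add: a_def add_pos_nonneg)
  define m where "m y = (y $ i) ^ (2 * k)" for y :: "real^'n"
  have m0: "m y \<ge> 0" for y by (simp add: m_def)
  have [measurable]: "m \<in> borel_measurable borel" unfolding m_def[abs_def] by measurable
  then have [measurable]: "m \<in> borel_measurable lborel" by simp
  have [measurable]: "cball (0::real^'n) 1 \<in> sets borel" by simp
  \<comment> \<open>An extended nonnegative integral: the exchange of integrals then needs no
    integrability, and finiteness of the moment comes out of the identity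
    \<open>main\<close>.\<close>
  define M where "M = (\<integral>\<^sup>+y. ennreal (indicator (cball 0 1) y * m y) \<partial>lborel)"
  have [measurable]: "Measurable.pred (lborel \<Otimes>\<^sub>M (lborel::real measure)) (\<lambda>p::(real^'n) \<times> real. (norm (fst p))\<^sup>2 \<le> snd p)"
    by measurable
  have scale: "(\<integral>\<^sup>+y. ennreal (of_bool ((norm y)\<^sup>2 \<le> s) * m y) \<partial>lborel) = ennreal (s powr (a - 1)) * M" if s: "s > 0" for s
  proof -
    define r where "r = sqrt s"
    have r: "r > 0" "r\<^sup>2 = s" using s by (auto simp: r_def)
    have "(\<integral>\<^sup>+y. ennreal (of_bool ((norm y)\<^sup>2 \<le> s) * m y) \<partial>lborel)
        = (\<integral>\<^sup>+y. ennreal (of_bool ((norm y)\<^sup>2 \<le> s) * m y) \<partial>density (distr lborel borel (\<lambda>x::real^'n. 0 + r *\<^sub>R x)) (\<lambda>_. \<bar>r\<bar> ^ DIM(real^'n)))"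
      using lborel_affine[of r "0::real^'n"] r by simp
    also have "\<dots> = (\<integral>\<^sup>+y. ennreal (r ^ ?d) * ennreal (of_bool ((norm (r *\<^sub>R y))\<^sup>2 \<le> s) * m (r *\<^sub>R y)) \<partial>lborel)"
      using r by (subst nn_integral_density; simp?; subst nn_integral_distr; simp?)
    also have "\<dots> = (\<integral>\<^sup>+y. ennreal (s powr (a - 1)) * ennreal (indicator (cball 0 1) y * m y) \<partial>lborel)"
    proof (rule nn_integral_cong)
      fix y :: "real^'n"
      have "(norm (r *\<^sub>R y))\<^sup>2 \<le> s \<longleftrightarrow> norm y \<le> 1"
      proof -
        have "(norm (r *\<^sub>R y))\<^sup>2 = s * (norm y)\<^sup>2" using r by (simp add: power_mult_distrib)
        also have "\<dots> \<le> s \<longleftrightarrow> (norm y)\<^sup>2 \<le> 1" using s by (simp add: mult_le_cancel_left2)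
        finally show ?thesis by (simp add: abs_square_le_1)
      qed
      moreover have "m (r *\<^sub>R y) = r ^ (2 * k) * m y" by (simp add: m_def power_mult_distrib)
      moreover have "s powr (a - 1) = r ^ ?d * r ^ (2 * k)"
      proof -
        have "s powr (a - 1) = s powr (real ?d / 2) * s powr (real k)" by (simp add: a_def powr_add)
        also have "s powr (real k) = r ^ (2 * k)" using s r by (simp add: powr_realpow power_mult)
        also have "s powr (real ?d / 2) = r ^ ?d"
          using s by (simp add: r_def powr_half_sqrt[symmetric] powr_power)
        finally show ?thesis .
      qed
      ultimately show "ennreal (r ^ ?d) * ennreal (of_bool ((norm (r *\<^sub>R y))\<^sup>2 \<le> s) * m (r *\<^sub>R y))
        = ennreal (s powr (a - 1)) * ennreal (indicator (cball 0 1) y * m y)"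
        using r m0[of y] by (auto simp: ennreal_mult[symmetric] indicator_def mult_ac)
    qed
    also have "\<dots> = ennreal (s powr (a - 1)) * M"
      unfolding M_def by (rule nn_integral_cmult) measurable
    finally show ?thesis .
  qed
  have tail: "(\<integral>\<^sup>+s. ennreal (of_bool ((norm y)\<^sup>2 \<le> s) * exp (- s)) \<partial>lborel) = ennreal (exp (- (norm y)\<^sup>2))" for y :: "real^'n"
  proof -
    have "(\<integral>\<^sup>+s. ennreal (exp (- s)) * indicator {(norm y)\<^sup>2..} s \<partial>lborel) = ennreal (0 - (- exp (- (norm y)\<^sup>2)))"
    proof (rule nn_integral_FTC_atLeast)
      show "((\<lambda>s::real. - exp (- s)) \<longlongrightarrow> 0) at_top"
        using tendsto_minus[OF filterlim_compose[OF exp_at_bot filterlim_uminus_at_bot_at_top]] by simp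
    qed (auto intro!: derivative_eq_intros)
    moreover have "ennreal (of_bool ((norm y)\<^sup>2 \<le> s) * exp (- s)) = ennreal (exp (- s)) * indicator {(norm y)\<^sup>2..} s" for s
      by (auto simp: indicator_def)
    ultimately show ?thesis by simp
  qed
  have "ennreal (pi powr (real ?d / 2) * (fact (2 * k) / (4 ^ k * fact k)))
    = (\<integral>\<^sup>+y. ennreal (exp (- (norm y)\<^sup>2) * m y) \<partial>(lborel :: (real^'n) measure))"
    unfolding m_def by (rule nn_integral_gaussian_moment_vec[symmetric])
  also have "\<dots> = (\<integral>\<^sup>+y. (\<integral>\<^sup>+s. ennreal (of_bool ((norm y)\<^sup>2 \<le> s) * exp (- s)) * ennreal (m y) \<partial>lborel) \<partial>lborel)"
  proof (rule nn_integral_cong)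
    fix y :: "real^'n"
    have "(\<integral>\<^sup>+s. ennreal (of_bool ((norm y)\<^sup>2 \<le> s) * exp (- s)) * ennreal (m y) \<partial>lborel)
      = (\<integral>\<^sup>+s. ennreal (of_bool ((norm y)\<^sup>2 \<le> s) * exp (- s)) \<partial>lborel) * ennreal (m y)"
      by (rule nn_integral_multc) measurable
    then show "ennreal (exp (- (norm y)\<^sup>2) * m y)
      = (\<integral>\<^sup>+s. ennreal (of_bool ((norm y)\<^sup>2 \<le> s) * exp (- s)) * ennreal (m y) \<partial>lborel)"
      unfolding tail by (simp only: ennreal_mult m0 exp_ge_zero)
  qed
  also have "\<dots> = (\<integral>\<^sup>+s. (\<integral>\<^sup>+y. ennreal (of_bool ((norm y)\<^sup>2 \<le> s) * exp (- s)) * ennreal (m y) \<partial>(lborel :: (real^'n) measure)) \<partial>lborel)"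
    by (rule lborel_pair.Fubini') measurable
  also have "\<dots> = (\<integral>\<^sup>+s. ennreal (indicator {0..} s * s powr (a - 1) / exp s) * M \<partial>lborel)"
  proof (rule nn_integral_cong_AE)
    \<comment> \<open>The scaling needs a positive radius. For negative \<open>s\<close> the set of
      \<open>y\<close> is empty, and the remaining point 0 is a null set.\<close>
    have "AE s::real in lborel. s \<noteq> 0" by (rule AE_lborel_singleton)
    then show "AE s in lborel. (\<integral>\<^sup>+y. ennreal (of_bool ((norm y)\<^sup>2 \<le> s) * exp (- s)) * ennreal (m y) \<partial>(lborel :: (real^'n) measure))
      = ennreal (indicator {0..} s * s powr (a - 1) / exp s) * M"
    proof eventually_elim
      case (elim s)
      show ?case
      proof (cases "s > 0")
        case True
        have "(\<integral>\<^sup>+y. ennreal (of_bool ((norm y)\<^sup>2 \<le> s) * exp (- s)) * ennreal (m y) \<partial>(lborel :: (real^'n) measure))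
          = (\<integral>\<^sup>+y. ennreal (exp (- s)) * ennreal (of_bool ((norm y)\<^sup>2 \<le> s) * m y) \<partial>lborel)"
          by (intro nn_integral_cong) (auto simp: ennreal_mult[symmetric] m0 mult_ac)
        also have "\<dots> = ennreal (exp (- s)) * (ennreal (s powr (a - 1)) * M)"
          unfolding scale[OF True, symmetric] by (rule nn_integral_cmult) measurable
        also have "\<dots> = ennreal (indicator {0..} s * s powr (a - 1) / exp s) * M"
        proof -
          have "indicator {0..} s * s powr (a - 1) / exp s = exp (- s) * s powr (a - 1)"
            using True by (simp add: exp_minus divide_inverse)
          then show ?thesis by (simp only: ennreal_mult exp_ge_zero powr_ge_zero mult.assoc)
        qed
        finally show ?thesis .
      next
        case False
        with elim have "\<not> (norm y)\<^sup>2 \<le> s" for y :: "real^'n" by (smt (verit) zero_le_power2)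
        with False elim show ?thesis by simp
      qed
    qed
  qed
  also have "\<dots> = ennreal (Gamma a) * M"
    unfolding Gamma_conv_nn_integral_real[OF a0] by (rule nn_integral_multc) measurable
  finally have main: "ennreal (pi powr (real ?d / 2) * (fact (2 * k) / (4 ^ k * fact k))) = ennreal (Gamma a) * M" .
  have Ga: "Gamma a > 0" using a0 by (rule Gamma_real_pos)
  have "M = ennreal (pi powr (real ?d / 2) * (fact (2 * k) / (4 ^ k * fact k)) / Gamma a)"
  proof -
    have "ennreal (1 / Gamma a) * (ennreal (Gamma a) * M) = M"
      using Ga by (simp add: mult.assoc[symmetric] ennreal_mult[symmetric])
    then show ?thesis
      unfolding main[symmetric] using Ga by (simp add: ennreal_mult[symmetric] mult_ac)
  qed
  then show ?thesis
    unfolding M_def m_def a_def using Ga a_def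
    by (intro has_bochner_integral_nn_integral) (auto simp: divide_nonneg_pos indicator_def)
qed

section \<open>Fourier transform of the limit density\<close>

text \<open>Integrating the cosine series termwise, \<open>fact (2 * k)\<close> cancels against the
  moment, the 4^k joins the power of \<open>r\<close>, and the quotient of Gamma values is the
  Pochhammer symbol. What remains is the Mehler-Heine series at w = r^2/4.\<close>

lemma unit_ball_cos_integral:
  fixes i :: "'n::finite" and r :: real
  defines "\<alpha> \<equiv> real CARD('n) / 2"
  shows "Gamma (\<alpha> + 1) / pi powr \<alpha> * (LINT y|lborel. indicator (cball 0 1) y * cos (r * (y::real^'n) $ i))
    = (\<Sum>k. (- (r\<^sup>2 / 4)) ^ k / (pochhammer (\<alpha> + 1) k * fact k))"
proof -
  define f where "f k y = (-1) ^ k / fact (2 * k) * r ^ (2 * k) * (indicator (cball 0 1) y * (y $ i) ^ (2 * k))" for k and y :: "real^'n"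
  define M where "M k = pi powr \<alpha> * (fact (2 * k) / (4 ^ k * fact k)) / Gamma (\<alpha> + real k + 1)" for k
  have f_int: "has_bochner_integral lborel (f k) ((-1) ^ k / fact (2 * k) * r ^ (2 * k) * M k)" for k
    unfolding f_def M_def \<alpha>_def by (intro has_bochner_integral_mult_right unit_ball_moment)
  \<comment> \<open>Coordinates are at most 1 on the ball, and replacing \<open>fact (2 * k)\<close>
    by \<open>fact k\<close> is crude but leaves an exponential series as majorant.\<close>
  have f_bd: "norm (f k y) \<le> (r\<^sup>2) ^ k / fact k * indicator (cball 0 1) y" for k y
  proof (cases "y \<in> cball 0 1")
    case True
    have "\<bar>y $ i\<bar> \<le> 1" using True component_le_norm_cart[of y i] by simp
    then have "\<bar>y $ i\<bar> ^ (2 * k) \<le> 1" by (intro power_le_one) auto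
    moreover have "(fact k :: real) \<le> fact (2 * k)" by (intro fact_mono) auto
    ultimately have "\<bar>r\<bar> ^ (2 * k) * \<bar>y $ i\<bar> ^ (2 * k) / fact (2 * k) \<le> \<bar>r\<bar> ^ (2 * k) * 1 / fact k"
      by (intro frac_le mult_mono) auto
    then show ?thesis using True by (simp add: f_def abs_mult power_abs power_mult)
  qed (simp add: f_def)
  have summ: "summable (\<lambda>k. (r\<^sup>2) ^ k / fact k * c)" for c :: real
    using summable_mult2[OF summable_exp[of "r\<^sup>2"], of c] by (simp add: field_simps)
  have ball: "integrable lborel (indicator (cball 0 1) :: real^'n \<Rightarrow> real)"
    by (intro integrable_real_indicator emeasure_bounded_finite) auto
  have "(\<Sum>k. f k y) = indicator (cball 0 1) y * cos (r * y $ i)" for y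
  proof -
    have "(\<lambda>k. indicator (cball 0 1) y * ((-1) ^ k / fact (2 * k) * (r * y $ i) ^ (2 * k))) sums (indicator (cball 0 1) y * cos (r * y $ i))"
      by (intro sums_mult cos_paired)
    moreover have "indicator (cball 0 1) y * ((-1) ^ k / fact (2 * k) * (r * y $ i) ^ (2 * k)) = f k y" for k
      by (simp add: f_def power_mult_distrib)
    ultimately show ?thesis by (simp add: sums_iff)
  qed
  then have "(LINT y|lborel. indicator (cball 0 1) y * cos (r * y $ i)) = (LINT y|lborel. (\<Sum>k. f k y))" by simp
  also have "\<dots> = (\<Sum>k. LINT y|lborel. f k y)"
  proof (rule integral_suminf)
    show "integrable lborel (f k)" for k using f_int by (simp add: has_bochner_integral_iff)
    show "AE y in lborel. summable (\<lambda>k. norm (f k y))"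
      by (intro AE_I2 summable_comparison_test'[OF summ]) (use f_bd in auto)
    show "summable (\<lambda>k. LINT y|lborel. norm (f k y))"
    proof (rule summable_comparison_test'[OF summ])
      fix k :: nat
      have "(LINT y|lborel. norm (f k y)) \<le> (LINT y|lborel. (r\<^sup>2) ^ k / fact k * indicator (cball 0 1) (y :: real^'n))"
        using f_int[of k] ball by (intro integral_mono f_bd integrable_norm integrable_mult_right) (auto simp: has_bochner_integral_iff)
      then show "norm (LINT y|lborel. norm (f k y)) \<le> (r\<^sup>2) ^ k / fact k * (LINT y|lborel. indicator (cball 0 1) (y :: real^'n))"
        by simp
    qed
  qed
  also have "\<dots> = (\<Sum>k. (-1) ^ k / fact (2 * k) * r ^ (2 * k) * M k)"
    using f_int by (simp add: has_bochner_integral_iff)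
  finally have I: "(LINT y|lborel. indicator (cball 0 1) y * cos (r * (y::real^'n) $ i)) = (\<Sum>k. (-1) ^ k / fact (2 * k) * r ^ (2 * k) * M k)" .
  have "(\<lambda>k. (-1) ^ k / fact (2 * k) * r ^ (2 * k) * M k) sums (\<Sum>k. (-1) ^ k / fact (2 * k) * r ^ (2 * k) * M k)"
  proof (rule summable_sums, rule summable_comparison_test'[OF summ])
    fix k :: nat
    have "norm (LINT y|lborel. f k y) \<le> (LINT y|lborel. norm (f k y))" by (rule integral_norm_bound)
    also have "\<dots> \<le> (LINT y|lborel. (r\<^sup>2) ^ k / fact k * indicator (cball 0 1) (y :: real^'n))"
      using f_int[of k] ball by (intro integral_mono f_bd integrable_norm integrable_mult_right) (auto simp: has_bochner_integral_iff)
    finally show "norm ((-1) ^ k / fact (2 * k) * r ^ (2 * k) * M k) \<le> (r\<^sup>2) ^ k / fact k * (LINT y|lborel. indicator (cball 0 1) (y :: real^'n))"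
      using f_int[of k] by (simp add: has_bochner_integral_iff)
  qed
  from sums_mult[OF this, of "Gamma (\<alpha> + 1) / pi powr \<alpha>"]
  have "(\<lambda>k. Gamma (\<alpha> + 1) / pi powr \<alpha> * ((-1) ^ k / fact (2 * k) * r ^ (2 * k) * M k)) sums
     (Gamma (\<alpha> + 1) / pi powr \<alpha> * (LINT y|lborel. indicator (cball 0 1) y * cos (r * (y::real^'n) $ i)))"
    unfolding I .
  moreover have "Gamma (\<alpha> + 1) / pi powr \<alpha> * ((-1) ^ k / fact (2 * k) * r ^ (2 * k) * M k)
      = (- (r\<^sup>2 / 4)) ^ k / (pochhammer (\<alpha> + 1) k * fact k)" for k
  proof -
    have a: "\<alpha> \<ge> 0" by (simp add: \<alpha>_def)
    then have "\<alpha> + 1 \<notin> \<int>\<^sub>\<le>\<^sub>0" by (auto elim!: nonpos_Ints_cases)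
    then have p: "pochhammer (\<alpha> + 1) k = Gamma (\<alpha> + 1 + real k) / Gamma (\<alpha> + 1)"
      by (rule pochhammer_Gamma)
    have g: "Gamma (\<alpha> + 1) > 0" "Gamma (\<alpha> + 1 + real k) > 0" using a by (auto intro!: Gamma_real_pos)
    have "(- (r\<^sup>2 / 4)) ^ k = (-1) ^ k * r ^ (2 * k) / 4 ^ k"
      by (simp add: power_minus[of "r\<^sup>2 / 4"] power_divide power_mult)
    then show ?thesis
      unfolding p M_def using g by (simp add: field_simps add_ac)
  qed
  ultimately show ?thesis by (simp add: sums_iff)
qed

lemma matrix_inv_cancel:
  fixes A :: "real^'n^'n"
  assumes "invertible A"
  shows "A ** matrix_inv A = mat 1" "matrix_inv A ** A = mat 1"
  using someI_ex[OF assms[unfolded invertible_def]] unfolding matrix_inv_def by auto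

text \<open>The map is \<open>t\<close> times the square-root factor of \<open>Q\<close> adapted to
  \<open>\<xi>\<close>. It carries the unit ball onto the ellipsoid, and the phase becomes a
  multiple of one coordinate, so the moments of a single coordinate are enough.\<close>

lemma limit_density_linear_image:
  fixes Q :: "real^'n^'n" and \<xi> :: "real^'n"
  assumes Q: "pos_def Q" and t: "t > 0"
  obtains A :: "real^'n^'n" and i :: 'n and s :: real where "det A \<noteq> 0" "s\<^sup>2 = \<xi> \<bullet> (Q *v \<xi>)"
    "\<And>x. limit_density Q t (A *v x)
      = Gamma (real CARD('n) / 2 + 1) / pi powr (real CARD('n) / 2) / \<bar>det A\<bar> * indicator (cball 0 1) x"
    "\<And>x. \<xi> \<bullet> (A *v x) = t * s * x $ i"
proof -
  let ?\<alpha> = "real CARD('n) / 2"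
  obtain A0 :: "real^'n^'n" and i :: 'n and s where A0: "A0 ** transpose A0 = Q" "invertible A0" "transpose A0 *v \<xi> = s *\<^sub>R axis i 1"
    by (rule posdef_factorization[OF Q, of \<xi>])
  have detA0: "det A0 \<noteq> 0" using A0(2) by (simp add: invertible_det_nz)
  have detQ: "det Q = (det A0)\<^sup>2" unfolding A0(1)[symmetric] by (simp add: det_mul power2_eq_square)
  have s2: "\<xi> \<bullet> (Q *v \<xi>) = s\<^sup>2"
  proof -
    have "\<xi> \<bullet> (Q *v \<xi>) = (transpose A0 *v \<xi>) \<bullet> (transpose A0 *v \<xi>)"
      unfolding A0(1)[symmetric] matrix_vector_mul_assoc[symmetric]
      by (simp only: inner_matrix_vector_mult transpose_transpose)
    then show ?thesis unfolding A0(3) by (simp add: inner_axis power2_eq_square)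
  qed
  have invQ: "invertible Q" using detQ detA0 by (simp add: invertible_det_nz)
  have quad: "(A0 *v x) \<bullet> (matrix_inv Q *v (A0 *v x)) = (norm x)\<^sup>2" for x
  proof -
    \<comment> \<open>From the factorisation of \<open>Q\<close>, its inverse sends
      \<open>A0 *v x\<close> to \<open>?B *v x\<close>; moving \<open>A0\<close> across the inner
      product then cancels \<open>?B\<close>.\<close>
    let ?B = "transpose (matrix_inv A0)"
    have tB: "transpose A0 ** ?B = mat 1"
      using matrix_inv_cancel[OF A0(2)] by (metis matrix_transpose_mul transpose_mat)
    have "Q *v (?B *v x) = A0 *v ((transpose A0 ** ?B) *v x)"
      unfolding A0(1)[symmetric] by (simp only: matrix_vector_mul_assoc matrix_mul_assoc)
    then have "Q *v (?B *v x) = A0 *v x" by (simp only: tB matrix_vector_mul_lid)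
    then have "matrix_inv Q *v (A0 *v x) = ?B *v x"
      using matrix_inv_cancel(2)[OF invQ] by (metis matrix_vector_mul_assoc matrix_vector_mul_lid)
    then have "(A0 *v x) \<bullet> (matrix_inv Q *v (A0 *v x)) = x \<bullet> (transpose A0 *v (?B *v x))"
      by (simp only: inner_matrix_vector_mult)
    also have "\<dots> = x \<bullet> x" by (simp only: matrix_vector_mul_assoc tB matrix_vector_mul_lid)
    finally show ?thesis by (simp add: power2_norm_eq_inner)
  qed
  define A where "A = t *\<^sub>R A0"
  have Ax: "A *v x = t *\<^sub>R (A0 *v x)" for x
    unfolding A_def by (simp add: scaleR_matrix_vector_assoc)
  have "A = (\<chi> i. t *s (A0 $ i))" by (simp add: A_def vec_eq_iff)
  then have detA: "det A = t ^ CARD('n) * det A0" by (simp add: det_rows_mul)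
  have detA': "det A \<noteq> 0" using detA detA0 t by simp
  have dens: "limit_density Q t (A *v x) = Gamma (?\<alpha> + 1) / pi powr ?\<alpha> / \<bar>det A\<bar> * indicator (cball 0 1) x" for x
  proof -
    have "(A *v x) \<bullet> (matrix_inv Q *v (A *v x)) = t\<^sup>2 * (norm x)\<^sup>2"
      unfolding Ax by (simp add: matrix_vector_mult_scaleR quad power2_eq_square)
    then have "(A *v x) \<bullet> (matrix_inv Q *v (A *v x)) \<le> t\<^sup>2 \<longleftrightarrow> x \<in> cball 0 1"
      using t by (simp add: mult_le_cancel_left2 abs_square_le_1)
    moreover have "sqrt (det Q) * t ^ CARD('n) = \<bar>det A\<bar>"
      using t by (simp add: detQ detA abs_mult)
    ultimately show ?thesis
      unfolding limit_density_def by (auto simp: divide_simps indicator_def)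
  qed
  have inner: "\<xi> \<bullet> (A *v x) = t * s * x $ i" for x
  proof -
    have "\<xi> \<bullet> (A *v x) = t * ((transpose A0 *v \<xi>) \<bullet> x)"
      by (simp only: Ax inner_scaleR_right inner_matrix_vector_mult transpose_transpose)
    also have "\<dots> = t * s * x $ i" unfolding A0(3) by (simp add: inner_axis inner_commute)
    finally show ?thesis .
  qed
  show ?thesis by (rule that[OF detA' s2[symmetric] dens inner])
qed

lemma borel_measurable_limit_density [measurable]: "limit_density Q t \<in> borel_measurable borel"
  unfolding limit_density_def[abs_def] by measurable

lemma limit_density_support:
  fixes Q :: "real^'n^'n"
  assumes Q: "pos_def Q" and t: "t > 0"
  shows "integrable lborel (limit_density Q t)" "bounded {y. limit_density Q t y \<noteq> 0}"
proof -
  \<comment> \<open>Only the shape of the density is wanted here, so the frequency is taken to be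
    0.\<close>
  obtain A :: "real^'n^'n" and i :: 'n and s where A: "det A \<noteq> 0" and dens: "\<And>x. limit_density Q t (A *v x)
      = Gamma (real CARD('n) / 2 + 1) / pi powr (real CARD('n) / 2) / \<bar>det A\<bar> * indicator (cball 0 1) x"
    by (rule limit_density_linear_image[OF Q t, of 0]) blast
  have "integrable lborel (\<lambda>x. limit_density Q t (A *v x))"
    unfolding dens by (intro integrable_mult_right integrable_real_indicator emeasure_bounded_finite) auto
  then show "integrable lborel (limit_density Q t)"
    using integrable_lborel_matrix_vector_mult[OF A borel_measurable_limit_density] by simp
  have "{y. limit_density Q t y \<noteq> 0} \<subseteq> (*v) A ` cball 0 1"
  proof
    fix y assume y: "y \<in> {y. limit_density Q t y \<noteq> 0}"
    have "y = A *v (matrix_inv A *v y)"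
      using matrix_inv_cancel(1)[of A] A by (simp add: matrix_vector_mul_assoc invertible_det_nz)
    with y dens[of "matrix_inv A *v y"] show "y \<in> (*v) A ` cball 0 1"
      by (intro image_eqI[of _ _ "matrix_inv A *v y"]) (auto simp: indicator_def split: if_splits)
  qed
  moreover have "compact ((*v) A ` cball 0 1)"
    by (intro compact_continuous_image continuous_intros) auto
  ultimately show "bounded {y. limit_density Q t y \<noteq> 0}"
    using bounded_subset compact_imp_bounded by blast
qed

text \<open>The substitution cancels the determinant and leaves the cosine integral over the unit
  ball with \<open>r = t * s\<close>. The series is the one that Mehler-Heine produces from the
  limit of n^2 z(\<epsilon> \<xi>).\<close>

theorem limit_density_cos_integral:
  fixes Q :: "real^'n^'n" and \<xi> :: "real^'n"
  assumes Q: "pos_def Q" and t: "t > 0"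
  shows "(LINT y|lborel. limit_density Q t y * cos (\<xi> \<bullet> y))
    = (\<Sum>k. (- (t\<^sup>2 * (\<xi> \<bullet> (Q *v \<xi>)) / 4)) ^ k / (pochhammer (real CARD('n) / 2 + 1) k * fact k))"
proof -
  let ?\<alpha> = "real CARD('n) / 2"
  obtain A :: "real^'n^'n" and i :: 'n and s where detA': "det A \<noteq> 0" and s2: "s\<^sup>2 = \<xi> \<bullet> (Q *v \<xi>)"
    and dens: "\<And>x. limit_density Q t (A *v x) = Gamma (?\<alpha> + 1) / pi powr ?\<alpha> / \<bar>det A\<bar> * indicator (cball 0 1) x"
    and inner: "\<And>x. \<xi> \<bullet> (A *v x) = t * s * x $ i"
    by (rule limit_density_linear_image[OF Q t, of \<xi>]) blast
  have "(LINT y|lborel. limit_density Q t y * cos (\<xi> \<bullet> y))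
    = \<bar>det A\<bar> * (LINT x|lborel. limit_density Q t (A *v x) * cos (\<xi> \<bullet> (A *v x)))"
    using integral_lborel_matrix_vector_mult[OF detA', of "\<lambda>y. limit_density Q t y * cos (\<xi> \<bullet> y)"] by simp
  also have "(LINT x|lborel. limit_density Q t (A *v x) * cos (\<xi> \<bullet> (A *v x)))
     = (LINT x|lborel. Gamma (?\<alpha> + 1) / pi powr ?\<alpha> / \<bar>det A\<bar> * (indicator (cball 0 1) x * cos (t * s * x $ i)))"
    by (simp only: dens inner mult.assoc)
  also have "\<bar>det A\<bar> * \<dots> = Gamma (?\<alpha> + 1) / pi powr ?\<alpha> * (LINT x|lborel. indicator (cball 0 1) x * cos (t * s * x $ i))"
    using detA' by simp
  also have "\<dots> = (\<Sum>k. (- ((t * s)\<^sup>2 / 4)) ^ k / (pochhammer (?\<alpha> + 1) k * fact k))"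
    by (rule unit_ball_cos_integral)
  finally show "(LINT y|lborel. limit_density Q t y * cos (\<xi> \<bullet> y))
    = (\<Sum>k. (- (t\<^sup>2 * (\<xi> \<bullet> (Q *v \<xi>)) / 4)) ^ k / (pochhammer (real CARD('n) / 2 + 1) k * fact k))"
    by (simp add: s2[symmetric] power_mult_distrib)
qed

section \<open>Weak convergence\<close>

text \<open>A zero of the quadratic form makes each weighted square vanish, so it lies in the kernel
  of the covariance, which full rank makes trivial.\<close>

lemma covariance_pos_def:
  fixes \<omega> :: "int^'n \<Rightarrow> real"
  assumes fin: "finite {v. \<omega> v \<noteq> 0}" and nonneg: "\<And>v. \<omega> v \<ge> 0" and fullrank: "rank (covariance \<omega>) = CARD('n)"
  shows "pos_def (covariance \<omega>)"
    and "x \<bullet> (covariance \<omega> *v x) = (\<Sum>v\<in>{v. \<omega> v \<noteq> 0}. \<omega> v * (x \<bullet> rvec v)\<^sup>2)"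
proof -
  show quad: "x \<bullet> (covariance \<omega> *v x) = (\<Sum>v\<in>{v. \<omega> v \<noteq> 0}. \<omega> v * (x \<bullet> rvec v)\<^sup>2)" for x
    by (simp add: covariance_mult inner_sum_right power2_eq_square inner_commute mult_ac)
  have "x \<bullet> (covariance \<omega> *v x) > 0" if x: "x \<noteq> 0" for x
  proof (rule ccontr)
    assume "\<not> x \<bullet> (covariance \<omega> *v x) > 0"
    moreover have "x \<bullet> (covariance \<omega> *v x) \<ge> 0" unfolding quad using nonneg by (intro sum_nonneg) auto
    ultimately have "(\<Sum>v\<in>{v. \<omega> v \<noteq> 0}. \<omega> v * (x \<bullet> rvec v)\<^sup>2) = 0" using quad by simp
    moreover have "(\<Sum>v\<in>{v. \<omega> v \<noteq> 0}. \<omega> v * (x \<bullet> rvec v)\<^sup>2) = 0 \<longleftrightarrow> (\<forall>v\<in>{v. \<omega> v \<noteq> 0}. \<omega> v * (x \<bullet> rvec v)\<^sup>2 = 0)"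
      using nonneg by (intro sum_nonneg_eq_0_iff fin) auto
    ultimately have "covariance \<omega> *v x = 0"
      unfolding covariance_mult by (intro sum.neutral) (auto simp: inner_commute)
    moreover have "inj ((*v) (covariance \<omega>))" using fullrank by (simp add: full_rank_injective)
    ultimately have "x = 0" by (metis injD matrix_vector_mult_0_right)
    with x show False by simp
  qed
  then show "pos_def (covariance \<omega>)"
    by (simp add: pos_def_def covariance_def transpose_def vec_eq_iff mult_ac)
qed

section \<open>Trigonometric polynomials as test functions\<close>

text \<open>Real trigonometric polynomials with arbitrary frequencies. The phase supplies sines and
  keeps the family closed under products with a single kind of generator; frequency 0 gives the
  constants.\<close>

inductive_set trig_span :: "('a::real_inner \<Rightarrow> real) set" where
  cos: "(\<lambda>y. cos (\<xi> \<bullet> y + \<phi>)) \<in> trig_span"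
| add: "f \<in> trig_span \<Longrightarrow> g \<in> trig_span \<Longrightarrow> (\<lambda>y. f y + g y) \<in> trig_span"
| scale: "f \<in> trig_span \<Longrightarrow> (\<lambda>y. c * f y) \<in> trig_span"

lemma trig_span_mult:
  assumes "f \<in> trig_span" "g \<in> trig_span"
  shows "(\<lambda>y. f y * g y) \<in> trig_span"
  using assms(1)
proof induction
  case (cos \<xi> \<phi>)
  show ?case
    using assms(2)
  proof induction
    case (cos \<xi>' \<phi>')
    have "(\<lambda>y. cos (\<xi> \<bullet> y + \<phi>) * cos (\<xi>' \<bullet> y + \<phi>'))
      = (\<lambda>y. 1/2 * cos ((\<xi> - \<xi>') \<bullet> y + (\<phi> - \<phi>')) + 1/2 * cos ((\<xi> + \<xi>') \<bullet> y + (\<phi> + \<phi>')))"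
    proof (rule ext)
      fix y
      have "cos a * cos b = 1/2 * cos (a - b) + 1/2 * cos (a + b)" for a b :: real
        by (simp add: cos_diff cos_add field_simps)
      from this[of "\<xi> \<bullet> y + \<phi>" "\<xi>' \<bullet> y + \<phi>'"]
      show "cos (\<xi> \<bullet> y + \<phi>) * cos (\<xi>' \<bullet> y + \<phi>')
        = 1/2 * cos ((\<xi> - \<xi>') \<bullet> y + (\<phi> - \<phi>')) + 1/2 * cos ((\<xi> + \<xi>') \<bullet> y + (\<phi> + \<phi>'))"
        by (simp add: inner_diff_left inner_add_left algebra_simps)
    qed
    then show ?case by (simp only:) (intro trig_span.intros)
  next
    case (add g h)
    then show ?case by (simp add: distrib_left trig_span.add)
  next
    case (scale g c)
    then show ?case using trig_span.scale[OF scale.IH, of c] by (simp add: mult_ac)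
  qed
next
  case (add f h)
  then show ?case by (simp add: distrib_right trig_span.add)
next
  case (scale f c)
  then show ?case using trig_span.scale[OF scale.IH, of c] by (simp add: mult_ac)
qed

lemma trig_span_const: "(\<lambda>_. c) \<in> trig_span"
  using trig_span.scale[OF trig_span.cos[of 0 0], of c] by simp

lemma trig_span_continuous: "f \<in> trig_span \<Longrightarrow> continuous_on S f"
  by (induction rule: trig_span.induct) (auto intro!: continuous_intros)

lemma trig_span_bounded: "f \<in> trig_span \<Longrightarrow> bounded (range f)"
proof (induction rule: trig_span.induct)
  case (cos \<xi> \<phi>)
  show ?case by (rule boundedI[of _ 1]) auto
next
  case (add f g)
  show ?case by (rule bounded_plus_comp[OF add.IH])
next
  case (scale f c)
  then show ?case using bounded_scaling[of "range f" c] by (simp add: image_image)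
qed

lemma trig_span_approx:
  fixes f :: "'a::euclidean_space \<Rightarrow> real"
  assumes "compact S" "continuous_on S f" "e > 0"
  obtains g where "g \<in> trig_span" "\<And>x. x \<in> S \<Longrightarrow> \<bar>f x - g x\<bar> < e"
proof -
  have "\<exists>g. g \<in> trig_span \<and> (\<forall>x\<in>S. \<bar>f x - g x\<bar> < e)"
  proof (rule Stone_Weierstrass_HOL[where P = "\<lambda>g. g \<in> trig_span"])
    fix x y :: 'a assume "x \<in> S \<and> y \<in> S \<and> x \<noteq> y"
    then have nz: "y - x \<noteq> 0" by auto
    \<comment> \<open>Scaled so that the phase advances by pi/2 from \<open>x\<close> to
      \<open>y\<close>; after shifting the phase to 0 at \<open>x\<close>, the cosine takes the
      values 1 and 0.\<close>
    define \<xi> where "\<xi> = (pi / 2 / ((y - x) \<bullet> (y - x))) *\<^sub>R (y - x)"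
    have "\<xi> \<bullet> (y - x) = pi / 2" using nz by (simp add: \<xi>_def)
    then have y: "\<xi> \<bullet> y = pi / 2 + \<xi> \<bullet> x" by (simp add: inner_diff_right)
    have "(\<lambda>u. cos (\<xi> \<bullet> u + (- (\<xi> \<bullet> x)))) \<in> trig_span" by (rule trig_span.cos)
    moreover have "cos (\<xi> \<bullet> x + (- (\<xi> \<bullet> x))) \<noteq> cos (\<xi> \<bullet> y + (- (\<xi> \<bullet> x)))" unfolding y by simp
    ultimately show "\<exists>g. g \<in> trig_span \<and> g x \<noteq> g y" by blast
  qed (use assms in \<open>auto intro: trig_span_const trig_span_continuous trig_span.add trig_span_mult\<close>)
  with that show ?thesis by blast
qed

section \<open>Symmetry of the limit and the scaling limits\<close>

lemma integral_lborel_reflect: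
  fixes g :: "'a::euclidean_space \<Rightarrow> real"
  assumes [measurable]: "g \<in> borel_measurable borel"
  shows "(LINT y|lborel. g (- y)) = (LINT y|lborel. g y)"
proof -
  have "(lborel :: 'a measure) = distr lborel borel uminus"
    using lborel_affine[of "-1" "0::'a"] by (simp add: density_1)
  then have "(LINT y|lborel. g y) = (LINT y|distr lborel borel uminus. g y)" by simp
  also have "\<dots> = (LINT y|lborel. g (- y))"
    by (simp add: integral_distr)
  finally show ?thesis ..
qed

lemma limit_density_uminus: "limit_density Q t (- y) = limit_density Q t y"
proof -
  have "matrix_inv Q *v (- y) = - (matrix_inv Q *v y)"
    using matrix_vector_mult_scaleR[of "matrix_inv Q" "-1" y] by simp
  then show ?thesis by (simp add: limit_density_def)
qed

lemma tendsto_sin_div_at_right: "((\<lambda>\<epsilon>. sin (\<epsilon> * b) / \<epsilon>) \<longlongrightarrow> b) (at_right 0)" for b :: real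
proof -
  have "((\<lambda>\<epsilon>. sin (\<epsilon> * b)) has_real_derivative b) (at 0)"
    by (auto intro!: derivative_eq_intros)
  then have "((\<lambda>\<epsilon>. sin (\<epsilon> * b) / \<epsilon>) \<longlongrightarrow> b) (at 0)" by (simp add: DERIV_def)
  then show ?thesis by (rule tendsto_within_subset) simp
qed

lemma filterlim_nat_floor_div:
  fixes t :: real
  assumes t: "t > 0"
  shows "filterlim (\<lambda>\<epsilon>. nat \<lfloor>t / \<epsilon>\<rfloor>) at_top (at_right 0)"
    and "((\<lambda>\<epsilon>. real (nat \<lfloor>t / \<epsilon>\<rfloor>) * \<epsilon>) \<longlongrightarrow> t) (at_right 0)"
proof -
  have pos: "\<forall>\<^sub>F \<epsilon>::real in at_right 0. \<epsilon> > 0" by (simp add: eventually_at_right_less)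
  have bd: "real (nat \<lfloor>t / \<epsilon>\<rfloor>) * \<epsilon> \<le> t" "t - \<epsilon> \<le> real (nat \<lfloor>t / \<epsilon>\<rfloor>) * \<epsilon>" if e: "\<epsilon> > 0" for \<epsilon>
  proof -
    have "0 \<le> \<lfloor>t / \<epsilon>\<rfloor>" using t e by simp
    then have n: "real (nat \<lfloor>t / \<epsilon>\<rfloor>) = of_int \<lfloor>t / \<epsilon>\<rfloor>" by simp
    show "real (nat \<lfloor>t / \<epsilon>\<rfloor>) * \<epsilon> \<le> t"
      unfolding n using pos_le_divide_eq[OF e] of_int_floor_le by blast
    have "t / \<epsilon> - 1 \<le> of_int \<lfloor>t / \<epsilon>\<rfloor>" by linarith
    then show "t - \<epsilon> \<le> real (nat \<lfloor>t / \<epsilon>\<rfloor>) * \<epsilon>"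
      using e unfolding n by (simp add: field_simps)
  qed
  show "((\<lambda>\<epsilon>. real (nat \<lfloor>t / \<epsilon>\<rfloor>) * \<epsilon>) \<longlongrightarrow> t) (at_right 0)"
  proof (rule tendsto_sandwich)
    show "\<forall>\<^sub>F \<epsilon> in at_right 0. t - \<epsilon> \<le> real (nat \<lfloor>t / \<epsilon>\<rfloor>) * \<epsilon>"
      using pos by eventually_elim (rule bd)
    show "\<forall>\<^sub>F \<epsilon> in at_right 0. real (nat \<lfloor>t / \<epsilon>\<rfloor>) * \<epsilon> \<le> t"
      using pos by eventually_elim (rule bd)
    have "((\<lambda>\<epsilon>::real. t - \<epsilon>) \<longlongrightarrow> t - 0) (at_right 0)" by (intro tendsto_intros)
    then show "((\<lambda>\<epsilon>::real. t - \<epsilon>) \<longlongrightarrow> t) (at_right 0)" by simp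
  qed simp
  show "filterlim (\<lambda>\<epsilon>. nat \<lfloor>t / \<epsilon>\<rfloor>) at_top (at_right 0)"
    unfolding filterlim_at_top
  proof
    fix Z :: nat
    have "\<forall>\<^sub>F \<epsilon>::real in at_right 0. \<epsilon> < t / (real Z + 1)"
      using eventually_at_right_real[of 0 "t / (real Z + 1)"] t by (auto elim: eventually_mono)
    with pos show "\<forall>\<^sub>F \<epsilon> in at_right 0. Z \<le> nat \<lfloor>t / \<epsilon>\<rfloor>"
    proof eventually_elim
      case (elim \<epsilon>)
      then have "(real Z + 1) * \<epsilon> < t" by (simp add: field_simps)
      then have "real Z \<le> t / \<epsilon>" using elim by (simp add: field_simps)
      then show ?case by (rule le_nat_floor)
    qed
  qed
qed

theorem theorem3:
  fixes \<omega> :: "int^'n \<Rightarrow> real"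
  assumes fin: "finite {v. \<omega> v \<noteq> 0}"
    and nonneg: "\<And>v. \<omega> v \<ge> 0"
    and total: "(\<Sum>v\<in>{v. \<omega> v \<noteq> 0}. \<omega> v) = 1"
    and centered: "(\<Sum>v\<in>{v. \<omega> v \<noteq> 0}. \<omega> v *\<^sub>R rvec v) = 0"
    and symm: "\<And>v. \<omega> (- v) = \<omega> v"
    and aper: "aperiodic \<omega>"
    and fullrank: "rank (covariance \<omega>) = CARD('n)"
    and t: "t > 0"
    and f_cont: "continuous_on UNIV f"
    and f_bdd: "bounded (range f)"
  shows "((\<lambda>\<epsilon>. infsum (\<lambda>v. jacobi \<omega> (nat \<lfloor>t / \<epsilon>\<rfloor>) v * f (\<epsilon> *\<^sub>R rvec v)) UNIV)
           \<longlongrightarrow> (LINT y|lborel. limit_density (covariance \<omega>) t y * f y)) (at_right 0)"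
proof -
  let ?Q = "covariance \<omega>"
  let ?u = "limit_density ?Q t"
  let ?S = "\<lambda>n. {v. jacobi \<omega> n v \<noteq> 0}"
  define N where "N \<epsilon> = nat \<lfloor>t / \<epsilon>\<rfloor>" for \<epsilon>
  define L where "L g \<epsilon> = (\<Sum>v\<in>?S (N \<epsilon>). jacobi \<omega> (N \<epsilon>) v * g (\<epsilon> *\<^sub>R rvec v))" for g :: "real^'n \<Rightarrow> real" and \<epsilon>
  define I where "I g = (LINT y|lborel. ?u y * g y)" for g :: "real^'n \<Rightarrow> real"
  have L_eq: "infsum (\<lambda>v. jacobi \<omega> (nat \<lfloor>t / \<epsilon>\<rfloor>) v * g (\<epsilon> *\<^sub>R rvec v)) UNIV = L g \<epsilon>" for g \<epsilon>
    unfolding L_def N_def using finite_jacobi_support[OF fin] by (intro infsum_finite_support) auto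
  note Q = covariance_pos_def(1)[OF fin nonneg fullrank]
  note N_top = filterlim_nat_floor_div(1)[OF t, folded N_def]
  note N_lim = filterlim_nat_floor_div(2)[OF t, folded N_def]
  have u_int: "integrable lborel ?u" by (rule limit_density_support(1)[OF Q t])
  have int_u: "integrable lborel (\<lambda>y. ?u y * g y)" if g: "continuous_on UNIV g" "bounded (range g)" for g :: "real^'n \<Rightarrow> real"
  proof -
    obtain M where M: "\<And>y. \<bar>g y\<bar> \<le> M" using g(2) by (auto simp: bounded_iff)
    have [measurable]: "g \<in> borel_measurable borel" using g(1) by (rule borel_measurable_continuous_onI)
    show ?thesis
    proof (rule Bochner_Integration.integrable_bound)
      show "integrable lborel (\<lambda>y. M * ?u y)" using u_int by (rule integrable_mult_right)
      show "AE y in lborel. norm (?u y * g y) \<le> norm (M * ?u y)"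
      proof (intro AE_I2)
        fix y
        have "\<bar>g y\<bar> \<le> \<bar>M\<bar>" using M[of y] by linarith
        then show "norm (?u y * g y) \<le> norm (M * ?u y)"
          by (simp add: abs_mult mult.commute mult_right_mono)
      qed
    qed measurable
  qed

  have trig_conv: "(L g \<longlongrightarrow> I g) (at_right 0)" if "g \<in> trig_span" for g
    using that
  proof induction
    case (cos \<xi> \<phi>)
    define q where "q = \<xi> \<bullet> (?Q *v \<xi>)"
    \<comment> \<open>Inserting \<epsilon>/\<epsilon> splits each term of n^2 z(\<epsilon> \<xi>)
      into two convergent factors, one tending to \<open>t\<close> and one to the derivative of the
      sine at 0. This produces the quadratic form of the covariance.\<close>
    have "((\<lambda>\<epsilon>. \<Sum>v\<in>{v. \<omega> v \<noteq> 0}. \<omega> v * (real (N \<epsilon>) * \<epsilon> * (sin (\<epsilon> * (\<xi> \<bullet> rvec v / 2)) / \<epsilon>))\<^sup>2)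
       \<longlongrightarrow> (\<Sum>v\<in>{v. \<omega> v \<noteq> 0}. \<omega> v * (t * (\<xi> \<bullet> rvec v / 2))\<^sup>2)) (at_right 0)"
      by (intro tendsto_intros N_lim tendsto_sin_div_at_right)
    also have "(\<Sum>v\<in>{v. \<omega> v \<noteq> 0}. \<omega> v * (t * (\<xi> \<bullet> rvec v / 2))\<^sup>2) = t\<^sup>2 * q / 4"
      unfolding q_def covariance_pos_def(2)[OF fin nonneg fullrank]
      by (simp add: sum_distrib_left sum_divide_distrib power_mult_distrib power_divide mult_ac)
    finally have "((\<lambda>\<epsilon>. \<Sum>v\<in>{v. \<omega> v \<noteq> 0}. \<omega> v * (real (N \<epsilon>) * \<epsilon> * (sin (\<epsilon> * (\<xi> \<bullet> rvec v / 2)) / \<epsilon>))\<^sup>2)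
       \<longlongrightarrow> t\<^sup>2 * q / 4) (at_right 0)" .
    moreover have "\<forall>\<^sub>F \<epsilon> in at_right 0. (\<Sum>v\<in>{v. \<omega> v \<noteq> 0}. \<omega> v * (real (N \<epsilon>) * \<epsilon> * (sin (\<epsilon> * (\<xi> \<bullet> rvec v / 2)) / \<epsilon>))\<^sup>2)
       = (real (N \<epsilon>))\<^sup>2 * walk_symbol \<omega> (\<epsilon> *\<^sub>R \<xi>)"
      using eventually_at_right_less[of "0::real"]
    proof eventually_elim
      case (elim \<epsilon>)
      then show ?case
        by (simp add: walk_symbol_def sum_distrib_left power_mult_distrib mult_ac)
    qed
    ultimately have "((\<lambda>\<epsilon>. (real (N \<epsilon>))\<^sup>2 * walk_symbol \<omega> (\<epsilon> *\<^sub>R \<xi>)) \<longlongrightarrow> t\<^sup>2 * q / 4) (at_right 0)"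
      by (simp add: filterlim_cong)
    then have "((\<lambda>\<epsilon>. poly (jacobi_poly (real CARD('n) / 2) (N \<epsilon>)) (walk_symbol \<omega> (\<epsilon> *\<^sub>R \<xi>)))
      \<longlongrightarrow> (\<Sum>k. (- (t\<^sup>2 * q / 4)) ^ k / (pochhammer (real CARD('n) / 2 + 1) k * fact k))) (at_right 0)"
      by (intro jacobi_poly_Mehler_Heine N_top) auto
    also have "(\<Sum>k. (- (t\<^sup>2 * q / 4)) ^ k / (pochhammer (real CARD('n) / 2 + 1) k * fact k)) = I (\<lambda>y. cos (\<xi> \<bullet> y))"
      unfolding I_def q_def by (rule limit_density_cos_integral[OF Q t, symmetric])
    finally have lim: "((\<lambda>\<epsilon>. cos \<phi> * poly (jacobi_poly (real CARD('n) / 2) (N \<epsilon>)) (walk_symbol \<omega> (\<epsilon> *\<^sub>R \<xi>)))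
      \<longlongrightarrow> cos \<phi> * I (\<lambda>y. cos (\<xi> \<bullet> y))) (at_right 0)"
      by (intro tendsto_intros)
    \<comment> \<open>The transform of the iterate is real, so its sine part is zero and a phase
      shift multiplies the value by \<open>cos \<phi>\<close>.\<close>
    have Lcos: "L (\<lambda>y. cos (\<xi> \<bullet> y + \<phi>)) \<epsilon> = cos \<phi> * poly (jacobi_poly (real CARD('n) / 2) (N \<epsilon>)) (walk_symbol \<omega> (\<epsilon> *\<^sub>R \<xi>))" for \<epsilon>
    proof -
      have "complex_of_real (poly (jacobi_poly (real CARD('n) / 2) (N \<epsilon>)) (walk_symbol \<omega> (\<epsilon> *\<^sub>R \<xi>)))
        = (\<Sum>v\<in>?S (N \<epsilon>). complex_of_real (jacobi \<omega> (N \<epsilon>) v) * cis ((\<epsilon> *\<^sub>R \<xi>) \<bullet> rvec v))" (is "complex_of_real ?p = ?s")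
        unfolding fourier_jacobi[OF fin total symm, symmetric]
        by (rule fourier_eq_sum) (use finite_jacobi_support[OF fin] in auto)
      then have "Re (cis \<phi> * complex_of_real ?p) = Re (cis \<phi> * ?s)" by simp
      then have "cos \<phi> * ?p = (\<Sum>v\<in>?S (N \<epsilon>). jacobi \<omega> (N \<epsilon>) v * (cos \<phi> * cos ((\<epsilon> *\<^sub>R \<xi>) \<bullet> rvec v) - sin \<phi> * sin ((\<epsilon> *\<^sub>R \<xi>) \<bullet> rvec v)))"
        by (simp add: sum_distrib_left sum_subtractf right_diff_distrib mult_ac)
      then show ?thesis by (simp add: L_def cos_add mult_ac)
    qed
    \<comment> \<open>The same reduction for the limit, where the sine part vanishes because the
      density is even.\<close>
    have Icos: "I (\<lambda>y. cos (\<xi> \<bullet> y + \<phi>)) = cos \<phi> * I (\<lambda>y. cos (\<xi> \<bullet> y))"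
    proof -
      have ic: "integrable lborel (\<lambda>y. ?u y * cos (\<xi> \<bullet> y))" and isn: "integrable lborel (\<lambda>y. ?u y * sin (\<xi> \<bullet> y))"
        by (intro int_u continuous_intros boundedI[of _ 1]; auto)+
      have "(LINT y|lborel. ?u y * sin (\<xi> \<bullet> y)) = (LINT y|lborel. ?u (- y) * sin (\<xi> \<bullet> (- y)))"
        by (rule integral_lborel_reflect[symmetric]) measurable
      then have "(LINT y|lborel. ?u y * sin (\<xi> \<bullet> y)) = 0" by (simp add: limit_density_uminus)
      moreover have "I (\<lambda>y. cos (\<xi> \<bullet> y + \<phi>)) = (LINT y|lborel. cos \<phi> * (?u y * cos (\<xi> \<bullet> y)) - sin \<phi> * (?u y * sin (\<xi> \<bullet> y)))"
        unfolding I_def by (intro Bochner_Integration.integral_cong) (auto simp: cos_add algebra_simps)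
      ultimately show ?thesis using ic isn by (simp add: I_def)
    qed
    show ?case using lim by (simp only: Lcos[symmetric] Icos)
  next
    case (add g h)
    have "L (\<lambda>y. g y + h y) = (\<lambda>\<epsilon>. L g \<epsilon> + L h \<epsilon>)"
      by (rule ext) (simp add: L_def distrib_left sum.distrib)
    moreover have "I (\<lambda>y. g y + h y) = I g + I h"
      unfolding I_def distrib_left
      using add by (intro Bochner_Integration.integral_add int_u trig_span_continuous trig_span_bounded)
    ultimately show ?case using tendsto_add[OF add.IH] by simp
  next
    case (scale g c)
    have "L (\<lambda>y. c * g y) = (\<lambda>\<epsilon>. c * L g \<epsilon>)"
      by (rule ext) (simp add: L_def sum_distrib_left mult_ac)
    moreover have "I (\<lambda>y. c * g y) = c * I g" unfolding I_def by (simp add: mult.left_commute)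
    ultimately show ?case using tendsto_mult_left[OF scale.IH, of c] by simp
  qed

  obtain B n0 where B: "B \<ge> 0" and l1: "\<And>n. n \<ge> n0 \<Longrightarrow> (\<Sum>v\<in>?S n. \<bar>jacobi \<omega> n v\<bar>) \<le> B"
    using jacobi_l1_bound[OF fin nonneg total symm aper fullrank] by blast
  obtain r1 where r1: "\<And>y. ?u y \<noteq> 0 \<Longrightarrow> norm y \<le> r1"
    using limit_density_support(2)[OF Q t] by (auto simp: bounded_iff)
  obtain R :: int where R: "R \<ge> 0" "\<And>v i. \<omega> v \<noteq> 0 \<Longrightarrow> \<bar>v $ i\<bar> \<le> R"
    using finite_support_radius[OF fin] by blast
  \<comment> \<open>One radius for the limit and all rescaled iterates: speed \<open>R\<close>
    during time \<open>t\<close> bounds every coordinate, and the dimension enters by bounding the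
    Euclidean norm by the l1 norm.\<close>
  define r where "r = max r1 (real CARD('n) * (real_of_int R * t))"
  have supp_L: "norm (\<epsilon> *\<^sub>R rvec v) \<le> r" if \<epsilon>: "\<epsilon> > 0" and v: "v \<in> ?S (N \<epsilon>)" for \<epsilon> v
  proof -
    have "real (N \<epsilon>) * \<epsilon> \<le> t"
    proof -
      have "real (N \<epsilon>) \<le> t / \<epsilon>" unfolding N_def using t \<epsilon> by (intro of_nat_floor) auto
      then show ?thesis using \<epsilon> by (simp add: field_simps)
    qed
    have "norm (\<epsilon> *\<^sub>R rvec v) \<le> (\<Sum>i\<in>UNIV. \<bar>(\<epsilon> *\<^sub>R rvec v) $ i\<bar>)" by (rule norm_le_l1_cart)
    also have "\<dots> \<le> (\<Sum>i\<in>(UNIV :: 'n set). real_of_int R * t)"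
    proof (rule sum_mono)
      fix i
      have "\<bar>v $ i\<bar> \<le> R * int (N \<epsilon>)" using jacobi_support_bound[OF fin R] v by blast
      then have "\<bar>real_of_int (v $ i)\<bar> \<le> real_of_int R * real (N \<epsilon>)"
        by (metis of_int_abs of_int_le_iff of_int_mult of_int_of_nat_eq)
      then have "\<epsilon> * \<bar>real_of_int (v $ i)\<bar> \<le> \<epsilon> * (real_of_int R * real (N \<epsilon>))" using \<epsilon> by (intro mult_left_mono) auto
      also have "\<dots> = real_of_int R * (real (N \<epsilon>) * \<epsilon>)" by simp
      also have "\<dots> \<le> real_of_int R * t" using R(1) \<open>real (N \<epsilon>) * \<epsilon> \<le> t\<close> by (intro mult_left_mono) auto
      finally show "\<bar>(\<epsilon> *\<^sub>R rvec v) $ i\<bar> \<le> real_of_int R * t" using \<epsilon> by (simp add: rvec_def abs_mult)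
    qed
    finally show ?thesis by (simp add: r_def)
  qed
  define D where "D = (LINT y|lborel. \<bar>?u y\<bar>)"
  have D: "D \<ge> 0" by (simp add: D_def)

  have "(L f \<longlongrightarrow> I f) (at_right 0)"
  proof (rule tendstoI)
    fix e :: real assume e: "e > 0"
    \<comment> \<open>The error budget: B \<delta> for replacing \<open>f\<close> by
      \<open>g\<close> in the iterates, D \<delta> in the limit, and \<delta> for the convergence of
      \<open>g\<close>.\<close>
    define \<delta> where "\<delta> = e / (B + D + 2)"
    have \<delta>: "\<delta> > 0" using e B D by (simp add: \<delta>_def)
    obtain g where g: "g \<in> trig_span" and fg: "\<And>y. y \<in> cball 0 r \<Longrightarrow> \<bar>f y - g y\<bar> < \<delta>"
      using trig_span_approx[of "cball 0 r" f \<delta>] continuous_on_subset[OF f_cont] \<delta> by auto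
    have iu: "integrable lborel (\<lambda>y. ?u y * f y)" "integrable lborel (\<lambda>y. ?u y * g y)"
      using int_u f_cont f_bdd trig_span_continuous[OF g] trig_span_bounded[OF g] by auto
    have "\<bar>I f - I g\<bar> = \<bar>LINT y|lborel. ?u y * f y - ?u y * g y\<bar>"
      unfolding I_def using iu by simp
    also have "\<dots> \<le> (LINT y|lborel. \<bar>?u y * f y - ?u y * g y\<bar>)"
      by (rule integral_abs_bound)
    also have "\<dots> \<le> (LINT y|lborel. \<delta> * \<bar>?u y\<bar>)"
    proof (rule integral_mono)
      show "integrable lborel (\<lambda>y. \<bar>?u y * f y - ?u y * g y\<bar>)" using iu by (intro integrable_abs Bochner_Integration.integrable_diff)
      show "integrable lborel (\<lambda>y. \<delta> * \<bar>?u y\<bar>)" using u_int by (intro integrable_mult_right integrable_abs)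
      fix y
      show "\<bar>?u y * f y - ?u y * g y\<bar> \<le> \<delta> * \<bar>?u y\<bar>"
      proof (cases "?u y = 0")
        case False
        then have "y \<in> cball 0 r" using r1[of y] by (simp add: r_def)
        then have "\<bar>?u y\<bar> * \<bar>f y - g y\<bar> \<le> \<bar>?u y\<bar> * \<delta>" using fg[of y] by (intro mult_left_mono) auto
        then show ?thesis by (simp add: abs_mult[symmetric] right_diff_distrib mult.commute)
      qed simp
    qed
    also have "\<dots> = \<delta> * D" by (simp add: D_def)
    finally have Ifg: "\<bar>I f - I g\<bar> \<le> \<delta> * D" .
    have "\<forall>\<^sub>F \<epsilon> in at_right 0. dist (L g \<epsilon>) (I g) < \<delta>"
      using tendstoD[OF trig_conv[OF g] \<delta>] .
    moreover have "\<forall>\<^sub>F \<epsilon> in at_right 0. n0 \<le> N \<epsilon>" using N_top by (simp add: filterlim_at_top)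
    moreover have "\<forall>\<^sub>F \<epsilon>::real in at_right 0. \<epsilon> > 0" by (simp add: eventually_at_right_less)
    ultimately show "\<forall>\<^sub>F \<epsilon> in at_right 0. dist (L f \<epsilon>) (I f) < e"
    proof eventually_elim
      case (elim \<epsilon>)
      have "\<bar>L f \<epsilon> - L g \<epsilon>\<bar> = \<bar>\<Sum>v\<in>?S (N \<epsilon>). jacobi \<omega> (N \<epsilon>) v * (f (\<epsilon> *\<^sub>R rvec v) - g (\<epsilon> *\<^sub>R rvec v))\<bar>"
        by (simp add: L_def sum_subtractf right_diff_distrib)
      also have "\<dots> \<le> (\<Sum>v\<in>?S (N \<epsilon>). \<bar>jacobi \<omega> (N \<epsilon>) v * (f (\<epsilon> *\<^sub>R rvec v) - g (\<epsilon> *\<^sub>R rvec v))\<bar>)"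
        by (rule sum_abs)
      also have "\<dots> \<le> (\<Sum>v\<in>?S (N \<epsilon>). \<bar>jacobi \<omega> (N \<epsilon>) v\<bar> * \<delta>)"
      proof (rule sum_mono)
        fix v assume "v \<in> ?S (N \<epsilon>)"
        then have "\<bar>f (\<epsilon> *\<^sub>R rvec v) - g (\<epsilon> *\<^sub>R rvec v)\<bar> \<le> \<delta>"
          using supp_L[OF elim(3)] fg[of "\<epsilon> *\<^sub>R rvec v"] by (auto simp del: norm_scaleR)
        then show "\<bar>jacobi \<omega> (N \<epsilon>) v * (f (\<epsilon> *\<^sub>R rvec v) - g (\<epsilon> *\<^sub>R rvec v))\<bar> \<le> \<bar>jacobi \<omega> (N \<epsilon>) v\<bar> * \<delta>"
          unfolding abs_mult by (intro mult_left_mono) auto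
      qed
      also have "\<dots> \<le> B * \<delta>"
        unfolding sum_distrib_right[symmetric] using l1[OF elim(2)] \<delta> by (intro mult_right_mono) auto
      finally have "\<bar>L f \<epsilon> - L g \<epsilon>\<bar> \<le> B * \<delta>" .
      moreover have "\<bar>L g \<epsilon> - I g\<bar> < \<delta>" using elim(1) by (simp add: dist_real_def)
      ultimately have "\<bar>L f \<epsilon> - I f\<bar> < B * \<delta> + \<delta> + \<delta> * D" using Ifg by linarith
      also have "\<dots> \<le> (B + D + 2) * \<delta>" using \<delta> by (simp add: algebra_simps)
      also have "\<dots> = e" using B D by (simp add: \<delta>_def)
      finally show ?case by (simp add: dist_real_def)
    qed
  qed
  then show ?thesis unfolding L_eq I_def .
qed

end
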